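(* Consider the two-player linear quadratic doubly stochastic game described in the context, with the standing assumptions on the coefficients and the commutation conditions stated there. Let $(x_t,y_t^1,y_t^2,k_t,h_t^1,h_t^2)$ be the solution of the forward-backward doubly stochastic system $$\begin{cases}dx_t=\big[Ax_t-B^1(N^1)^{-1}(B^1)^Ty_t^1-B^2(N^2)^{-1}(B^2)^Ty_t^2+Ck_t+\alpha_t\big]dt+\big[Dx_t+Ek_t+\beta_t\big]dW_t-k_t\,\hat dB_t,\\ dy_t^1=-\big[A^Ty_t^1+D^Th_t^1+R^1x_t\big]dt-\big(C^Ty_t^1+E^Th_t^1+P^1k_t\big)\hat dB_t+h_t^1dW_t,\\ dy_t^2=-\big[A^Ty_t^2+D^Th_t^2+R^2x_t\big]dt-\big(C^Ty_t^2+E^Th_t^2+P^2k_t\big)\hat dB_t+h_t^2dW_t,\\ x_0=a,\quad y_T^1=Q^1x_T,\quad y_T^2=Q^2x_T.\end{cases}$$ Then the pair $$u_t^1=-(N^1)^{-1}(B^1)^Ty_t^1,\qquad u_t^2=-(N^2)^{-1}(B^2)^Ty_t^2,\qquad t\in[0,T],$$ is a Nash equilibrium point of the game, i.e. $J^1(u^1,u^2)\le J^1(v^1,u^2)$ for every admissible control $v^1$ and $J^2(u^1,u^2)\le J^2(u^1,v^2)$ for every admissible control $v^2$.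
   Context: **Probabilistic setting.** $(\Omega,\mathcal F,P)$ is a complete probability space, $T>0$, and $W$, $B$ are mutually independent standard (one-dimensional) Brownian motions on $[0,T]$. $\mathcal N$ is the class of $P$-null sets, $\mathcal F_t=\mathcal F_t^W\vee\mathcal F_{t,T}^B$ with $\mathcal F_t^W=\mathcal N\vee\sigma\{W_r-W_0;0\le r\le t\}$, $\mathcal F_{t,T}^B=\mathcal N\vee\sigma\{B_r-B_t;t\le r\le T\}$. A process $X$ is $\mathcal F_t$-progressively measurable if for each $t$ its restriction to $\Omega\times[0,t]$ is measurable with respect to $(\mathcal F_t^W\times\mathcal B([0,t]))\vee(\mathcal F_{t,T}^B\times\mathcal B([t,T]))$. $M^2(0,T;\mathbf R^m)$ is the space of $\mathbf R^m$-valued $\mathcal F_t$-progressively measurable processes with $\mathbf E\int_0^T|v_t|^2dt<\infty$; solutions of the equations are understood in such spaces. $dW$ is the forward and $\hat dB$ the backward Itô integral. **Game.** An admissible control is an $\mathcal F_t$-progressively measurable square integrable process with values in $\mathbf R^k$. For admissible $v=(v^1,v^2)$ the state is the pair $(x^v,k^v)$ ($\mathbf R^n\times\mathbf R^n$-valued) solving $$dx_t^v=\big[Ax_t^v+B^1v_t^1+B^2v_t^2+Ck_t^v+\alpha_t\big]dt+\big[Dx_t^v+Ek_t^v+\beta_t\big]dW_t-k_t^v\,\hat dB_t,\qquad x_0^v=a,$$ where $A,C,D,E$ are bounded $n\times n$ matrices, $0<|E|<1$, $B^1,B^2$ are bounded $n\times k$ matrices, and $\alpha,\beta$ are adapted square-integrable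 processes. The costs are, for $i=1,2$, $$J^i(v)=\tfrac12\mathbf E\Big[\int_0^T\big(\langle R^ix_t^v,x_t^v\rangle+\langle N^iv_t^i,v_t^i\rangle+\langle P^ik_t^v,k_t^v\rangle\big)dt+\langle Q^ix_T^v,x_T^v\rangle\Big],$$ where $Q^i,R^i,P^i$ are $n\times n$ nonnegative symmetric bounded matrices and $N^i$ are $k\times k$ positive symmetric bounded matrices with bounded inverses $(N^i)^{-1}$. **Commutation conditions.** For $i=1,2$, the matrix $B^i(N^i)^{-1}(B^i)^T$ commutes with each of $A^T,\ C^T,\ D^T,\ E^T,\ P^1,\ P^2$. *)

theory Defs
  imports "HOL-Probability.Probability"
begin

section \<open>Brownian motions and the two-sided information flow\<close>

definition standard_brownian_motion :: "'a measure \<Rightarrow> real \<Rightarrow> (real \<Rightarrow> 'a \<Rightarrow> real) \<Rightarrow> bool" where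
  "standard_brownian_motion M T X \<longleftrightarrow>
     (\<forall>t\<in>{0..T}. X t \<in> borel_measurable M) \<and>
     (AE \<omega> in M. X 0 \<omega> = 0) \<and>
     (AE \<omega> in M. continuous_on {0..T} (\<lambda>t. X t \<omega>)) \<and>
     (\<forall>s t. 0 \<le> s \<and> s < t \<and> t \<le> T \<longrightarrow>
        distributed M lborel (\<lambda>\<omega>. X t \<omega> - X s \<omega>)
          (\<lambda>x. ennreal (normal_density 0 (sqrt (t - s)) x))) \<and>
     (\<forall>n (\<tau>::nat \<Rightarrow> real). mono_on {..n} \<tau> \<and> \<tau> ` {..n} \<subseteq> {0..T} \<longrightarrow>
        prob_space.indep_vars M (\<lambda>_. borel) (\<lambda>i \<omega>. X (\<tau> (Suc i)) \<omega> - X (\<tau> i) \<omega>) {..<n})"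

definition independent_processes ::
  "'a measure \<Rightarrow> real \<Rightarrow> (real \<Rightarrow> 'a \<Rightarrow> real) \<Rightarrow> (real \<Rightarrow> 'a \<Rightarrow> real) \<Rightarrow> bool" where
  "independent_processes M T X Y \<longleftrightarrow>
     prob_space.indep_var M
       (Pi\<^sub>M {0..T} (\<lambda>_. borel)) (\<lambda>\<omega>. \<lambda>t\<in>{0..T}. X t \<omega>)
       (Pi\<^sub>M {0..T} (\<lambda>_. borel)) (\<lambda>\<omega>. \<lambda>t\<in>{0..T}. Y t \<omega>)"

text \<open>
  The sigma-algebra generated by the null sets and the increments \<open>X r - X s\<close>, \<open>s \<le> r \<le> t\<close>.
\<close>
definition increment_algebra :: "'a measure \<Rightarrow> (real \<Rightarrow> 'a \<Rightarrow> real) \<Rightarrow> real \<Rightarrow> real \<Rightarrow> 'a measure" where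
  "increment_algebra M X s t =
     sigma (space M)
       (null_sets M \<union>
        {(\<lambda>\<omega>. X r \<omega> - X s \<omega>) -` S \<inter> space M | r S. r \<in> {s..t} \<and> S \<in> sets borel})"

text \<open>
  \<open>info M W B T s t\<close> is the join of \<open>F\<^sup>W\<close> up to time \<open>s\<close> and of \<open>F\<^sup>B\<close> from time \<open>t\<close> on.
  The information at time \<open>t\<close> is \<open>info M W B T t t\<close>, which is not monotone in \<open>t\<close>;
  \<open>info M W B T t 0\<close> is increasing in \<open>t\<close> and \<open>info M W B T T t\<close> is decreasing in \<open>t\<close>.
\<close>
definition info ::
  "'a measure \<Rightarrow> (real \<Rightarrow> 'a \<Rightarrow> real) \<Rightarrow> (real \<Rightarrow> 'a \<Rightarrow> real) \<Rightarrow> real \<Rightarrow> real \<Rightarrow> real \<Rightarrow> 'a measure" where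
  "info M W B T s t =
     sigma (space M) (sets (increment_algebra M W 0 s) \<union> sets (increment_algebra M B t T))"

definition doubly_stochastic_basis ::
  "'a measure \<Rightarrow> real \<Rightarrow> (real \<Rightarrow> 'a \<Rightarrow> real) \<Rightarrow> (real \<Rightarrow> 'a \<Rightarrow> real) \<Rightarrow> bool" where
  "doubly_stochastic_basis M T W B \<longleftrightarrow>
     prob_space M \<and> complete_measure M \<and> 0 < T \<and>
     standard_brownian_motion M T W \<and> standard_brownian_motion M T B \<and>
     independent_processes M T W B"


section \<open>Spaces of processes\<close>

definition adapted_process ::
  "'a measure \<Rightarrow> real \<Rightarrow> (real \<Rightarrow> 'a \<Rightarrow> real) \<Rightarrow> (real \<Rightarrow> 'a \<Rightarrow> real)
    \<Rightarrow> (real \<Rightarrow> 'a \<Rightarrow> 'b::euclidean_space) \<Rightarrow> bool" where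
  "adapted_process M T W B X \<longleftrightarrow>
     (\<lambda>(\<omega>, s). X s \<omega>) \<in> borel_measurable (M \<Otimes>\<^sub>M restrict_space borel {0..T}) \<and>
     (\<forall>t\<in>{0..T}. X t \<in> borel_measurable (info M W B T t t))"

text \<open>
  Progressive measurability with respect to a flow that is increasing in its \<open>W\<close>-part and
  decreasing in its \<open>B\<close>-part: on \<open>[0,t]\<close> the process depends on \<open>W\<close> only up to time \<open>t\<close>,
  and on \<open>[t,T]\<close> it depends on \<open>B\<close> only from time \<open>t\<close> on. Requiring the restriction to
  \<open>[0,t]\<close> to depend on \<open>B\<close> only from time \<open>t\<close> on would remove the dependence on \<open>B\<close> altogether.
\<close>
definition progressive_process ::
  "'a measure \<Rightarrow> real \<Rightarrow> (real \<Rightarrow> 'a \<Rightarrow> real) \<Rightarrow> (real \<Rightarrow> 'a \<Rightarrow> real)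
    \<Rightarrow> (real \<Rightarrow> 'a \<Rightarrow> 'b::euclidean_space) \<Rightarrow> bool" where
  "progressive_process M T W B X \<longleftrightarrow>
     (\<forall>t\<in>{0..T}.
        (\<lambda>(\<omega>, s). X s \<omega>)
          \<in> borel_measurable (info M W B T t 0 \<Otimes>\<^sub>M restrict_space borel {0..t}) \<and>
        (\<lambda>(\<omega>, s). X s \<omega>)
          \<in> borel_measurable (info M W B T T t \<Otimes>\<^sub>M restrict_space borel {t..T}) \<and>
        X t \<in> borel_measurable (info M W B T t t))"

definition square_integrable_process ::
  "'a measure \<Rightarrow> real \<Rightarrow> (real \<Rightarrow> 'a \<Rightarrow> 'b::euclidean_space) \<Rightarrow> bool" where
  "square_integrable_process M T X \<longleftrightarrow>
     (\<integral>\<^sup>+\<omega>. (\<integral>\<^sup>+s\<in>{0..T}. ennreal ((norm (X s \<omega>))\<^sup>2) \<partial>lborel) \<partial>M) < \<infinity>"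

definition M2 ::
  "'a measure \<Rightarrow> real \<Rightarrow> (real \<Rightarrow> 'a \<Rightarrow> real) \<Rightarrow> (real \<Rightarrow> 'a \<Rightarrow> real)
    \<Rightarrow> (real \<Rightarrow> 'a \<Rightarrow> 'b::euclidean_space) set" where
  "M2 M T W B = {X. progressive_process M T W B X \<and> square_integrable_process M T X}"


section \<open>Forward and backward stochastic integrals\<close>

definition step_process ::
  "nat \<Rightarrow> (nat \<Rightarrow> real) \<Rightarrow> (nat \<Rightarrow> 'a \<Rightarrow> 'b::euclidean_space) \<Rightarrow> real \<Rightarrow> 'a \<Rightarrow> 'b" where
  "step_process n \<tau> \<xi> s \<omega> = (\<Sum>i<n. indicator {\<tau> i<..\<tau> (Suc i)} s *\<^sub>R \<xi> i \<omega>)"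

text \<open>The elementary integral over \<open>[0,t]\<close> of a step process against the path \<open>X\<close>.\<close>
definition step_integral ::
  "(real \<Rightarrow> 'a \<Rightarrow> real) \<Rightarrow> nat \<Rightarrow> (nat \<Rightarrow> real) \<Rightarrow> (nat \<Rightarrow> 'a \<Rightarrow> 'b::euclidean_space)
    \<Rightarrow> real \<Rightarrow> 'a \<Rightarrow> 'b" where
  "step_integral X n \<tau> \<xi> t \<omega> =
     (\<Sum>i<n. (X (min t (\<tau> (Suc i))) \<omega> - X (min t (\<tau> i)) \<omega>) *\<^sub>R \<xi> i \<omega>)"

definition step_data ::
  "real \<Rightarrow> nat \<Rightarrow> (nat \<Rightarrow> real) \<Rightarrow> (nat \<Rightarrow> 'a \<Rightarrow> 'b::euclidean_space) \<Rightarrow> bool" where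
  "step_data T n \<tau> \<xi> \<longleftrightarrow>
     mono_on {..n} \<tau> \<and> \<tau> ` {..n} \<subseteq> {0..T} \<and> (\<exists>c. \<forall>i<n. \<forall>\<omega>. norm (\<xi> i \<omega>) \<le> c)"

text \<open>
  Forward integrands are frozen at the left endpoint of each interval (nonanticipating in \<open>W\<close>),
  backward integrands at the right endpoint (depending on \<open>B\<close> only through later increments).
\<close>
definition forward_step_data ::
  "'a measure \<Rightarrow> real \<Rightarrow> (real \<Rightarrow> 'a \<Rightarrow> real) \<Rightarrow> (real \<Rightarrow> 'a \<Rightarrow> real)
    \<Rightarrow> nat \<Rightarrow> (nat \<Rightarrow> real) \<Rightarrow> (nat \<Rightarrow> 'a \<Rightarrow> 'b::euclidean_space) \<Rightarrow> bool" where
  "forward_step_data M T W B n \<tau> \<xi> \<longleftrightarrow>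
     step_data T n \<tau> \<xi> \<and> (\<forall>i<n. \<xi> i \<in> borel_measurable (info M W B T (\<tau> i) 0))"

definition backward_step_data ::
  "'a measure \<Rightarrow> real \<Rightarrow> (real \<Rightarrow> 'a \<Rightarrow> real) \<Rightarrow> (real \<Rightarrow> 'a \<Rightarrow> real)
    \<Rightarrow> nat \<Rightarrow> (nat \<Rightarrow> real) \<Rightarrow> (nat \<Rightarrow> 'a \<Rightarrow> 'b::euclidean_space) \<Rightarrow> bool" where
  "backward_step_data M T W B n \<tau> \<xi> \<longleftrightarrow>
     step_data T n \<tau> \<xi> \<and> (\<forall>i<n. \<xi> i \<in> borel_measurable (info M W B T T (\<tau> (Suc i))))"

text \<open>
  \<open>L2_integral_limit M T S X \<phi> J\<close>: \<open>J t\<close> is, for every \<open>t\<close>, the limit in \<open>L\<^sup>2\<close> of the elementary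
  integrals over \<open>[0,t]\<close> of step processes from the class \<open>S\<close> that converge to \<open>\<phi>\<close> in
  \<open>L\<^sup>2\<close> of the product space. By the Ito isometry \<open>J t\<close> is determined by \<open>\<phi>\<close> almost surely.
\<close>
definition L2_integral_limit ::
  "'a measure \<Rightarrow> real \<Rightarrow> (nat \<Rightarrow> (nat \<Rightarrow> real) \<Rightarrow> (nat \<Rightarrow> 'a \<Rightarrow> 'b) \<Rightarrow> bool)
    \<Rightarrow> (real \<Rightarrow> 'a \<Rightarrow> real) \<Rightarrow> (real \<Rightarrow> 'a \<Rightarrow> 'b::euclidean_space) \<Rightarrow> (real \<Rightarrow> 'a \<Rightarrow> 'b) \<Rightarrow> bool" where
  "L2_integral_limit M T S X \<phi> J \<longleftrightarrow>
     (\<forall>t\<in>{0..T}. J t \<in> borel_measurable M) \<and>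
     (\<exists>n \<tau> \<xi>. (\<forall>m. S (n m) (\<tau> m) (\<xi> m)) \<and>
        (\<lambda>m. \<integral>\<^sup>+\<omega>. (\<integral>\<^sup>+s\<in>{0..T}.
            ennreal ((norm (step_process (n m) (\<tau> m) (\<xi> m) s \<omega> - \<phi> s \<omega>))\<^sup>2) \<partial>lborel) \<partial>M)
          \<longlonglongrightarrow> 0 \<and>
        (\<forall>t\<in>{0..T}.
          (\<lambda>m. \<integral>\<^sup>+\<omega>.
              ennreal ((norm (step_integral X (n m) (\<tau> m) (\<xi> m) t \<omega> - J t \<omega>))\<^sup>2) \<partial>M)
            \<longlonglongrightarrow> 0))"

definition has_forward_integral ::
  "'a measure \<Rightarrow> real \<Rightarrow> (real \<Rightarrow> 'a \<Rightarrow> real) \<Rightarrow> (real \<Rightarrow> 'a \<Rightarrow> real)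
    \<Rightarrow> (real \<Rightarrow> 'a \<Rightarrow> 'b::euclidean_space) \<Rightarrow> (real \<Rightarrow> 'a \<Rightarrow> 'b) \<Rightarrow> bool" where
  "has_forward_integral M T W B \<phi> J \<longleftrightarrow>
     L2_integral_limit M T (forward_step_data M T W B) W \<phi> J"

definition has_backward_integral ::
  "'a measure \<Rightarrow> real \<Rightarrow> (real \<Rightarrow> 'a \<Rightarrow> real) \<Rightarrow> (real \<Rightarrow> 'a \<Rightarrow> real)
    \<Rightarrow> (real \<Rightarrow> 'a \<Rightarrow> 'b::euclidean_space) \<Rightarrow> (real \<Rightarrow> 'a \<Rightarrow> 'b) \<Rightarrow> bool" where
  "has_backward_integral M T W B \<phi> J \<longleftrightarrow>
     L2_integral_limit M T (backward_step_data M T W B) B \<phi> J"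

text \<open>\<open>dZ = f dt + g dW + h dB\<close> on \<open>[0,T]\<close>, with forward \<open>dW\<close> and backward \<open>dB\<close>.\<close>
definition has_ds_differential ::
  "'a measure \<Rightarrow> real \<Rightarrow> (real \<Rightarrow> 'a \<Rightarrow> real) \<Rightarrow> (real \<Rightarrow> 'a \<Rightarrow> real)
    \<Rightarrow> (real \<Rightarrow> 'a \<Rightarrow> 'b::euclidean_space)
    \<Rightarrow> (real \<Rightarrow> 'a \<Rightarrow> 'b) \<Rightarrow> (real \<Rightarrow> 'a \<Rightarrow> 'b) \<Rightarrow> (real \<Rightarrow> 'a \<Rightarrow> 'b) \<Rightarrow> bool" where
  "has_ds_differential M T W B Z f g h \<longleftrightarrow>
     (\<exists>G H. has_forward_integral M T W B g G \<and> has_backward_integral M T W B h H \<and>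
        (\<forall>t\<in>{0..T}. AE \<omega> in M.
           Z t \<omega> = Z 0 \<omega> + (LINT s:{0..t}|lborel. f s \<omega>) + G t \<omega> + H t \<omega>))"


section \<open>The linear quadratic game\<close>

datatype player = Player1 | Player2

definition nonneg_symmetric :: "real^'m^'m \<Rightarrow> bool" where
  "nonneg_symmetric X \<longleftrightarrow> transpose X = X \<and> (\<forall>z. 0 \<le> (X *v z) \<bullet> z)"

definition pos_symmetric :: "real^'m^'m \<Rightarrow> bool" where
  "pos_symmetric X \<longleftrightarrow> transpose X = X \<and> (\<forall>z. z \<noteq> 0 \<longrightarrow> 0 < (X *v z) \<bullet> z)"

text \<open>\<open>gain Bc N i\<close> is \<open>B N\<^sup>-\<^sup>1 B\<^sup>T\<close> for player \<open>i\<close>; \<open>Bc i\<close> is the control matrix \<open>B\<close>.\<close>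
definition gain ::
  "(player \<Rightarrow> real^'k^'n) \<Rightarrow> (player \<Rightarrow> real^'k^'k) \<Rightarrow> player \<Rightarrow> real^'n^'n" where
  "gain Bc N i = Bc i ** matrix_inv (N i) ** transpose (Bc i)"

definition is_state ::
  "'a measure \<Rightarrow> real \<Rightarrow> (real \<Rightarrow> 'a \<Rightarrow> real) \<Rightarrow> (real \<Rightarrow> 'a \<Rightarrow> real)
    \<Rightarrow> real^'n^'n \<Rightarrow> (player \<Rightarrow> real^'k^'n) \<Rightarrow> real^'n^'n \<Rightarrow> real^'n^'n \<Rightarrow> real^'n^'n
    \<Rightarrow> (real \<Rightarrow> 'a \<Rightarrow> real^'n) \<Rightarrow> (real \<Rightarrow> 'a \<Rightarrow> real^'n) \<Rightarrow> real^'n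
    \<Rightarrow> (player \<Rightarrow> real \<Rightarrow> 'a \<Rightarrow> real^'k)
    \<Rightarrow> (real \<Rightarrow> 'a \<Rightarrow> real^'n) \<Rightarrow> (real \<Rightarrow> 'a \<Rightarrow> real^'n) \<Rightarrow> bool" where
  "is_state M T W B A Bc C D E \<alpha> \<beta> a v x k \<longleftrightarrow>
     x \<in> M2 M T W B \<and> k \<in> M2 M T W B \<and>
     has_ds_differential M T W B x
       (\<lambda>t \<omega>. A *v x t \<omega> + Bc Player1 *v v Player1 t \<omega> + Bc Player2 *v v Player2 t \<omega>
               + C *v k t \<omega> + \<alpha> t \<omega>)
       (\<lambda>t \<omega>. D *v x t \<omega> + E *v k t \<omega> + \<beta> t \<omega>)
       (\<lambda>t \<omega>. - k t \<omega>) \<and>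
     (AE \<omega> in M. x 0 \<omega> = a)"

text \<open>The cost of one player, with weights \<open>R\<close>, \<open>N\<close>, \<open>P\<close>, \<open>Q\<close> and own control \<open>w\<close>.\<close>
definition lq_cost ::
  "'a measure \<Rightarrow> real \<Rightarrow> real^'n^'n \<Rightarrow> real^'k^'k \<Rightarrow> real^'n^'n \<Rightarrow> real^'n^'n
    \<Rightarrow> (real \<Rightarrow> 'a \<Rightarrow> real^'n) \<Rightarrow> (real \<Rightarrow> 'a \<Rightarrow> real^'n) \<Rightarrow> (real \<Rightarrow> 'a \<Rightarrow> real^'k) \<Rightarrow> real" where
  "lq_cost M T R N P Q x k w =
     1 / 2 * prob_space.expectation M (\<lambda>\<omega>.
       (LINT t:{0..T}|lborel.
          (R *v x t \<omega>) \<bullet> x t \<omega> + (N *v w t \<omega>) \<bullet> w t \<omega> + (P *v k t \<omega>) \<bullet> k t \<omega>)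
       + (Q *v x T \<omega>) \<bullet> x T \<omega>)"

text \<open>
  \<open>J i v c\<close> stands for ``the cost of player \<open>i\<close> under the control pair \<open>v\<close> equals \<open>c\<close>'': a relation,
  because the cost depends on \<open>v\<close> through a solution of the state equation. Both players have
  a cost at an equilibrium, and the inequality holds whatever solutions are used to compute it.
\<close>
definition nash_equilibrium ::
  "('c \<Rightarrow> bool) \<Rightarrow> (player \<Rightarrow> (player \<Rightarrow> 'c) \<Rightarrow> real \<Rightarrow> bool) \<Rightarrow> (player \<Rightarrow> 'c) \<Rightarrow> bool" where
  "nash_equilibrium admissible J u \<longleftrightarrow>
     (\<forall>i. admissible (u i) \<and> (\<exists>c. J i u c) \<and>
       (\<forall>w c c'. admissible w \<and> J i u c \<and> J i (u(i := w)) c' \<longrightarrow> c \<le> c'))"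

definition game_cost ::
  "'a measure \<Rightarrow> real \<Rightarrow> (real \<Rightarrow> 'a \<Rightarrow> real) \<Rightarrow> (real \<Rightarrow> 'a \<Rightarrow> real)
    \<Rightarrow> real^'n^'n \<Rightarrow> (player \<Rightarrow> real^'k^'n) \<Rightarrow> real^'n^'n \<Rightarrow> real^'n^'n \<Rightarrow> real^'n^'n
    \<Rightarrow> (real \<Rightarrow> 'a \<Rightarrow> real^'n) \<Rightarrow> (real \<Rightarrow> 'a \<Rightarrow> real^'n) \<Rightarrow> real^'n
    \<Rightarrow> (player \<Rightarrow> real^'n^'n) \<Rightarrow> (player \<Rightarrow> real^'k^'k)
    \<Rightarrow> (player \<Rightarrow> real^'n^'n) \<Rightarrow> (player \<Rightarrow> real^'n^'n)
    \<Rightarrow> player \<Rightarrow> (player \<Rightarrow> real \<Rightarrow> 'a \<Rightarrow> real^'k) \<Rightarrow> real \<Rightarrow> bool" where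
  "game_cost M T W B A Bc C D E \<alpha> \<beta> a R N P Q i v c \<longleftrightarrow>
     (\<exists>x k. is_state M T W B A Bc C D E \<alpha> \<beta> a v x k \<and>
            c = lq_cost M T (R i) (N i) (P i) (Q i) x k (v i))"

end

theory Submission
  imports Defs
begin

text \<open>
  Fix one player, with control matrix \<open>Bc\<close>, and let the other keep its control. The cost of the
  player is a convex quadratic functional of the state pair and of its own control, so a deviation
  from \<open>u\<close> to \<open>w\<close> changes the cost by at least the derivative of the functional at \<open>u\<close> in the
  direction of the deviation (\<open>quadratic_form_tangent\<close>). Write \<open>X\<close>, \<open>K\<close> and \<open>V\<close> for the differences of the two states, of their
  second components and of the two controls. The derivative is the expectation of
  \<open>\<langle>Q x\<^sub>T, X\<^sub>T\<rangle>\<close> plus the time integral of \<open>\<langle>R x, X\<rangle> + \<langle>N u, V\<rangle> + \<langle>P k, K\<rangle>\<close>. Since \<open>y\<^sub>T = Q x\<^sub>T\<close>, the first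
  term is \<open>\<langle>y\<^sub>T, X\<^sub>T\<rangle>\<close>, and the product formula applied to \<open>X\<close> and \<open>y\<close> turns it into the time integral
  of \<open>\<langle>Bc V, y\<rangle> - \<langle>R x, X\<rangle> - \<langle>P k, K\<rangle>\<close>: the coefficients of the adjoint equation are the transposes
  that make every other term cancel (\<open>adjoint_duality\<close>). What is left is \<open>\<langle>N u + Bc\<^sup>T y, V\<rangle>\<close>, which is
  \<open>0\<close> by the choice of \<open>u\<close>.

  The product formula says that, for \<open>dZ = f dt + g dW + h dB\<close> and \<open>dY = f' dt + g' dW + h' dB\<close>,
  the expectation of \<open>\<langle>Z\<^sub>t, Y\<^sub>t\<rangle> - \<langle>Z\<^sub>0, Y\<^sub>0\<rangle>\<close> is the expected time integral of
  \<open>\<langle>Z, f'\<rangle> + \<langle>f, Y\<rangle> + \<langle>g, g'\<rangle> - \<langle>h, h'\<rangle>\<close>. The minus sign comes from the direction of the integral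
  against \<open>B\<close>: over \<open>[s, t]\<close> its increment is orthogonal to the value of a process at the right
  endpoint, whereas an increment of the integral against \<open>W\<close> is orthogonal to the value at the left
  endpoint. Expanding over one interval with these relations and with the isometries leaves an error
  of order \<open>sqrt (t - s)\<close> times an additive function of the interval (\<open>product_local_estimate\<close>), and such
  errors disappear on refinement (\<open>eq_if_sqrt_additive_bound\<close>). The formula is bilinear, so it
  passes to differences of processes although their approximating step processes live on unrelated
  partitions.

  The orthogonality relations rest on the independence of a Brownian increment from the information
  that an integrand may use (\<open>increment_indep_sigma\<close>). The two directions are treated together:
  reversed in time, \<open>B\<close> has increments that are independent of the past of an increasing flow, just
  as \<open>W\<close> does (\<open>filtered_noise\<close>).

  The cost at \<open>u\<close> may be computed with any solution of the state equation, whereas \<open>y\<close> is built from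
  the given one. The two agree (\<open>linear_state_unique\<close>): in the formula for the square of
  their difference the second component enters with the coefficient \<open>\<bar>E\<bar>\<^sup>2 - 1 < 0\<close>, after which
  Gronwall's argument applies.
\<close>

section \<open>The inner product of square integrable functions\<close>

definition sq_int :: "'a measure \<Rightarrow> ('a \<Rightarrow> 'b::euclidean_space) \<Rightarrow> bool" where
  "sq_int M f \<longleftrightarrow> f \<in> borel_measurable M \<and> integrable M (\<lambda>x. (norm (f x))\<^sup>2)"

text \<open>The inner product of \<open>L\<^sup>2\<close>, taken on functions; versions that agree almost everywhere are exchanged by \<open>ip_cong_AE\<close>.\<close>
definition ip :: "'a measure \<Rightarrow> ('a \<Rightarrow> 'b::euclidean_space) \<Rightarrow> ('a \<Rightarrow> 'b) \<Rightarrow> real" where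
  "ip M f g = (\<integral>x. f x \<bullet> g x \<partial>M)"

lemma
  assumes "sq_int M f"
  shows sq_int_measurable: "f \<in> borel_measurable M"
    and sq_int_norm: "integrable M (\<lambda>x. (norm (f x))\<^sup>2)"
  using assms by (auto simp: sq_int_def)

lemma sq_int_iff_nn:
  assumes "f \<in> borel_measurable M"
  shows "sq_int M f \<longleftrightarrow> (\<integral>\<^sup>+x. ennreal ((norm (f x))\<^sup>2) \<partial>M) < \<infinity>"
  unfolding sq_int_def using assms
  by (subst integrable_iff_bounded) auto

lemma sq_int_bound:
  fixes f :: "'a \<Rightarrow> 'b::euclidean_space" and g :: "'a \<Rightarrow> 'c::euclidean_space"
  assumes "sq_int M g" "f \<in> borel_measurable M" "AE x in M. norm (f x) \<le> c * norm (g x)"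
  shows "sq_int M f"
  unfolding sq_int_def
proof
  show "integrable M (\<lambda>x. (norm (f x))\<^sup>2)"
  proof (rule Bochner_Integration.integrable_bound)
    show "integrable M (\<lambda>x. c\<^sup>2 * (norm (g x))\<^sup>2)"
      using sq_int_norm[OF assms(1)] by simp
    show "AE x in M. norm ((norm (f x))\<^sup>2) \<le> norm (c\<^sup>2 * (norm (g x))\<^sup>2)"
      using assms(3)
    proof eventually_elim
      case (elim x)
      have "(norm (f x))\<^sup>2 \<le> (c * norm (g x))\<^sup>2"
        using elim by (rule power_mono) simp
      then show ?case by (simp add: power_mult_distrib)
    qed
    show "(\<lambda>x. (norm (f x))\<^sup>2) \<in> borel_measurable M"
      using assms(2) by measurable
  qed
qed fact

lemma norm_add_sq_le: "(norm (a + b :: 'b::real_inner))\<^sup>2 \<le> 2 * (norm a)\<^sup>2 + 2 * (norm b)\<^sup>2"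
proof -
  have "0 \<le> (norm (a - b))\<^sup>2" by simp
  then show ?thesis by (simp add: power2_norm_eq_inner inner_simps inner_commute)
qed

lemma sq_int_add:
  assumes "sq_int M f" "sq_int M g"
  shows "sq_int M (\<lambda>x. f x + g x)"
  unfolding sq_int_def
proof
  note [measurable] = sq_int_measurable[OF assms(1)] sq_int_measurable[OF assms(2)]
  show m: "(\<lambda>x. f x + g x) \<in> borel_measurable M" by measurable
  show "integrable M (\<lambda>x. (norm (f x + g x))\<^sup>2)"
  proof (rule Bochner_Integration.integrable_bound)
    show "integrable M (\<lambda>x. 2 * (norm (f x))\<^sup>2 + 2 * (norm (g x))\<^sup>2)"
      using sq_int_norm[OF assms(1)] sq_int_norm[OF assms(2)] by simp
    show "AE x in M. norm ((norm (f x + g x))\<^sup>2) \<le> norm (2 * (norm (f x))\<^sup>2 + 2 * (norm (g x))\<^sup>2)"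
      using norm_add_sq_le[of "f _" "g _"] by auto
  qed measurable
qed

lemma sq_int_linear:
  assumes "bounded_linear L" "sq_int M f"
  shows "sq_int M (\<lambda>x. L (f x))"
proof -
  obtain c where c: "\<And>x. norm (L x) \<le> norm x * c"
    using bounded_linear.bounded[OF assms(1)] by auto
  have [measurable]: "L \<in> borel_measurable borel"
    using assms(1) by (simp add: borel_measurable_continuous_onI linear_continuous_on)
  show ?thesis
    by (rule sq_int_bound[OF assms(2), where c=c])
       (use sq_int_measurable[OF assms(2)] c in \<open>auto simp: mult.commute\<close>)
qed

lemma sq_int_minus: "sq_int M f \<Longrightarrow> sq_int M (\<lambda>x. - f x)"
  by (rule sq_int_linear) (auto intro: bounded_linear_minus bounded_linear_ident)

lemma sq_int_diff: "sq_int M f \<Longrightarrow> sq_int M g \<Longrightarrow> sq_int M (\<lambda>x. f x - g x)"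
  using sq_int_add[of M f "\<lambda>x. - g x"] sq_int_minus[of M g] by simp

lemma sq_int_mult_vec: "sq_int M f \<Longrightarrow> sq_int M (\<lambda>x. (A :: real^'n^'m) *v f x)"
  by (rule sq_int_linear) (auto intro: matrix_vector_mul_bounded_linear)

lemma sq_int_indicator:
  assumes "sq_int M f" "A \<inter> space M \<in> sets M"
  shows "sq_int M (\<lambda>x. indicator A x *\<^sub>R f x)"
proof (rule sq_int_bound[OF assms(1), where c=1])
  have "(indicator A :: 'a \<Rightarrow> real) \<in> borel_measurable M"
    using assms(2) by (simp add: borel_measurable_indicator_iff)
  then show "(\<lambda>x. indicator A x *\<^sub>R f x) \<in> borel_measurable M"
    using sq_int_measurable[OF assms(1)] by (rule borel_measurable_scaleR)
qed (auto simp: indicator_def)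

lemma sq_int_sum:
  "(\<And>i. i \<in> I \<Longrightarrow> sq_int M (f i)) \<Longrightarrow> sq_int M (\<lambda>x. \<Sum>i\<in>I. f i x)"
proof (induction I rule: infinite_finite_induct)
  case (insert i I)
  then show ?case by (simp add: sq_int_add)
qed (auto simp: sq_int_def)

lemma sq_int_integrable_inner:
  assumes "sq_int M f" "sq_int M g"
  shows "integrable M (\<lambda>x. f x \<bullet> g x)"
proof (rule Bochner_Integration.integrable_bound)
  note [measurable] = sq_int_measurable[OF assms(1)] sq_int_measurable[OF assms(2)]
  show "(\<lambda>x. f x \<bullet> g x) \<in> borel_measurable M" by measurable
  show "integrable M (\<lambda>x. (norm (f x))\<^sup>2 + (norm (g x))\<^sup>2)"
    using sq_int_norm[OF assms(1)] sq_int_norm[OF assms(2)] by simp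
  have "\<bar>f x \<bullet> g x\<bar> \<le> (norm (f x))\<^sup>2 + (norm (g x))\<^sup>2" for x
  proof -
    have "\<bar>f x \<bullet> g x\<bar> \<le> norm (f x) * norm (g x)" by (rule Cauchy_Schwarz_ineq2)
    also have "\<dots> \<le> (norm (f x))\<^sup>2 + (norm (g x))\<^sup>2"
      using sum_squares_bound[of "norm (f x)" "norm (g x)"]
        mult_nonneg_nonneg[OF norm_ge_zero[of "f x"] norm_ge_zero[of "g x"]] by linarith
    finally show ?thesis .
  qed
  then show "AE x in M. norm (f x \<bullet> g x) \<le> norm ((norm (f x))\<^sup>2 + (norm (g x))\<^sup>2)"
    by (intro AE_I2) (simp add: abs_of_nonneg)
qed

lemma ip_commute: "ip M f g = ip M g f"
  by (simp add: ip_def inner_commute)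

lemma ip_self: "ip M f f = (\<integral>x. (norm (f x))\<^sup>2 \<partial>M)"
  by (simp add: ip_def power2_norm_eq_inner)

lemma ip_nonneg: "0 \<le> ip M f f"
  by (simp add: ip_self)

lemma ip_add_left:
  "sq_int M f \<Longrightarrow> sq_int M g \<Longrightarrow> sq_int M h \<Longrightarrow> ip M (\<lambda>x. f x + g x) h = ip M f h + ip M g h"
  by (simp add: ip_def inner_add_left sq_int_integrable_inner)

lemma ip_diff_left:
  "sq_int M f \<Longrightarrow> sq_int M g \<Longrightarrow> sq_int M h \<Longrightarrow> ip M (\<lambda>x. f x - g x) h = ip M f h - ip M g h"
  by (simp add: ip_def inner_diff_left sq_int_integrable_inner)

lemma ip_add_right:
  "sq_int M f \<Longrightarrow> sq_int M g \<Longrightarrow> sq_int M h \<Longrightarrow> ip M h (\<lambda>x. f x + g x) = ip M h f + ip M h g"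
  by (simp add: ip_def inner_add_right sq_int_integrable_inner)

lemma ip_diff_right:
  "sq_int M f \<Longrightarrow> sq_int M g \<Longrightarrow> sq_int M h \<Longrightarrow> ip M h (\<lambda>x. f x - g x) = ip M h f - ip M h g"
  by (simp add: ip_def inner_diff_right sq_int_integrable_inner)

lemma ip_cong_AE:
  "AE x in M. f x = f' x \<Longrightarrow> AE x in M. g x = g' x \<Longrightarrow>
   f \<in> borel_measurable M \<Longrightarrow> g \<in> borel_measurable M \<Longrightarrow>
   f' \<in> borel_measurable M \<Longrightarrow> g' \<in> borel_measurable M \<Longrightarrow> ip M f g = ip M f' g'"
  unfolding ip_def by (intro integral_cong_AE) auto

lemma ip_Cauchy_Schwarz:
  fixes f g :: "'a \<Rightarrow> 'b::euclidean_space"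
  assumes f: "sq_int M f" and g: "sq_int M g"
  shows "\<bar>ip M f g\<bar> \<le> sqrt (ip M f f) * sqrt (ip M g g)"
proof -
  \<comment> \<open>The discriminant argument: the quadratic below is nonnegative for every scalar.\<close>
  have sc: "sq_int M (\<lambda>x. c *\<^sub>R f x)" if "sq_int M f" for c and f :: "'a \<Rightarrow> 'b"
    using that by (rule sq_int_linear[OF bounded_linear_scaleR_right])
  have quad: "0 \<le> a\<^sup>2 * ip M f f - 2 * a * b * ip M f g + b\<^sup>2 * ip M g g" for a b
  proof -
    have "0 \<le> ip M (\<lambda>x. a *\<^sub>R f x - b *\<^sub>R g x) (\<lambda>x. a *\<^sub>R f x - b *\<^sub>R g x)"
      by (rule ip_nonneg)
    also have "\<dots> = a\<^sup>2 * ip M f f - 2 * a * b * ip M f g + b\<^sup>2 * ip M g g"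
      by (simp add: ip_diff_left ip_diff_right sc f g sq_int_diff)
         (simp add: ip_def inner_commute power2_eq_square algebra_simps)
    finally show ?thesis .
  qed
  have *: "(ip M f g)\<^sup>2 \<le> ip M f f * ip M g g"
  proof (cases "ip M g g = 0")
    case True
    have "ip M f g = 0"
    proof (rule ccontr)
      assume "ip M f g \<noteq> 0"
      then show False
        using quad[of 1 "(ip M f f + 1) / (2 * ip M f g)"] True by (simp add: field_simps)
    qed
    then show ?thesis using True by simp
  next
    case False
    then have pos: "0 < ip M g g" using ip_nonneg[of M g] by simp
    have "0 \<le> (ip M g g)\<^sup>2 * ip M f f - 2 * ip M g g * ip M f g * ip M f g + (ip M f g)\<^sup>2 * ip M g g"
      by (rule quad)
    also have "\<dots> = ip M g g * (ip M f f * ip M g g - (ip M f g)\<^sup>2)"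
      by (simp add: power2_eq_square algebra_simps)
    finally show ?thesis using pos by (simp add: zero_le_mult_iff)
  qed
  have "\<bar>ip M f g\<bar> = sqrt ((ip M f g)\<^sup>2)" by simp
  also have "\<dots> \<le> sqrt (ip M f f * ip M g g)" using * by (rule real_sqrt_le_mono)
  finally show ?thesis by (simp add: real_sqrt_mult)
qed

lemma ip_add_self_le:
  assumes "sq_int M f" "sq_int M g"
  shows "ip M (\<lambda>x. f x + g x) (\<lambda>x. f x + g x) \<le> 2 * ip M f f + 2 * ip M g g"
proof -
  have "ip M (\<lambda>x. f x + g x) (\<lambda>x. f x + g x)
      \<le> (\<integral>x. 2 * (norm (f x))\<^sup>2 + 2 * (norm (g x))\<^sup>2 \<partial>M)"
    unfolding ip_self
    using sq_int_norm[OF assms(1)] sq_int_norm[OF assms(2)] sq_int_norm[OF sq_int_add[OF assms]]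
    by (intro integral_mono norm_add_sq_le) auto
  also have "\<dots> = 2 * ip M f f + 2 * ip M g g"
    unfolding ip_self using sq_int_norm[OF assms(1)] sq_int_norm[OF assms(2)] by simp
  finally show ?thesis .
qed

definition sq_conv :: "'a measure \<Rightarrow> (nat \<Rightarrow> 'a \<Rightarrow> 'b::euclidean_space) \<Rightarrow> ('a \<Rightarrow> 'b) \<Rightarrow> bool" where
  "sq_conv M f g \<longleftrightarrow> (\<forall>m. sq_int M (f m)) \<and> sq_int M g \<and>
     (\<lambda>m. ip M (\<lambda>x. f m x - g x) (\<lambda>x. f m x - g x)) \<longlonglongrightarrow> 0"

text \<open>
  The limit inherits square integrability from a single approximant at finite distance, so it
  is enough to know that the limit is measurable.
\<close>
lemma sq_convI_nn:
  assumes f: "\<And>m. sq_int M (f m)" and g: "g \<in> borel_measurable M"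
    and lim: "(\<lambda>m. \<integral>\<^sup>+x. ennreal ((norm (f m x - g x))\<^sup>2) \<partial>M) \<longlonglongrightarrow> 0"
  shows "sq_conv M f g"
proof -
  note [measurable] = sq_int_measurable[OF f] g
  have "eventually (\<lambda>m. (\<integral>\<^sup>+x. ennreal ((norm (f m x - g x))\<^sup>2) \<partial>M) < 1) sequentially"
    using order_tendstoD(2)[OF lim, of 1] by simp
  then obtain m where m: "(\<integral>\<^sup>+x. ennreal ((norm (f m x - g x))\<^sup>2) \<partial>M) < 1"
    by (auto simp: eventually_sequentially)
  have "sq_int M (\<lambda>x. f m x - g x)"
    by (subst sq_int_iff_nn) (use m in \<open>auto intro: less_trans\<close>)
  from sq_int_diff[OF f[of m] this] have gs: "sq_int M g" by simp
  have eq: "(\<integral>\<^sup>+x. ennreal ((norm (f m x - g x))\<^sup>2) \<partial>M)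
      = ennreal (ip M (\<lambda>x. f m x - g x) (\<lambda>x. f m x - g x))" for m
    unfolding ip_self
    by (rule nn_integral_eq_integral) (auto intro: sq_int_norm[OF sq_int_diff[OF f gs]])
  have "(\<lambda>m. enn2real (ennreal (ip M (\<lambda>x. f m x - g x) (\<lambda>x. f m x - g x)))) \<longlonglongrightarrow> enn2real 0"
    by (rule tendsto_enn2real) (use lim in \<open>auto simp: eq\<close>)
  then show ?thesis
    unfolding sq_conv_def using f gs by (simp add: ip_nonneg)
qed

lemma sq_conv_const: "sq_int M f \<Longrightarrow> sq_conv M (\<lambda>_. f) f"
  by (simp add: sq_conv_def ip_def)

lemma sq_conv_diff:
  assumes "sq_conv M f g" "sq_conv M f' g'"
  shows "sq_conv M (\<lambda>m x. f m x - f' m x) (\<lambda>x. g x - g' x)"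
proof -
  note s = assms[unfolded sq_conv_def]
  let ?e = "\<lambda>m. ip M (\<lambda>x. f m x - g x) (\<lambda>x. f m x - g x)"
  let ?e' = "\<lambda>m. ip M (\<lambda>x. f' m x - g' x) (\<lambda>x. f' m x - g' x)"
  let ?d = "\<lambda>m. ip M (\<lambda>x. f m x - f' m x - (g x - g' x)) (\<lambda>x. f m x - f' m x - (g x - g' x))"
  have "?d m \<le> 2 * ?e m + 2 * ?e' m" for m
  proof -
    have "?d m = ip M (\<lambda>x. (f m x - g x) + - (f' m x - g' x)) (\<lambda>x. (f m x - g x) + - (f' m x - g' x))"
      by (simp add: algebra_simps)
    also have "\<dots> \<le> 2 * ?e m + 2 * ip M (\<lambda>x. - (f' m x - g' x)) (\<lambda>x. - (f' m x - g' x))"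
      by (intro ip_add_self_le sq_int_diff sq_int_minus) (use s in auto)
    also have "\<dots> = 2 * ?e m + 2 * ?e' m" by (simp add: ip_self norm_minus_commute)
    finally show ?thesis .
  qed
  moreover have "(\<lambda>m. 2 * ?e m + 2 * ?e' m) \<longlonglongrightarrow> 2 * 0 + 2 * 0"
    using s by (intro tendsto_intros) auto
  ultimately have "?d \<longlonglongrightarrow> 0"
    by (intro tendsto_sandwich[of "\<lambda>_. 0" ?d _ "\<lambda>m. 2 * ?e m + 2 * ?e' m"]) (auto simp: ip_nonneg)
  then show ?thesis using s by (auto simp: sq_conv_def sq_int_diff)
qed

lemma sq_conv_indicator:
  assumes "sq_conv M f g" "A \<inter> space M \<in> sets M"
  shows "sq_conv M (\<lambda>m x. indicator A x *\<^sub>R f m x) (\<lambda>x. indicator A x *\<^sub>R g x)"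
proof -
  note s = assms(1)[unfolded sq_conv_def]
  let ?e = "\<lambda>m. ip M (\<lambda>x. f m x - g x) (\<lambda>x. f m x - g x)"
  let ?d = "\<lambda>m. ip M (\<lambda>x. indicator A x *\<^sub>R f m x - indicator A x *\<^sub>R g x)
    (\<lambda>x. indicator A x *\<^sub>R f m x - indicator A x *\<^sub>R g x)"
  have "?d m \<le> ?e m" for m
    unfolding ip_self
  proof (rule integral_mono)
    show "integrable M (\<lambda>x. (norm (indicator A x *\<^sub>R f m x - indicator A x *\<^sub>R g x))\<^sup>2)"
      using s assms(2) by (intro sq_int_norm sq_int_diff sq_int_indicator) auto
    show "integrable M (\<lambda>x. (norm (f m x - g x))\<^sup>2)"
      using s by (intro sq_int_norm sq_int_diff) auto
  qed (auto simp: indicator_def)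
  then have "?d \<longlonglongrightarrow> 0"
    using s by (intro tendsto_sandwich[of "\<lambda>_. 0" ?d _ ?e]) (auto simp: ip_nonneg)
  then show ?thesis using s assms(2) by (auto simp: sq_conv_def sq_int_indicator)
qed

text \<open>
  With the errors \<open>u = f - f'\<close> and \<open>v = g - g'\<close> the difference of the inner products is
  \<open>\<langle>u, v\<rangle> + \<langle>u, g'\<rangle> + \<langle>f', v\<rangle>\<close>, which the Cauchy-Schwarz inequality bounds by the errors and by the
  norms of the limits only.
\<close>
lemma ip_tendsto:
  assumes f: "sq_conv M f f'" and g: "sq_conv M g g'"
  shows "(\<lambda>m. ip M (f m) (g m)) \<longlonglongrightarrow> ip M f' g'"
proof -
  note s = f[unfolded sq_conv_def] g[unfolded sq_conv_def]
  define u where "u = (\<lambda>m x. f m x - f' x)"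
  define v where "v = (\<lambda>m x. g m x - g' x)"
  have u: "sq_int M (u m)" and v: "sq_int M (v m)" for m
    using s by (auto simp: u_def v_def sq_int_diff)
  have u0: "(\<lambda>m. sqrt (ip M (u m) (u m))) \<longlonglongrightarrow> 0" and v0: "(\<lambda>m. sqrt (ip M (v m) (v m))) \<longlonglongrightarrow> 0"
    using s tendsto_real_sqrt[of _ 0] by (auto simp: u_def v_def)
  have split: "ip M (f m) (g m) - ip M f' g' = ip M (u m) (v m) + ip M (u m) g' + ip M f' (v m)" for m
    using s by (simp add: u_def v_def ip_diff_left ip_diff_right sq_int_diff)
  let ?b = "\<lambda>m. sqrt (ip M (u m) (u m)) * sqrt (ip M (v m) (v m))
     + sqrt (ip M (u m) (u m)) * sqrt (ip M g' g') + sqrt (ip M f' f') * sqrt (ip M (v m) (v m))"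
  have f': "sq_int M f'" and g': "sq_int M g'" using s by auto
  have bound: "\<bar>ip M (f m) (g m) - ip M f' g'\<bar> \<le> ?b m" for m
    unfolding split
    using ip_Cauchy_Schwarz[OF u[of m] v[of m]] ip_Cauchy_Schwarz[OF u[of m] g']
      ip_Cauchy_Schwarz[OF f' v[of m]] by linarith
  have "?b \<longlonglongrightarrow> 0 * 0 + 0 * sqrt (ip M g' g') + sqrt (ip M f' f') * 0"
    by (intro tendsto_add tendsto_mult tendsto_const u0 v0)
  then have b0: "?b \<longlonglongrightarrow> 0" by simp
  have "(\<lambda>m. ip M (f m) (g m) - ip M f' g') \<longlonglongrightarrow> 0"
    by (rule Lim_null_comparison[OF _ b0]) (simp add: bound)
  then show ?thesis by (simp add: LIM_zero_iff)
qed

section \<open>Independence of an increment from the information\<close>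

lemma space_increment_algebra [simp]: "space (increment_algebra M X s t) = space M"
  by (simp add: increment_algebra_def space_measure_of_conv)

lemma sets_increment_algebra:
  "sets (increment_algebra M X s t) = sigma_sets (space M) (null_sets M \<union>
     {(\<lambda>\<omega>. X u \<omega> - X s \<omega>) -` S \<inter> space M | u S. u \<in> {s..t} \<and> S \<in> sets borel})"
  unfolding increment_algebra_def by (rule sets_measure_of) (auto dest: null_sets.sets_into_space)

text \<open>Apart from null sets, these events form the \<open>\<inter>\<close>-stable generator of the algebra of increments.\<close>
definition increment_cylinders :: "'a measure \<Rightarrow> (real \<Rightarrow> 'a \<Rightarrow> real) \<Rightarrow> real \<Rightarrow> real \<Rightarrow> 'a set set" where
  "increment_cylinders M X s t =
     {{\<omega>\<in>space M. \<forall>r\<in>R. X r \<omega> - X s \<omega> \<in> S r} | R S.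
        finite R \<and> R \<subseteq> {s..t} \<and> (\<forall>r. S r \<in> sets borel)}"

text \<open>Independence of two processes as paths is independence of these events.\<close>
definition path_events :: "'a measure \<Rightarrow> real \<Rightarrow> (real \<Rightarrow> 'a \<Rightarrow> real) \<Rightarrow> 'a set set" where
  "path_events M T X =
     {(\<lambda>\<omega>. \<lambda>t\<in>{0..T}. X t \<omega>) -` A \<inter> space M | A. A \<in> sets (Pi\<^sub>M {0..T} (\<lambda>_. borel))}"

lemma increment_cylinders_Int:
  assumes "C \<in> increment_cylinders M X s t" "C' \<in> increment_cylinders M X s t"
  shows "C \<inter> C' \<in> increment_cylinders M X s t"
proof -
  obtain R S where C: "C = {\<omega>\<in>space M. \<forall>r\<in>R. X r \<omega> - X s \<omega> \<in> S r}"
      "finite R" "R \<subseteq> {s..t}" "\<forall>r. S r \<in> sets borel"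
    using assms(1) unfolding increment_cylinders_def by auto
  obtain R' S' where C': "C' = {\<omega>\<in>space M. \<forall>r\<in>R'. X r \<omega> - X s \<omega> \<in> S' r}"
      "finite R'" "R' \<subseteq> {s..t}" "\<forall>r. S' r \<in> sets borel"
    using assms(2) unfolding increment_cylinders_def by auto
  define U where "U = (\<lambda>r. (if r \<in> R then S r else UNIV) \<inter> (if r \<in> R' then S' r else UNIV))"
  have "C \<inter> C' = {\<omega>\<in>space M. \<forall>r\<in>R \<union> R'. X r \<omega> - X s \<omega> \<in> U r}"
    unfolding C(1) C'(1) U_def by auto
  moreover have "U r \<in> sets borel" for r
    using C(4) C'(4) by (auto simp: U_def)
  ultimately show ?thesis
    unfolding increment_cylinders_def using C C'
    by (intro CollectI exI[of _ "R \<union> R'"] exI[of _ U]) auto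
qed

lemma increment_cylinder_single:
  assumes "r \<in> {s..t}" "S \<in> sets borel"
  shows "(\<lambda>\<omega>. X r \<omega> - X s \<omega>) -` S \<inter> space M \<in> increment_cylinders M X s t"
  unfolding increment_cylinders_def using assms
  by (intro CollectI exI[of _ "{r}"] exI[of _ "\<lambda>_. S"]) auto

lemma increment_cylinder_space: "space M \<in> increment_cylinders M X s t"
  unfolding increment_cylinders_def by (intro CollectI exI[of _ "{}"] exI[of _ "\<lambda>_. UNIV"]) auto

text \<open>
  A cylinder and an increment of the same process together are one event of its path. This allows
  independence of the paths to be used first, and independence of increments only within one path.
\<close>
lemma cylinder_increment_path_event:
  assumes C: "C \<in> increment_cylinders M X s t" and st: "0 \<le> s" "t \<le> T" "s \<le> T"
    and ab: "a \<in> {0..T}" "b \<in> {0..T}" and S: "S \<in> sets borel"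
  shows "C \<inter> ((\<lambda>\<omega>. X b \<omega> - X a \<omega>) -` S \<inter> space M) \<in> path_events M T X"
proof -
  obtain R U where C: "C = {\<omega>\<in>space M. \<forall>r\<in>R. X r \<omega> - X s \<omega> \<in> U r}"
      "finite R" "R \<subseteq> {s..t}" "\<forall>r. U r \<in> sets borel"
    using C unfolding increment_cylinders_def by auto
  let ?Pi = "Pi\<^sub>M {0..T} (\<lambda>_. borel :: real measure)"
  have RT: "R \<subseteq> {0..T}" and sT: "s \<in> {0..T}" using C(3) st by auto
  have meas: "(\<lambda>p. p r - p q) \<in> borel_measurable ?Pi" if "r \<in> {0..T}" "q \<in> {0..T}" for r q
    using that by (intro borel_measurable_diff measurable_component_singleton) auto
  have "{p\<in>space ?Pi. \<forall>r\<in>R. p r - p s \<in> U r} \<in> sets ?Pi"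
    using C(2,4) RT sT
    by (intro sets.sets_Collect_finite_All measurable_sets_Collect[OF meas]) auto
  moreover have "{p\<in>space ?Pi. p b - p a \<in> S} \<in> sets ?Pi"
    using ab S by (intro measurable_sets_Collect[OF meas]) auto
  ultimately have "{p\<in>space ?Pi. \<forall>r\<in>R. p r - p s \<in> U r} \<inter> {p\<in>space ?Pi. p b - p a \<in> S} \<in> sets ?Pi"
    by auto
  moreover have "C \<inter> ((\<lambda>\<omega>. X b \<omega> - X a \<omega>) -` S \<inter> space M) =
    (\<lambda>\<omega>. \<lambda>t\<in>{0..T}. X t \<omega>) -` ({p\<in>space ?Pi. \<forall>r\<in>R. p r - p s \<in> U r} \<inter> {p\<in>space ?Pi. p b - p a \<in> S})
      \<inter> space M"
    unfolding C(1) using ab sT RT by (auto simp: space_PiM subset_iff)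
  ultimately show ?thesis unfolding path_events_def by blast
qed

lemma cylinder_path_event:
  assumes C: "C \<in> increment_cylinders M X s t" and st: "0 \<le> s" "t \<le> T" "s \<le> T"
  shows "C \<in> path_events M T X"
proof -
  have "C \<subseteq> space M" using C by (auto simp: increment_cylinders_def)
  then have "C \<inter> ((\<lambda>\<omega>. X s \<omega> - X s \<omega>) -` UNIV \<inter> space M) = C" by auto
  then show ?thesis using cylinder_increment_path_event[OF C st, of s s UNIV] st by simp
qed

text \<open>
  The sampling times of the cylinder and the endpoints of an increment over a disjoint interval are
  merged into one sorted list. The values of the cylinder are partial sums of the consecutive
  differences over one block of this list, and the separate increment is a difference outside it.
\<close>
lemma cylinder_indep_increment:
  assumes "prob_space M" and bm: "standard_brownian_motion M T X"
    and st: "0 \<le> s" "s \<le> t" "t \<le> T" and ab: "0 \<le> a" "a \<le> b" "b \<le> T" and dis: "t \<le> a \<or> b \<le> s"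
    and C: "C \<in> increment_cylinders M X s t" and V: "V \<in> sets borel"
  shows "measure M (C \<inter> ((\<lambda>\<omega>. X b \<omega> - X a \<omega>) -` V \<inter> space M)) =
    measure M C * measure M ((\<lambda>\<omega>. X b \<omega> - X a \<omega>) -` V \<inter> space M)"
proof -
  interpret prob_space M by fact
  obtain R U where C: "C = {\<omega>\<in>space M. \<forall>r\<in>R. X r \<omega> - X s \<omega> \<in> U r}"
      "finite R" "R \<subseteq> {s..t}" "\<And>r. U r \<in> sets borel"
    using C unfolding increment_cylinders_def by auto
  define l where "l = sorted_list_of_set (insert s R)"
  have fin: "finite (insert s R)" using C(2) by simp
  have l: "sorted l" "set l = insert s R" "l \<noteq> []"
    unfolding l_def
    by (rule sorted_sorted_list_of_set, rule set_sorted_list_of_set[OF fin],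
        subst sorted_list_of_set_eq_Nil_iff[OF fin], blast)
  have l0: "l ! 0 = s"
  proof -
    have "l ! 0 \<le> s"
    proof -
      have "s \<in> set l" using l(2) by simp
      then obtain j where j: "j < length l" "l ! j = s" unfolding in_set_conv_nth by blast
      show ?thesis using sorted_nth_mono[OF l(1), of 0 j] j by simp
    qed
    moreover have "l ! 0 \<in> set l" using l(3) by simp
    then have "s \<le> l ! 0" using l(2) C(3) st by auto
    ultimately show ?thesis by simp
  qed
  have lst: "set l \<subseteq> {s..t}" using l(2) C(3) st by auto
  define n where "n = length l - 1"
  have n: "length l = Suc n" using l(3) by (cases l) (auto simp: n_def)
  have "\<exists>L p q. sorted L \<and> set L \<subseteq> {0..T} \<and> (\<forall>j\<le>n. L ! (p + j) = l ! j) \<and> p + n < length L \<and>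
      Suc q < length L \<and> L ! q = a \<and> L ! Suc q = b \<and> q \<notin> {p..<p+n}"
    using dis
  proof
    assume ta: "t \<le> a"
    have "L ! j = l ! j" if "j \<le> n" "L = l @ [a, b]" for j L
      using that n by (simp add: nth_append)
    then show ?thesis
      using l lst n ta ab st
      by (intro exI[of _ "l @ [a, b]"] exI[of _ 0] exI[of _ "Suc n"])
         (auto simp: sorted_append nth_append)
  next
    assume bs: "b \<le> s"
    show ?thesis
      using l lst n bs ab st
      by (intro exI[of _ "a # b # l"] exI[of _ 2] exI[of _ 0]) auto
  qed
  then obtain L p q where L: "sorted L" "set L \<subseteq> {0..T}" "\<And>j. j \<le> n \<Longrightarrow> L ! (p + j) = l ! j"
      "p + n < length L" "Suc q < length L" "L ! q = a" "L ! Suc q = b" "q \<notin> {p..<p+n}"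
    by blast
  define N where "N = length L - 1"
  have N: "length L = Suc N" using L(5) by (simp add: N_def)
  define inc where "inc = (\<lambda>i \<omega>. X (L ! Suc i) \<omega> - X (L ! i) \<omega>)"
  have "mono_on {..N} ((!) L)"
    using L(1) N by (auto intro!: mono_onI sorted_nth_mono)
  moreover have "(!) L ` {..N} \<subseteq> {0..T}"
    using L(2) N by (auto simp: subset_iff)
  ultimately have "indep_vars (\<lambda>_. borel) inc {..<N}"
    using bm unfolding standard_brownian_motion_def inc_def by blast
  then have ind: "indep_var (PiM {p..<p+n} (\<lambda>_. borel)) (\<lambda>\<omega>. restrict (\<lambda>i. inc i \<omega>) {p..<p+n})
      (PiM {q} (\<lambda>_. borel)) (\<lambda>\<omega>. restrict (\<lambda>i. inc i \<omega>) {q})"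
    by (rule indep_var_restrict) (use L N in auto)
  define J where "J = {j. j \<le> n \<and> l ! j \<in> R}"
  define \<C> where "\<C> = {g\<in>space (PiM {p..<p+n} (\<lambda>_. borel :: real measure)).
      \<forall>j\<in>J. (\<Sum>i\<in>{p..<p+j}. g i) \<in> U (l ! j)}"
  define \<V> where "\<V> = {g\<in>space (PiM {q} (\<lambda>_. borel :: real measure)). g q \<in> V}"
  have "\<C> \<in> sets (PiM {p..<p+n} (\<lambda>_. borel))"
    unfolding \<C>_def
  proof (intro sets.sets_Collect_finite_All)
    fix j assume "j \<in> J"
    then have "(\<lambda>g. \<Sum>i\<in>{p..<p+j}. g i) \<in> borel_measurable (PiM {p..<p+n} (\<lambda>_. borel :: real measure))"
      by (intro borel_measurable_sum measurable_component_singleton) (auto simp: J_def)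
    from measurable_sets_Collect[OF this, of "\<lambda>x. x \<in> U (l ! j)"] C(4)[of "l ! j"]
    show "{g\<in>space (PiM {p..<p+n} (\<lambda>_. borel :: real measure)). (\<Sum>i\<in>{p..<p+j}. g i) \<in> U (l ! j)}
        \<in> sets (PiM {p..<p+n} (\<lambda>_. borel))" by simp
  qed (simp add: J_def)
  moreover have "\<V> \<in> sets (PiM {q} (\<lambda>_. borel))"
    unfolding \<V>_def using V
      measurable_sets_Collect[OF measurable_component_singleton[of q "{q}" "\<lambda>_. borel"], of "\<lambda>x. x \<in> V"]
    by simp
  ultimately have "prob ((\<lambda>\<omega>. (restrict (\<lambda>i. inc i \<omega>) {p..<p+n}, restrict (\<lambda>i. inc i \<omega>) {q})) -` (\<C> \<times> \<V>) \<inter> space M)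
     = prob ((\<lambda>\<omega>. restrict (\<lambda>i. inc i \<omega>) {p..<p+n}) -` \<C> \<inter> space M)
       * prob ((\<lambda>\<omega>. restrict (\<lambda>i. inc i \<omega>) {q}) -` \<V> \<inter> space M)"
    by (rule indep_varD[OF ind])
  moreover have CC: "(\<lambda>\<omega>. restrict (\<lambda>i. inc i \<omega>) {p..<p+n}) -` \<C> \<inter> space M = C"
  proof -
    have tele: "(\<Sum>i\<in>{p..<p+j}. restrict (\<lambda>i. inc i \<omega>) {p..<p+n} i) = X (l ! j) \<omega> - X s \<omega>" if "j \<le> n" for j \<omega>
    proof -
      have "(\<Sum>i\<in>{p..<p+j}. restrict (\<lambda>i. inc i \<omega>) {p..<p+n} i) = (\<Sum>i\<in>{p..<p+j}. inc i \<omega>)"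
        using that by (intro sum.cong) auto
      also have "\<dots> = X (L ! (p + j)) \<omega> - X (L ! (p + 0)) \<omega>"
        unfolding inc_def using sum_Suc_diff'[of p "p + j" "\<lambda>i. X (L ! i) \<omega>"] by simp
      also have "\<dots> = X (l ! j) \<omega> - X s \<omega>"
        using L(3)[OF that] L(3)[of 0] l0 by simp
      finally show ?thesis .
    qed
    have "(\<forall>j\<in>J. Z (l ! j)) \<longleftrightarrow> (\<forall>r\<in>R. Z r)" for Z
    proof -
      have "R = (!) l ` J"
      proof
        show "R \<subseteq> (!) l ` J"
        proof
          fix r assume r: "r \<in> R"
          then have "r \<in> set l" using l(2) by simp
          then obtain j where "j < length l" "l ! j = r" unfolding in_set_conv_nth by blast
          then show "r \<in> (!) l ` J" using r n by (auto simp: J_def)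
        qed
      qed (auto simp: J_def)
      then show ?thesis by auto
    qed
    note J = this
    have "(\<lambda>\<omega>. restrict (\<lambda>i. inc i \<omega>) {p..<p+n}) -` \<C> \<inter> space M
       = {\<omega>\<in>space M. \<forall>j\<in>J. X (l ! j) \<omega> - X s \<omega> \<in> U (l ! j)}"
      unfolding \<C>_def using tele by (auto simp: space_PiM J_def)
    also have "\<dots> = C" unfolding C(1) using J[of "\<lambda>r. X r \<omega> - X s \<omega> \<in> U r" for \<omega>] by auto
    finally show ?thesis .
  qed
  moreover have VV: "(\<lambda>\<omega>. restrict (\<lambda>i. inc i \<omega>) {q}) -` \<V> \<inter> space M = (\<lambda>\<omega>. X b \<omega> - X a \<omega>) -` V \<inter> space M"
    unfolding \<V>_def inc_def using L by (auto simp: space_PiM)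
  moreover have "(\<lambda>\<omega>. (restrict (\<lambda>i. inc i \<omega>) {p..<p+n}, restrict (\<lambda>i. inc i \<omega>) {q})) -` (\<C> \<times> \<V>) \<inter> space M
      = C \<inter> ((\<lambda>\<omega>. X b \<omega> - X a \<omega>) -` V \<inter> space M)"
    using CC VV by blast
  ultimately show ?thesis by simp
qed

text \<open>
  Intersections of a cylinder of \<open>X\<close> with one of \<open>Y\<close> are \<open>\<inter>\<close>-stable and generate the joint
  information. For \<open>C\<close>, \<open>C'\<close> of this kind and an event \<open>D\<close> of the increment,
  \<open>P(C \<inter> D \<inter> C') = P(C \<inter> D) P(C') = P(C) P(D) P(C') = P(C \<inter> C') P(D)\<close>. Working with events that
  agree almost surely with such intersections puts the null sets into the generator as well.
\<close>
lemma increment_indep_sigma: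
  assumes "prob_space M" and bm: "standard_brownian_motion M T X"
    and Ym: "\<And>r. r \<in> {0..T} \<Longrightarrow> Y r \<in> borel_measurable M"
    and XY: "\<And>F F'. F \<in> path_events M T X \<Longrightarrow> F' \<in> path_events M T Y \<Longrightarrow>
      measure M (F \<inter> F') = measure M F * measure M F'"
    and st: "0 \<le> s" "s \<le> t" "t \<le> T" and ab: "0 \<le> a" "a \<le> b" "b \<le> T" and dis: "t \<le> a \<or> b \<le> s"
    and st': "0 \<le> s'" "s' \<le> t'" "t' \<le> T"
    and G: "space G = space M" "sets G \<subseteq> sigma_sets (space M)
      (sets (increment_algebra M X s t) \<union> sets (increment_algebra M Y s' t'))"
    and \<zeta>: "\<zeta> \<in> borel_measurable G"
  shows "prob_space.indep_var M borel \<zeta> borel (\<lambda>\<omega>. X b \<omega> - X a \<omega>)"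
proof -
  interpret prob_space M by fact
  have Xm: "X r \<in> borel_measurable M" if "r \<in> {0..T}" for r
    using bm that by (auto simp: standard_brownian_motion_def)
  have [measurable]: "X a \<in> borel_measurable M" "X b \<in> borel_measurable M"
    using Xm ab by auto
  have cyl_sets: "C \<in> events" if cyl: "C \<in> increment_cylinders M Z s t" and le: "0 \<le> s" "s \<le> t" "t \<le> T"
      and Zm: "\<And>r. r \<in> {0..T} \<Longrightarrow> Z r \<in> borel_measurable M" for C Z s t
  proof -
    obtain R U where C: "C = {\<omega>\<in>space M. \<forall>r\<in>R. Z r \<omega> - Z s \<omega> \<in> U r}"
        "finite R" "R \<subseteq> {s..t}" "\<forall>r. U r \<in> sets borel"
      using cyl unfolding increment_cylinders_def by blast
    show ?thesis unfolding C(1)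
    proof (intro sets.sets_Collect_finite_All)
      fix r assume "r \<in> R"
      then have "(\<lambda>\<omega>. Z r \<omega> - Z s \<omega>) \<in> borel_measurable M"
        using C(3) le by (intro borel_measurable_diff Zm) auto
      from measurable_sets_Collect[OF this, of "\<lambda>x. x \<in> U r"] C(4)
      show "{\<omega>\<in>space M. Z r \<omega> - Z s \<omega> \<in> U r} \<in> events" by simp
    qed fact
  qed
  define CX where "CX = increment_cylinders M X s t"
  define CY where "CY = increment_cylinders M Y s' t'"
  define \<G> where "\<G> = {F\<in>events. \<exists>C\<in>CX. \<exists>C'\<in>CY. AE \<omega> in M. \<omega> \<in> F \<longleftrightarrow> \<omega> \<in> C \<inter> C'}"
  define \<D> where "\<D> = {(\<lambda>\<omega>. X b \<omega> - X a \<omega>) -` V \<inter> space M | V. V \<in> sets borel}"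
  have CX: "C \<in> events" if "C \<in> CX" for C
    using cyl_sets[of C X s t] that st Xm by (auto simp: CX_def)
  have CY: "C \<in> events" if "C \<in> CY" for C
    using cyl_sets[of C Y s' t'] that st' Ym by (auto simp: CY_def)
  have \<D>: "D \<in> events" if D: "D \<in> \<D>" for D
  proof -
    obtain V where "D = (\<lambda>\<omega>. X b \<omega> - X a \<omega>) -` V \<inter> space M" "V \<in> sets borel"
      using D by (auto simp: \<D>_def)
    then show ?thesis by (auto intro!: measurable_sets[of _ _ borel])
  qed
  have "indep_set \<G> \<D>"
  proof (rule indep_setI)
    show "\<G> \<subseteq> events" "\<D> \<subseteq> events" using \<D> by (auto simp: \<G>_def)
    fix F D assume F: "F \<in> \<G>" and D: "D \<in> \<D>"
    obtain C C' where C: "C \<in> CX" "C' \<in> CY" "AE \<omega> in M. \<omega> \<in> F \<longleftrightarrow> \<omega> \<in> C \<inter> C'" "F \<in> events"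
      using F by (auto simp: \<G>_def)
    obtain V where V: "D = (\<lambda>\<omega>. X b \<omega> - X a \<omega>) -` V \<inter> space M" "V \<in> sets borel"
      using D by (auto simp: \<D>_def)
    have C'p: "C' \<in> path_events M T Y"
      using cylinder_path_event[of C' M Y s' t' T] C(2) st' by (auto simp: CY_def)
    have Cp: "C \<in> path_events M T X"
      using cylinder_path_event[of C M X s t T] C(1) st by (auto simp: CX_def)
    have CDp: "C \<inter> D \<in> path_events M T X"
      using cylinder_increment_path_event[of C M X s t T a b V] C(1) st ab V by (auto simp: CX_def)
    have "prob (F \<inter> D) = prob ((C \<inter> D) \<inter> C')"
      using C(3) by (intro measure_eq_AE) (use C V \<D>[OF D] CX CY in auto)
    also have "\<dots> = prob (C \<inter> D) * prob C'" by (rule XY[OF CDp C'p])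
    also have "prob (C \<inter> D) = prob C * prob D"
      unfolding V(1)
      by (rule cylinder_indep_increment[OF prob_space_axioms bm st ab dis _ V(2)])
         (use C(1) in \<open>simp add: CX_def\<close>)
    also have "prob C * prob D * prob C' = prob (C \<inter> C') * prob D"
      using XY[OF Cp C'p] by simp
    also have "prob (C \<inter> C') = prob F"
      using C(3) by (intro measure_eq_AE) (use C CX CY in auto)
    finally show "prob (F \<inter> D) = prob F * prob D" .
  qed
  moreover have "Int_stable \<G>"
  proof (rule Int_stableI)
    fix F F' assume "F \<in> \<G>" "F' \<in> \<G>"
    then obtain C1 C2 C1' C2' where
      *: "C1 \<in> CX" "C2 \<in> CY" "AE \<omega> in M. \<omega> \<in> F \<longleftrightarrow> \<omega> \<in> C1 \<inter> C2" "F \<in> events"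
         "C1' \<in> CX" "C2' \<in> CY" "AE \<omega> in M. \<omega> \<in> F' \<longleftrightarrow> \<omega> \<in> C1' \<inter> C2'" "F' \<in> events"
      by (auto simp: \<G>_def)
    have "AE \<omega> in M. \<omega> \<in> F \<inter> F' \<longleftrightarrow> \<omega> \<in> (C1 \<inter> C1') \<inter> (C2 \<inter> C2')"
      using *(3,7) by eventually_elim auto
    moreover have "C1 \<inter> C1' \<in> CX" "C2 \<inter> C2' \<in> CY"
      using * increment_cylinders_Int unfolding CX_def CY_def by blast+
    ultimately show "F \<inter> F' \<in> \<G>" using * unfolding \<G>_def by blast
  qed
  moreover have "Int_stable \<D>"
  proof (rule Int_stableI)
    fix D D' assume "D \<in> \<D>" "D' \<in> \<D>"
    then obtain V V' where "D = (\<lambda>\<omega>. X b \<omega> - X a \<omega>) -` V \<inter> space M" "V \<in> sets borel"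
       "D' = (\<lambda>\<omega>. X b \<omega> - X a \<omega>) -` V' \<inter> space M" "V' \<in> sets borel"
      by (auto simp: \<D>_def)
    then show "D \<inter> D' \<in> \<D>" unfolding \<D>_def by (intro CollectI exI[of _ "V \<inter> V'"]) auto
  qed
  ultimately have ind: "indep_set (sigma_sets (space M) \<G>) (sigma_sets (space M) \<D>)"
    by (rule indep_set_sigma_sets)
  have null: "F \<in> \<G>" if "F \<in> null_sets M" for F
  proof -
    have "(\<lambda>\<omega>. X s \<omega> - X s \<omega>) -` {} \<inter> space M \<in> CX"
      unfolding CX_def using st by (intro increment_cylinder_single) auto
    then have "{} \<in> CX" by simp
    moreover have "space M \<in> CY" unfolding CY_def by (rule increment_cylinder_space)
    moreover have "AE \<omega> in M. \<omega> \<in> F \<longleftrightarrow> \<omega> \<in> {} \<inter> space M"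
      using AE_not_in[OF that] by simp
    ultimately show ?thesis using that unfolding \<G>_def by blast
  qed
  have cylX: "C \<in> \<G>" if "C \<in> CX" for C
  proof -
    have "AE \<omega> in M. \<omega> \<in> C \<longleftrightarrow> \<omega> \<in> C \<inter> space M" by auto
    then show ?thesis using CX[OF that] that increment_cylinder_space[of M Y s' t']
      unfolding \<G>_def CY_def by blast
  qed
  have cylY: "C \<in> \<G>" if "C \<in> CY" for C
  proof -
    have "AE \<omega> in M. \<omega> \<in> C \<longleftrightarrow> \<omega> \<in> space M \<inter> C" by auto
    then show ?thesis using CY[OF that] that increment_cylinder_space[of M X s t]
      unfolding \<G>_def CX_def by blast
  qed
  have "sets (increment_algebra M X s t) \<subseteq> sigma_sets (space M) \<G>"
    unfolding sets_increment_algebra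
    by (rule sigma_sets_mono) (auto intro: sigma_sets.Basic[OF null] sigma_sets.Basic[OF cylX[unfolded CX_def, OF increment_cylinder_single]])
  moreover have "sets (increment_algebra M Y s' t') \<subseteq> sigma_sets (space M) \<G>"
    unfolding sets_increment_algebra
    by (rule sigma_sets_mono) (auto intro: sigma_sets.Basic[OF null] sigma_sets.Basic[OF cylY[unfolded CY_def, OF increment_cylinder_single]])
  ultimately have "sets G \<subseteq> sigma_sets (space M) \<G>"
    using G(2) sigma_sets_mono[of "sets (increment_algebra M X s t) \<union> sets (increment_algebra M Y s' t')"
      "space M" \<G>] by blast
  then have \<zeta>s: "{\<zeta> -` A \<inter> space M | A. A \<in> sets borel} \<subseteq> sigma_sets (space M) \<G>"
    using measurable_sets[OF \<zeta>] G(1) by auto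
  have \<G>s: "sigma_sets (space M) \<G> \<subseteq> events"
    by (rule sets.sigma_sets_subset) (auto simp: \<G>_def)
  have "\<zeta> \<in> borel_measurable M"
    using \<zeta>s \<G>s by (auto intro!: measurableI)
  moreover have "indep_set (sigma_sets (space M) {\<zeta> -` A \<inter> space M | A. A \<in> sets borel})
      (sigma_sets (space M) \<D>)"
  proof -
    have "sigma_sets (space M) {\<zeta> -` A \<inter> space M | A. A \<in> sets borel} \<subseteq> sigma_sets (space M) \<G>"
      using \<zeta>s by (rule sigma_sets_mono)
    then show ?thesis using ind unfolding indep_sets2_eq by blast
  qed
  ultimately show ?thesis
    unfolding indep_var_eq \<D>_def by auto
qed

text \<open>The case \<open>a = b\<close> is separate because the normal density needs a positive variance.\<close>
lemma brownian_increment_moments: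
  assumes "prob_space M" and bm: "standard_brownian_motion M T X"
    and ab: "0 \<le> a" "a \<le> b" "b \<le> T"
  shows "integrable M (\<lambda>\<omega>. (X b \<omega> - X a \<omega>)\<^sup>2)" "(\<integral>\<omega>. (X b \<omega> - X a \<omega>)\<^sup>2 \<partial>M) = b - a"
    "(\<integral>\<omega>. X b \<omega> - X a \<omega> \<partial>M) = 0"
proof -
  interpret prob_space M by fact
  have "integrable M (\<lambda>\<omega>. (X b \<omega> - X a \<omega>)\<^sup>2) \<and> (\<integral>\<omega>. (X b \<omega> - X a \<omega>)\<^sup>2 \<partial>M) = b - a
    \<and> (\<integral>\<omega>. X b \<omega> - X a \<omega> \<partial>M) = 0"
  proof (cases "a = b")
    case False
    then have ab': "a < b" using ab by simp
    then have D: "distributed M lborel (\<lambda>\<omega>. X b \<omega> - X a \<omega>) (\<lambda>x. ennreal (normal_density 0 (sqrt (b - a)) x))"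
      using bm ab unfolding standard_brownian_motion_def by simp
    have pos: "0 < sqrt (b - a)" using ab' by simp
    have E: "expectation (\<lambda>\<omega>. X b \<omega> - X a \<omega>) = 0"
      using normal_distributed_expectation[OF pos D] .
    moreover have "(\<integral>\<omega>. (X b \<omega> - X a \<omega>)\<^sup>2 \<partial>M) = b - a"
      using normal_distributed_variance[OF pos D] ab' E by simp
    moreover have "integrable M (\<lambda>\<omega>. (X b \<omega> - X a \<omega>)\<^sup>2)"
      using integrable_normal_moment[OF pos, of 0 2] 
        distributed_integrable[OF D, of "\<lambda>x. x\<^sup>2"] by simp
    ultimately show ?thesis by simp
  qed simp
  then show "integrable M (\<lambda>\<omega>. (X b \<omega> - X a \<omega>)\<^sup>2)" "(\<integral>\<omega>. (X b \<omega> - X a \<omega>)\<^sup>2 \<partial>M) = b - a"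
    "(\<integral>\<omega>. X b \<omega> - X a \<omega> \<partial>M) = 0" by auto
qed

section \<open>Noise with orthogonal increments\<close>

lemma increment_measurable_increment_algebra:
  assumes "r \<in> {s..t}"
  shows "(\<lambda>\<omega>. X r \<omega> - X s \<omega>) \<in> borel_measurable (increment_algebra M X s t)"
proof (rule measurableI)
  fix S :: "real set" assume "S \<in> sets borel"
  then show "(\<lambda>\<omega>. X r \<omega> - X s \<omega>) -` S \<inter> space (increment_algebra M X s t) \<in> sets (increment_algebra M X s t)"
    unfolding sets_increment_algebra using assms by (auto intro!: sigma_sets.Basic)
qed simp

lemma sets_increment_algebra_le:
  assumes "space N = space M" "null_sets M \<subseteq> sets N"
    and "\<And>r. r \<in> {s..t} \<Longrightarrow> (\<lambda>\<omega>. X r \<omega> - X s \<omega>) \<in> borel_measurable N"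
  shows "sets (increment_algebra M X s t) \<subseteq> sets N"
  unfolding sets_increment_algebra assms(1)[symmetric]
proof (rule sets.sigma_sets_subset, safe)
  fix A assume "A \<in> null_sets M" then show "A \<in> sets N" using assms(2) by auto
next
  fix u and S :: "real set" assume "u \<in> {s..t}" "S \<in> sets borel"
  then show "(\<lambda>\<omega>. X u \<omega> - X s \<omega>) -` S \<inter> space N \<in> sets N"
    using measurable_sets[OF assms(3)] by auto
qed

lemma null_sets_increment_algebra: "null_sets M \<subseteq> sets (increment_algebra M X s t)"
  unfolding sets_increment_algebra by (rule subsetI, rule sigma_sets.Basic, simp)

lemma space_info [simp]: "space (info M W B T s t) = space M"
  by (simp add: info_def space_measure_of_conv)

lemma sets_info:
  "sets (info M W B T s t) = sigma_sets (space M)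
    (sets (increment_algebra M W 0 s) \<union> sets (increment_algebra M B t T))"
  unfolding info_def
proof (rule sets_measure_of)
  show "sets (increment_algebra M W 0 s) \<union> sets (increment_algebra M B t T) \<subseteq> Pow (space M)"
    using sets.space_closed[of "increment_algebra M W 0 s"] sets.space_closed[of "increment_algebra M B t T"]
    by simp
qed

lemma sets_info_ge:
  "sets (increment_algebra M W 0 s) \<subseteq> sets (info M W B T s t)"
  "sets (increment_algebra M B t T) \<subseteq> sets (info M W B T s t)"
  unfolding sets_info by (rule subsetI, rule sigma_sets.Basic, simp)+

lemma sets_info_le:
  assumes "space N = space M" "sets (increment_algebra M W 0 s) \<subseteq> sets N"
    "sets (increment_algebra M B t T) \<subseteq> sets N"
  shows "sets (info M W B T s t) \<subseteq> sets N"
  unfolding sets_info assms(1)[symmetric] using assms by (intro sets.sigma_sets_subset) auto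

lemma measurable_mono_sets:
  "f \<in> borel_measurable N \<Longrightarrow> space N = space N' \<Longrightarrow> sets N \<subseteq> sets N' \<Longrightarrow> f \<in> borel_measurable N'"
  by (auto simp: measurable_def)

lemma increment_W_measurable_info:
  assumes "0 \<le> r" "r \<le> s"
  shows "(\<lambda>\<omega>. W r \<omega> - W 0 \<omega>) \<in> borel_measurable (info M W B T s t)"
  by (rule measurable_mono_sets[OF increment_measurable_increment_algebra[of r 0 s] _ sets_info_ge(1)])
     (use assms in auto)

lemma increment_B_measurable_info:
  assumes "t \<le> r" "r \<le> T"
  shows "(\<lambda>\<omega>. B r \<omega> - B t \<omega>) \<in> borel_measurable (info M W B T s t)"
  by (rule measurable_mono_sets[OF increment_measurable_increment_algebra[of r t T] _ sets_info_ge(2)])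
     (use assms in auto)

lemma null_sets_info: "null_sets M \<subseteq> sets (info M W B T s t)"
  by (rule order_trans[OF null_sets_increment_algebra sets_info_ge(1)])

lemma sets_info_mono:
  assumes "s \<le> s'" "t' \<le> t" "t \<le> T"
  shows "sets (info M W B T s t) \<subseteq> sets (info M W B T s' t')"
proof (rule sets_info_le)
  show "sets (increment_algebra M W 0 s) \<subseteq> sets (info M W B T s' t')"
    by (rule sets_increment_algebra_le[OF space_info null_sets_info])
       (use assms in \<open>auto intro: increment_W_measurable_info\<close>)
  show "sets (increment_algebra M B t T) \<subseteq> sets (info M W B T s' t')"
  proof (rule sets_increment_algebra_le[OF space_info null_sets_info])
    fix r assume r: "r \<in> {t..T}"
    have "(\<lambda>\<omega>. (B r \<omega> - B t' \<omega>) - (B t \<omega> - B t' \<omega>)) \<in> borel_measurable (info M W B T s' t')"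
      using r assms by (intro borel_measurable_diff increment_B_measurable_info) auto
    then show "(\<lambda>\<omega>. B r \<omega> - B t \<omega>) \<in> borel_measurable (info M W B T s' t')" by simp
  qed
qed simp

lemma subalgebra_info:
  assumes "standard_brownian_motion M T W" "standard_brownian_motion M T B" "s \<le> T" "0 \<le> t" "t \<le> T"
  shows "subalgebra M (info M W B T s t)"
  unfolding subalgebra_def
proof
  have m: "W r \<in> borel_measurable M" "B r \<in> borel_measurable M" if "r \<in> {0..T}" for r
    using assms that by (auto simp: standard_brownian_motion_def)
  show "sets (info M W B T s t) \<subseteq> sets M"
    by (intro sets_info_le sets_increment_algebra_le borel_measurable_diff m)
       (use assms in auto)
qed simp

text \<open>
  What the construction of the integral uses about Brownian motion and an increasing flow of
  information. Both \<open>W\<close> and the time reversal of \<open>B\<close> are of this kind.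
\<close>
locale filtered_noise = prob_space M for M :: "'a measure" +
  fixes T :: real and X :: "real \<Rightarrow> 'a \<Rightarrow> real" and F :: "real \<Rightarrow> 'a measure"
  assumes subalg: "0 \<le> t \<Longrightarrow> t \<le> T \<Longrightarrow> subalgebra M (F t)"
    and F_mono: "0 \<le> s \<Longrightarrow> s \<le> t \<Longrightarrow> t \<le> T \<Longrightarrow> sets (F s) \<subseteq> sets (F t)"
    and adapted: "0 \<le> a \<Longrightarrow> a \<le> b \<Longrightarrow> b \<le> T \<Longrightarrow> (\<lambda>\<omega>. X b \<omega> - X a \<omega>) \<in> borel_measurable (F b)"
    and indep: "0 \<le> a \<Longrightarrow> a \<le> b \<Longrightarrow> b \<le> T \<Longrightarrow> (\<zeta> :: 'a \<Rightarrow> real) \<in> borel_measurable (F a) \<Longrightarrow>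
      indep_var borel \<zeta> borel (\<lambda>\<omega>. X b \<omega> - X a \<omega>)"
    and incr_sq: "0 \<le> a \<Longrightarrow> a \<le> b \<Longrightarrow> b \<le> T \<Longrightarrow> integrable M (\<lambda>\<omega>. (X b \<omega> - X a \<omega>)\<^sup>2)"
    and incr_var: "0 \<le> a \<Longrightarrow> a \<le> b \<Longrightarrow> b \<le> T \<Longrightarrow> (\<integral>\<omega>. (X b \<omega> - X a \<omega>)\<^sup>2 \<partial>M) = b - a"
    and incr_mean: "0 \<le> a \<Longrightarrow> a \<le> b \<Longrightarrow> b \<le> T \<Longrightarrow> (\<integral>\<omega>. X b \<omega> - X a \<omega> \<partial>M) = 0"
begin

lemma incr_meas:
  assumes "0 \<le> a" "a \<le> b" "b \<le> T"
  shows "(\<lambda>\<omega>. X b \<omega> - X a \<omega>) \<in> borel_measurable M"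
  by (rule measurable_from_subalg[OF subalg adapted]) (use assms in auto)

lemma incr_sq_int:
  assumes "0 \<le> a" "a \<le> b" "b \<le> T"
  shows "sq_int M (\<lambda>\<omega>. X b \<omega> - X a \<omega>)"
  using incr_meas incr_sq assms by (simp add: sq_int_def)

lemma incr_integrable:
  assumes "0 \<le> a" "a \<le> b" "b \<le> T"
  shows "integrable M (\<lambda>\<omega>. X b \<omega> - X a \<omega>)"
  using square_integrable_imp_integrable[OF incr_meas incr_sq] assms by simp

lemma F_meas_mono:
  assumes "f \<in> borel_measurable (F s)" "0 \<le> s" "s \<le> t" "t \<le> T"
  shows "f \<in> borel_measurable (F t)"
  by (rule measurable_mono_sets[OF assms(1)])
     (use F_mono subalg[of s] subalg[of t] assms in \<open>auto simp: subalgebra_def\<close>)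

lemma mean_orthogonal:
  assumes ab: "0 \<le> a" "a \<le> b" "b \<le> T" and \<zeta>: "\<zeta> \<in> borel_measurable (F a)" "integrable M \<zeta>"
  shows "integrable M (\<lambda>\<omega>. \<zeta> \<omega> * (X b \<omega> - X a \<omega>))" "(\<integral>\<omega>. \<zeta> \<omega> * (X b \<omega> - X a \<omega>) \<partial>M) = 0"
  using indep_var_integrable[OF indep[OF ab \<zeta>(1)] \<zeta>(2) incr_integrable[OF ab]]
    indep_var_lebesgue_integral[OF indep[OF ab \<zeta>(1)] \<zeta>(2) incr_integrable[OF ab]] incr_mean[OF ab]
  by simp_all

lemma square_orthogonal:
  assumes ab: "0 \<le> a" "a \<le> b" "b \<le> T" and \<zeta>: "\<zeta> \<in> borel_measurable (F a)" "integrable M \<zeta>"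
  shows "integrable M (\<lambda>\<omega>. \<zeta> \<omega> * (X b \<omega> - X a \<omega>)\<^sup>2)"
    "(\<integral>\<omega>. \<zeta> \<omega> * (X b \<omega> - X a \<omega>)\<^sup>2 \<partial>M) = (b - a) * (\<integral>\<omega>. \<zeta> \<omega> \<partial>M)"
proof -
  have "indep_var borel ((\<lambda>x. x) \<circ> \<zeta>) borel ((\<lambda>x. x\<^sup>2) \<circ> (\<lambda>\<omega>. X b \<omega> - X a \<omega>))"
    by (rule indep_var_compose[OF indep[OF ab \<zeta>(1)]]) auto
  then have ind: "indep_var borel \<zeta> borel (\<lambda>\<omega>. (X b \<omega> - X a \<omega>)\<^sup>2)" by (simp add: comp_def)
  show "integrable M (\<lambda>\<omega>. \<zeta> \<omega> * (X b \<omega> - X a \<omega>)\<^sup>2)"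
    "(\<integral>\<omega>. \<zeta> \<omega> * (X b \<omega> - X a \<omega>)\<^sup>2 \<partial>M) = (b - a) * (\<integral>\<omega>. \<zeta> \<omega> \<partial>M)"
    using indep_var_integrable[OF ind \<zeta>(2) incr_sq[OF ab]]
      indep_var_lebesgue_integral[OF ind \<zeta>(2) incr_sq[OF ab]] incr_var[OF ab]
    by simp_all
qed

text \<open>
  Of the product of two increments only the square of the increment over the overlap contributes:
  every other product has a factor whose interval lies after all that the remaining factors involve.
\<close>
lemma pair_orthogonal_ordered:
  assumes ab: "0 \<le> a" "a \<le> b" "b \<le> T" and cd: "c \<le> d" "d \<le> T" and ac: "a \<le> c"
    and \<zeta>: "\<zeta> \<in> borel_measurable (F c)" "\<And>\<omega>. \<bar>\<zeta> \<omega>\<bar> \<le> K"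
  shows "(\<integral>\<omega>. \<zeta> \<omega> * ((X b \<omega> - X a \<omega>) * (X d \<omega> - X c \<omega>)) \<partial>M) = max 0 (min b d - c) * (\<integral>\<omega>. \<zeta> \<omega> \<partial>M)"
proof -
  define p where "p = min b c"
  define q where "q = max b c"
  define m where "m = min q d"
  define n where "n = max q d"
  have ord: "0 \<le> c" "c \<le> T" "a \<le> p" "p \<le> c" "c \<le> q" "q \<le> T" "c \<le> m" "m \<le> n" "n \<le> T" "m \<le> T" "0 \<le> m"
    using assms by (auto simp: p_def q_def m_def n_def)
  have \<zeta>M: "\<zeta> \<in> borel_measurable M" using measurable_from_subalg[OF subalg \<zeta>(1)] ord by simp
  have \<zeta>i: "integrable M \<zeta>" by (rule integrable_const_bound[of _ K]) (use \<zeta> \<zeta>M in auto)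
  have bdd: "sq_int M (\<lambda>\<omega>. \<zeta> \<omega> * f \<omega>)" if "sq_int M f" for f :: "'a \<Rightarrow> real"
  proof (rule sq_int_bound[OF that, where c=K])
    show "(\<lambda>\<omega>. \<zeta> \<omega> * f \<omega>) \<in> borel_measurable M"
      using \<zeta>M sq_int_measurable[OF that] by measurable
    show "AE x in M. norm (\<zeta> x * f x) \<le> K * norm (f x)"
      using \<zeta>(2) by (auto simp: abs_mult intro!: mult_right_mono)
  qed
  have int1: "integrable M (\<lambda>\<omega>. \<zeta> \<omega> * f \<omega>)" if "sq_int M f" for f :: "'a \<Rightarrow> real"
  proof (rule square_integrable_imp_integrable)
    show "(\<lambda>\<omega>. \<zeta> \<omega> * f \<omega>) \<in> borel_measurable M" using sq_int_measurable[OF bdd[OF that]] .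
    show "integrable M (\<lambda>\<omega>. (\<zeta> \<omega> * f \<omega>)\<^sup>2)"
      using sq_int_norm[OF bdd[OF that]] by simp
  qed
  \<comment> \<open>Split off the part of the first increment before \<open>c\<close>, then the overlap of the rest.\<close>
  have e1: "integrable M (\<lambda>\<omega>. (\<zeta> \<omega> * (X p \<omega> - X a \<omega>)) * (X d \<omega> - X c \<omega>))"
    "(\<integral>\<omega>. (\<zeta> \<omega> * (X p \<omega> - X a \<omega>)) * (X d \<omega> - X c \<omega>) \<partial>M) = 0"
  proof -
    have "(\<lambda>\<omega>. \<zeta> \<omega> * (X p \<omega> - X a \<omega>)) \<in> borel_measurable (F c)"
      using \<zeta>(1) F_meas_mono[OF adapted[of a p], of c] ord assms
      by (intro borel_measurable_times) auto
    moreover have "integrable M (\<lambda>\<omega>. \<zeta> \<omega> * (X p \<omega> - X a \<omega>))"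
      using ord assms by (intro int1 incr_sq_int) auto
    ultimately show "integrable M (\<lambda>\<omega>. (\<zeta> \<omega> * (X p \<omega> - X a \<omega>)) * (X d \<omega> - X c \<omega>))"
      "(\<integral>\<omega>. (\<zeta> \<omega> * (X p \<omega> - X a \<omega>)) * (X d \<omega> - X c \<omega>) \<partial>M) = 0"
      using mean_orthogonal[of c d] ord assms by auto
  qed
  have e2: "integrable M (\<lambda>\<omega>. (\<zeta> \<omega> * (X m \<omega> - X c \<omega>)) * (X n \<omega> - X m \<omega>))"
    "(\<integral>\<omega>. (\<zeta> \<omega> * (X m \<omega> - X c \<omega>)) * (X n \<omega> - X m \<omega>) \<partial>M) = 0"
  proof -
    have "(\<lambda>\<omega>. \<zeta> \<omega> * (X m \<omega> - X c \<omega>)) \<in> borel_measurable (F m)"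
      using F_meas_mono[OF \<zeta>(1), of m] adapted[of c m] ord assms
      by (intro borel_measurable_times) auto
    moreover have "integrable M (\<lambda>\<omega>. \<zeta> \<omega> * (X m \<omega> - X c \<omega>))"
      using ord assms by (intro int1 incr_sq_int) auto
    ultimately show "integrable M (\<lambda>\<omega>. (\<zeta> \<omega> * (X m \<omega> - X c \<omega>)) * (X n \<omega> - X m \<omega>))"
      "(\<integral>\<omega>. (\<zeta> \<omega> * (X m \<omega> - X c \<omega>)) * (X n \<omega> - X m \<omega>) \<partial>M) = 0"
      using mean_orthogonal[of m n] ord assms by auto
  qed
  have e3: "integrable M (\<lambda>\<omega>. \<zeta> \<omega> * (X m \<omega> - X c \<omega>)\<^sup>2)"
    "(\<integral>\<omega>. \<zeta> \<omega> * (X m \<omega> - X c \<omega>)\<^sup>2 \<partial>M) = (m - c) * (\<integral>\<omega>. \<zeta> \<omega> \<partial>M)"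
    using square_orthogonal[OF _ _ _ \<zeta>(1) \<zeta>i, of m] ord by auto
  have "\<zeta> \<omega> * ((X b \<omega> - X a \<omega>) * (X d \<omega> - X c \<omega>))
      = (\<zeta> \<omega> * (X p \<omega> - X a \<omega>)) * (X d \<omega> - X c \<omega>) + (\<zeta> \<omega> * (X m \<omega> - X c \<omega>)\<^sup>2
        + (\<zeta> \<omega> * (X m \<omega> - X c \<omega>)) * (X n \<omega> - X m \<omega>))" for \<omega>
    by (cases "b \<le> c"; cases "q \<le> d")
       (auto simp: p_def m_def n_def q_def max_def min_def power2_eq_square algebra_simps)
  then have "(\<integral>\<omega>. \<zeta> \<omega> * ((X b \<omega> - X a \<omega>) * (X d \<omega> - X c \<omega>)) \<partial>M) = (m - c) * (\<integral>\<omega>. \<zeta> \<omega> \<partial>M)"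
    using e1 e2 e3 by simp
  moreover have "m - c = max 0 (min b d - c)"
    using cd by (auto simp: m_def q_def max_def min_def)
  ultimately show ?thesis by simp
qed

lemma pair_orthogonal:
  assumes ab: "0 \<le> a" "a \<le> b" "b \<le> T" and cd: "0 \<le> c" "c \<le> d" "d \<le> T"
    and \<xi>: "\<xi> \<in> borel_measurable (F a)" "\<And>\<omega>. \<bar>\<xi> \<omega>\<bar> \<le> K"
    and \<eta>: "\<eta> \<in> borel_measurable (F c)" "\<And>\<omega>. \<bar>\<eta> \<omega>\<bar> \<le> K'"
  shows "(\<integral>\<omega>. (\<xi> \<omega> * \<eta> \<omega>) * ((X b \<omega> - X a \<omega>) * (X d \<omega> - X c \<omega>)) \<partial>M)
    = max 0 (min b d - max a c) * (\<integral>\<omega>. \<xi> \<omega> * \<eta> \<omega> \<partial>M)"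
proof -
  have bound: "\<bar>\<xi> \<omega> * \<eta> \<omega>\<bar> \<le> \<bar>K\<bar> * \<bar>K'\<bar>" for \<omega>
    using \<xi>(2)[of \<omega>] \<eta>(2)[of \<omega>] unfolding abs_mult by (intro mult_mono) auto
  show ?thesis
  proof (cases "a \<le> c")
    case True
    have "(\<lambda>\<omega>. \<xi> \<omega> * \<eta> \<omega>) \<in> borel_measurable (F c)"
      using F_meas_mono[OF \<xi>(1), of c] \<eta>(1) True assms by (intro borel_measurable_times) auto
    then show ?thesis
      using pair_orthogonal_ordered[OF ab cd(2,3) True _ bound] True by (simp add: max_absorb2)
  next
    case False
    have "(\<lambda>\<omega>. \<xi> \<omega> * \<eta> \<omega>) \<in> borel_measurable (F a)"
      using F_meas_mono[OF \<eta>(1), of a] \<xi>(1) False assms by (intro borel_measurable_times) auto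
    then have "(\<integral>\<omega>. (\<xi> \<omega> * \<eta> \<omega>) * ((X d \<omega> - X c \<omega>) * (X b \<omega> - X a \<omega>)) \<partial>M)
        = max 0 (min d b - a) * (\<integral>\<omega>. \<xi> \<omega> * \<eta> \<omega> \<partial>M)"
      using pair_orthogonal_ordered[OF cd ab(2,3) _ _ bound] False by simp
    moreover have "(\<xi> \<omega> * \<eta> \<omega>) * ((X b \<omega> - X a \<omega>) * (X d \<omega> - X c \<omega>))
        = (\<xi> \<omega> * \<eta> \<omega>) * ((X d \<omega> - X c \<omega>) * (X b \<omega> - X a \<omega>))" for \<omega>
      by (simp only: mult_ac)
    moreover have "max a c = a" "min b d = min d b"
      using False by (auto simp: max_def min_def)
    ultimately show ?thesis by (simp only:)
  qed
qed

end

text \<open>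
  The common form of the forward and of the backward situation. \<open>K a b\<close> is the information that an
  integrand may use on \<open>(a, b]\<close>: it grows with \<open>a\<close> in the forward case and shrinks as \<open>b\<close> grows in
  the backward case. In both cases a shorter interval allows more information.
\<close>
locale orthogonal_noise = prob_space M for M :: "'a measure" +
  fixes T :: real and X :: "real \<Rightarrow> 'a \<Rightarrow> real" and K :: "real \<Rightarrow> real \<Rightarrow> 'a measure"
  assumes K_subalg: "0 \<le> a \<Longrightarrow> a \<le> b \<Longrightarrow> b \<le> T \<Longrightarrow> subalgebra M (K a b)"
    and K_mono: "0 \<le> a \<Longrightarrow> a \<le> a' \<Longrightarrow> a' \<le> b' \<Longrightarrow> b' \<le> b \<Longrightarrow> b \<le> T \<Longrightarrow> sets (K a b) \<subseteq> sets (K a' b')"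
    and increment_sq_int: "0 \<le> a \<Longrightarrow> a \<le> b \<Longrightarrow> b \<le> T \<Longrightarrow> sq_int M (\<lambda>\<omega>. X b \<omega> - X a \<omega>)"
    and increment_mean: "0 \<le> a \<Longrightarrow> a \<le> b \<Longrightarrow> b \<le> T \<Longrightarrow> \<zeta> \<in> borel_measurable (K a b) \<Longrightarrow> integrable M \<zeta> \<Longrightarrow>
      integrable M (\<lambda>\<omega>. \<zeta> \<omega> * (X b \<omega> - X a \<omega>)) \<and> (\<integral>\<omega>. \<zeta> \<omega> * (X b \<omega> - X a \<omega>) \<partial>M) = 0"
    and increment_pair: "0 \<le> a \<Longrightarrow> a \<le> b \<Longrightarrow> b \<le> T \<Longrightarrow> 0 \<le> c \<Longrightarrow> c \<le> d \<Longrightarrow> d \<le> T \<Longrightarrow>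
      \<xi> \<in> borel_measurable (K a b) \<Longrightarrow> (\<And>\<omega>. \<bar>\<xi> \<omega>\<bar> \<le> k) \<Longrightarrow>
      \<eta> \<in> borel_measurable (K c d) \<Longrightarrow> (\<And>\<omega>. \<bar>\<eta> \<omega>\<bar> \<le> k') \<Longrightarrow>
      (\<integral>\<omega>. (\<xi> \<omega> * \<eta> \<omega>) * ((X b \<omega> - X a \<omega>) * (X d \<omega> - X c \<omega>)) \<partial>M)
        = max 0 (min b d - max a c) * (\<integral>\<omega>. \<xi> \<omega> * \<eta> \<omega> \<partial>M)"

context filtered_noise
begin

lemma orthogonal_noise_forward: "orthogonal_noise M T X (\<lambda>a b. F a)"
proof
  show "subalgebra M (F a)" if "0 \<le> a" "a \<le> b" "b \<le> T" for a b
    using subalg that by simp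
  show "sets (F a) \<subseteq> sets (F a')" if "0 \<le> a" "a \<le> a'" "a' \<le> b'" "b' \<le> b" "b \<le> T" for a a' b b'
    using F_mono that by simp
  show "sq_int M (\<lambda>\<omega>. X b \<omega> - X a \<omega>)" if "0 \<le> a" "a \<le> b" "b \<le> T" for a b
    using that by (rule incr_sq_int)
  show "integrable M (\<lambda>\<omega>. \<zeta> \<omega> * (X b \<omega> - X a \<omega>)) \<and> (\<integral>\<omega>. \<zeta> \<omega> * (X b \<omega> - X a \<omega>) \<partial>M) = 0"
    if "0 \<le> a" "a \<le> b" "b \<le> T" "\<zeta> \<in> borel_measurable (F a)" "integrable M \<zeta>" for a b \<zeta>
    using mean_orthogonal[OF that] by blast
qed (rule pair_orthogonal)

text \<open>
  The reflection \<open>t \<mapsto> T - t\<close> exchanges the endpoints of an interval and changes the sign of each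
  increment. Signs cancel in the product of two increments, and overlaps keep their length.
\<close>
lemma orthogonal_noise_reversed: "orthogonal_noise M T (\<lambda>t. X (T - t)) (\<lambda>a b. F (T - b))"
proof
  fix a b assume ab: "0 \<le> a" "a \<le> b" "b \<le> T"
  show "subalgebra M (F (T - b))" using subalg ab by simp
  have "sq_int M (\<lambda>\<omega>. - (X (T - a) \<omega> - X (T - b) \<omega>))"
    using ab by (intro sq_int_minus incr_sq_int) auto
  then show "sq_int M (\<lambda>\<omega>. X (T - b) \<omega> - X (T - a) \<omega>)" by simp
  fix \<zeta> :: "'a \<Rightarrow> real" assume \<zeta>: "\<zeta> \<in> borel_measurable (F (T - b))" "integrable M \<zeta>"
  have *: "\<zeta> \<omega> * (X (T - b) \<omega> - X (T - a) \<omega>) = - (\<zeta> \<omega> * (X (T - a) \<omega> - X (T - b) \<omega>))" for \<omega>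
    by (simp add: algebra_simps)
  show "integrable M (\<lambda>\<omega>. \<zeta> \<omega> * (X (T - b) \<omega> - X (T - a) \<omega>)) \<and>
      (\<integral>\<omega>. \<zeta> \<omega> * (X (T - b) \<omega> - X (T - a) \<omega>) \<partial>M) = 0"
    unfolding * using mean_orthogonal[OF _ _ _ \<zeta>, of "T - a"] ab by (simp del: right_diff_distrib)
next
  fix a a' b' b assume "0 \<le> a" "a \<le> a'" "a' \<le> b'" "b' \<le> b" "b \<le> T"
  then show "sets (F (T - b)) \<subseteq> sets (F (T - b'))" using F_mono by simp
next
  fix a b c d k k' and \<xi> \<eta> :: "'a \<Rightarrow> real"
  assume ab: "0 \<le> a" "a \<le> b" "b \<le> T" and cd: "0 \<le> c" "c \<le> d" "d \<le> T"
    and \<xi>: "\<xi> \<in> borel_measurable (F (T - b))" "\<And>\<omega>. \<bar>\<xi> \<omega>\<bar> \<le> k"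
    and \<eta>: "\<eta> \<in> borel_measurable (F (T - d))" "\<And>\<omega>. \<bar>\<eta> \<omega>\<bar> \<le> k'"
  have "(\<integral>\<omega>. (\<xi> \<omega> * \<eta> \<omega>) * ((X (T - b) \<omega> - X (T - a) \<omega>) * (X (T - d) \<omega> - X (T - c) \<omega>)) \<partial>M)
      = (\<integral>\<omega>. (\<xi> \<omega> * \<eta> \<omega>) * ((X (T - a) \<omega> - X (T - b) \<omega>) * (X (T - c) \<omega> - X (T - d) \<omega>)) \<partial>M)"
    by (intro Bochner_Integration.integral_cong) (auto simp: algebra_simps)
  also have "\<dots> = max 0 (min (T - a) (T - c) - max (T - b) (T - d)) * (\<integral>\<omega>. \<xi> \<omega> * \<eta> \<omega> \<partial>M)"
    by (rule pair_orthogonal[OF _ _ _ _ _ _ \<xi> \<eta>]) (use ab cd in auto)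
  also have "min (T - a) (T - c) - max (T - b) (T - d) = min b d - max a c"
    by (auto simp: min_def max_def)
  finally show "(\<integral>\<omega>. (\<xi> \<omega> * \<eta> \<omega>) * ((X (T - b) \<omega> - X (T - a) \<omega>) * (X (T - d) \<omega> - X (T - c) \<omega>)) \<partial>M)
      = max 0 (min b d - max a c) * (\<integral>\<omega>. \<xi> \<omega> * \<eta> \<omega> \<partial>M)" .
qed

end

lemma independent_processes_path_events:
  assumes "prob_space M" "independent_processes M T X Y"
    and "E \<in> path_events M T X" "E' \<in> path_events M T Y"
  shows "measure M (E \<inter> E') = measure M E * measure M E'"
proof -
  interpret prob_space M by fact
  obtain A A' where A: "A \<in> sets (Pi\<^sub>M {0..T} (\<lambda>_. borel))" "A' \<in> sets (Pi\<^sub>M {0..T} (\<lambda>_. borel))"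
    and E: "E = (\<lambda>\<omega>. \<lambda>t\<in>{0..T}. X t \<omega>) -` A \<inter> space M" "E' = (\<lambda>\<omega>. \<lambda>t\<in>{0..T}. Y t \<omega>) -` A' \<inter> space M"
    using assms(3,4) by (auto simp: path_events_def)
  have "(\<lambda>\<omega>. (\<lambda>t\<in>{0..T}. X t \<omega>, \<lambda>t\<in>{0..T}. Y t \<omega>)) -` (A \<times> A') \<inter> space M = E \<inter> E'"
    unfolding E by blast
  with indep_varD[OF assms(2)[unfolded independent_processes_def] A] show ?thesis
    unfolding E by (simp only:)
qed

lemma filtered_noise_W:
  assumes basis: "doubly_stochastic_basis M T W B"
  shows "filtered_noise M T W (\<lambda>t. info M W B T t 0)"
proof -
  interpret prob_space M using basis unfolding doubly_stochastic_basis_def by blast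
  note basis' = basis[unfolded doubly_stochastic_basis_def]
  from basis' have T: "0 < T" by blast
  from basis' have W: "standard_brownian_motion M T W" by blast
  from basis' have B: "standard_brownian_motion M T B" by blast
  from basis' have WB: "independent_processes M T W B" by blast
  have Bm: "\<And>r. r \<in> {0..T} \<Longrightarrow> B r \<in> borel_measurable M"
    using B unfolding standard_brownian_motion_def by blast
  show ?thesis
  proof
    show "subalgebra M (info M W B T t 0)" if "0 \<le> t" "t \<le> T" for t
      using subalgebra_info[OF W B] that T by simp
    show "sets (info M W B T s 0) \<subseteq> sets (info M W B T t 0)" if "s \<le> t" for s t
      by (rule sets_info_mono) (use that T in auto)
    fix a b assume ab: "0 \<le> a" "a \<le> b" "b \<le> T"
    have "(\<lambda>\<omega>. (W b \<omega> - W 0 \<omega>) - (W a \<omega> - W 0 \<omega>)) \<in> borel_measurable (info M W B T b 0)"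
      using ab by (intro borel_measurable_diff increment_W_measurable_info) auto
    then show "(\<lambda>\<omega>. W b \<omega> - W a \<omega>) \<in> borel_measurable (info M W B T b 0)" by simp
    show "indep_var borel \<zeta> borel (\<lambda>\<omega>. W b \<omega> - W a \<omega>)"
      if "\<zeta> \<in> borel_measurable (info M W B T a 0)" for \<zeta> :: "'a \<Rightarrow> real"
      by (rule increment_indep_sigma[OF prob_space_axioms W Bm
            independent_processes_path_events[OF prob_space_axioms WB], where s=0 and t=a and s'=0 and t'=T])
         (use that ab T in \<open>auto simp: sets_info\<close>)
    show "integrable M (\<lambda>\<omega>. (W b \<omega> - W a \<omega>)\<^sup>2)" "(\<integral>\<omega>. (W b \<omega> - W a \<omega>)\<^sup>2 \<partial>M) = b - a"
      "(\<integral>\<omega>. W b \<omega> - W a \<omega> \<partial>M) = 0"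
      by (fact brownian_increment_moments[OF prob_space_axioms W ab])+
  qed
qed

text \<open>Seen backwards from \<open>T\<close>, the information in the future of \<open>B\<close> increases.\<close>
lemma filtered_noise_B:
  assumes basis: "doubly_stochastic_basis M T W B"
  shows "filtered_noise M T (\<lambda>t. B (T - t)) (\<lambda>t. info M W B T T (T - t))"
proof -
  interpret prob_space M using basis unfolding doubly_stochastic_basis_def by blast
  note basis' = basis[unfolded doubly_stochastic_basis_def]
  from basis' have T: "0 < T" by blast
  from basis' have W: "standard_brownian_motion M T W" by blast
  from basis' have B: "standard_brownian_motion M T B" by blast
  from basis' have WB: "independent_processes M T W B" by blast
  have Wm: "\<And>r. r \<in> {0..T} \<Longrightarrow> W r \<in> borel_measurable M"
    using W unfolding standard_brownian_motion_def by blast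
  show ?thesis
  proof
    show "subalgebra M (info M W B T T (T - t))" if "0 \<le> t" "t \<le> T" for t
      using subalgebra_info[OF W B] that T by simp
    show "sets (info M W B T T (T - s)) \<subseteq> sets (info M W B T T (T - t))" if "0 \<le> s" "s \<le> t" for s t
      by (rule sets_info_mono) (use that T in auto)
    fix a b assume ab: "0 \<le> a" "a \<le> b" "b \<le> T"
    have "(\<lambda>\<omega>. - (B (T - a) \<omega> - B (T - b) \<omega>)) \<in> borel_measurable (info M W B T T (T - b))"
      using ab by (intro borel_measurable_uminus increment_B_measurable_info) auto
    then show "(\<lambda>\<omega>. B (T - b) \<omega> - B (T - a) \<omega>) \<in> borel_measurable (info M W B T T (T - b))" by simp
    show "indep_var borel \<zeta> borel (\<lambda>\<omega>. B (T - b) \<omega> - B (T - a) \<omega>)"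
      if "\<zeta> \<in> borel_measurable (info M W B T T (T - a))" for \<zeta> :: "'a \<Rightarrow> real"
    proof -
      have "indep_var borel \<zeta> borel (\<lambda>\<omega>. B (T - a) \<omega> - B (T - b) \<omega>)"
      proof (rule increment_indep_sigma[OF prob_space_axioms B Wm,
            where s="T - a" and t=T and s'=0 and t'=T])
        show "measure M (E \<inter> E') = measure M E * measure M E'"
          if "E \<in> path_events M T B" "E' \<in> path_events M T W" for E E'
          using independent_processes_path_events[OF prob_space_axioms WB that(2,1)]
          by (simp add: Int_commute mult.commute)
      qed (use that ab T in \<open>auto simp: sets_info Un_commute\<close>)
      then have "indep_var borel ((\<lambda>x. x) \<circ> \<zeta>) borel (uminus \<circ> (\<lambda>\<omega>. B (T - a) \<omega> - B (T - b) \<omega>))"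
        by (rule indep_var_compose) auto
      then show ?thesis by (simp add: comp_def)
    qed
    note m = brownian_increment_moments[OF prob_space_axioms B, of "T - b" "T - a"]
    show "integrable M (\<lambda>\<omega>. (B (T - b) \<omega> - B (T - a) \<omega>)\<^sup>2)"
      "(\<integral>\<omega>. (B (T - b) \<omega> - B (T - a) \<omega>)\<^sup>2 \<partial>M) = b - a"
      using m ab by (auto simp: power2_commute[of "B (T - b) _"])
    have "(\<integral>\<omega>. B (T - b) \<omega> - B (T - a) \<omega> \<partial>M) = (\<integral>\<omega>. - (B (T - a) \<omega> - B (T - b) \<omega>) \<partial>M)" by simp
    also have "\<dots> = 0" unfolding integral_minus using m ab by simp
    finally show "(\<integral>\<omega>. B (T - b) \<omega> - B (T - a) \<omega> \<partial>M) = 0" .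
  qed
qed

lemma orthogonal_noise_W:
  "doubly_stochastic_basis M T W B \<Longrightarrow> orthogonal_noise M T W (\<lambda>a b. info M W B T a 0)"
  by (rule filtered_noise.orthogonal_noise_forward[OF filtered_noise_W])

lemma orthogonal_noise_B:
  "doubly_stochastic_basis M T W B \<Longrightarrow> orthogonal_noise M T B (\<lambda>a b. info M W B T T b)"
  by (drule filtered_noise_B, drule filtered_noise.orthogonal_noise_reversed) simp

section \<open>The isometry for stochastic integrals\<close>

text \<open>The space on which processes are compared in \<open>L\<^sup>2\<close>; a process enters it through \<open>joint\<close>.\<close>
definition state_time :: "'a measure \<Rightarrow> real \<Rightarrow> ('a \<times> real) measure" where
  "state_time M T = M \<Otimes>\<^sub>M restrict_space lborel {0..T}"

definition joint :: "(real \<Rightarrow> 'a \<Rightarrow> 'b) \<Rightarrow> 'a \<times> real \<Rightarrow> 'b" where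
  "joint X p = X (snd p) (fst p)"

definition strip :: "real \<Rightarrow> real \<Rightarrow> ('a \<times> real) set" where
  "strip s t = UNIV \<times> {s<..t}"

lemma indicator_strip: "indicator (strip s t) p = (indicator {s<..t} (snd p) :: real)"
  by (cases p) (simp add: strip_def indicator_def)

lemma finite_measure_time: "finite_measure (restrict_space lborel {0..T::real})"
  by (rule finite_measureI)
     (simp add: space_restrict_space emeasure_restrict_space emeasure_lborel_Icc_eq)

lemma space_state_time: "space (state_time M T) = space M \<times> {0..T}"
  by (simp add: state_time_def space_pair_measure space_restrict_space)

lemma sets_state_time: "sets (state_time M T) = sets (M \<Otimes>\<^sub>M restrict_space borel {0..T})"
  unfolding state_time_def by (intro sets_pair_measure_cong sets_restrict_space_cong) auto

lemma strip_measurable: "strip s t \<inter> space (state_time M T) \<in> sets (state_time M T)"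
proof -
  have "strip s t \<inter> space (state_time M T) = space M \<times> ({s<..t} \<inter> {0..T})"
    by (auto simp: strip_def space_state_time)
  moreover have "{s<..t} \<inter> {0..T} \<in> sets (restrict_space lborel {0..T})"
    by (subst sets_restrict_space_iff) auto
  ultimately show ?thesis by (simp add: state_time_def pair_measureI)
qed

lemma time_component_measurable: "f \<in> borel_measurable borel \<Longrightarrow> (\<lambda>p. f (snd p)) \<in> borel_measurable (state_time M T)"
proof -
  assume f: "f \<in> borel_measurable borel"
  have "f \<in> borel_measurable (restrict_space lborel {0..T})"
    using f by (intro measurable_restrict_space1) simp
  then show ?thesis unfolding state_time_def by (rule measurable_compose[OF measurable_snd])
qed

lemma state_component_measurable: "f \<in> borel_measurable M \<Longrightarrow> (\<lambda>p. f (fst p)) \<in> borel_measurable (state_time M T)"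
  unfolding state_time_def by (rule measurable_compose[OF measurable_fst])

lemma finite_measure_state_time:
  assumes "prob_space M" shows "finite_measure (state_time M T)"
proof -
  interpret prob_space M by fact
  show ?thesis unfolding state_time_def
    using finite_measure_pair_measure[OF finite_measure_time finite_measure_axioms] .
qed

lemma measure_strip_overlap:
  fixes a b c d :: real
  assumes "0 \<le> a" "b \<le> T" "0 \<le> c" "d \<le> T"
  shows "measure (restrict_space lborel {0..T}) ({a<..b} \<inter> {c<..d}) = max 0 (min b d - max a c)"
proof -
  have eq: "{a<..b} \<inter> {c<..d} = {max a c<..min b d}" by auto
  have "{a<..b} \<inter> {c<..d} \<subseteq> {0..T}" using assms by auto
  then have "measure (restrict_space lborel {0..T}) ({a<..b} \<inter> {c<..d}) = measure lborel {max a c<..min b d}"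
    by (subst measure_restrict_space) (auto simp: eq)
  also have "\<dots> = max 0 (min b d - max a c)"
    by (cases "max a c \<le> min b d") (auto simp: max_def)
  finally show ?thesis .
qed

lemma integral_product_indicator:
  fixes \<zeta> :: "'a \<Rightarrow> real"
  assumes "prob_space M" and \<zeta>: "\<zeta> \<in> borel_measurable M" "\<And>\<omega>. \<bar>\<zeta> \<omega>\<bar> \<le> k"
    and A: "A \<in> sets borel" "A \<subseteq> {0..T}"
  shows "integrable (state_time M T) (\<lambda>p. \<zeta> (fst p) * indicator A (snd p))"
    "(\<integral>p. \<zeta> (fst p) * indicator A (snd p) \<partial>state_time M T)
      = (\<integral>\<omega>. \<zeta> \<omega> \<partial>M) * measure (restrict_space lborel {0..T}) A"
proof -
  interpret prob_space M by fact
  interpret L: finite_measure "restrict_space lborel {0..T}" by (rule finite_measure_time)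
  interpret P: pair_sigma_finite M "restrict_space lborel {0..T}" ..
  interpret ST: finite_measure "state_time M T" by (rule finite_measure_state_time) fact
  have m: "(\<lambda>p. \<zeta> (fst p) * indicator A (snd p)) \<in> borel_measurable (state_time M T)"
    using A \<zeta> by (intro borel_measurable_times state_component_measurable time_component_measurable) auto
  have k: "0 \<le> k" using \<zeta>(2)[of undefined] by linarith
  show i: "integrable (state_time M T) (\<lambda>p. \<zeta> (fst p) * indicator A (snd p))"
    by (rule ST.integrable_const_bound[of _ k, OF _ m])
       (use \<zeta>(2) k in \<open>auto simp: indicator_def\<close>)
  have "(\<integral>p. \<zeta> (fst p) * indicator A (snd p) \<partial>state_time M T)
      = (\<integral>\<omega>. (\<integral>r. \<zeta> \<omega> * indicator A r \<partial>restrict_space lborel {0..T}) \<partial>M)"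
    unfolding state_time_def
    using P.integral_fst'[OF i[unfolded state_time_def]] by simp
  also have "(\<lambda>\<omega>. (\<integral>r. \<zeta> \<omega> * indicator A r \<partial>restrict_space lborel {0..T}))
      = (\<lambda>\<omega>. \<zeta> \<omega> * measure (restrict_space lborel {0..T}) A)"
  proof
    fix \<omega>
    have "A \<in> sets (restrict_space lborel {0..T})"
      using A by (subst sets_restrict_space_iff) auto
    then show "(\<integral>r. \<zeta> \<omega> * indicator A r \<partial>restrict_space lborel {0..T})
        = \<zeta> \<omega> * measure (restrict_space lborel {0..T}) A"
      using A(2) by (simp add: Int_absorb2 space_restrict_space)
  qed
  finally show "(\<integral>p. \<zeta> (fst p) * indicator A (snd p) \<partial>state_time M T)
      = (\<integral>\<omega>. \<zeta> \<omega> \<partial>M) * measure (restrict_space lborel {0..T}) A" by simp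
qed

lemma integral_sum_sum:
  fixes f :: "'i \<Rightarrow> 'j \<Rightarrow> 'c \<Rightarrow> real"
  assumes "\<And>i j. i \<in> I \<Longrightarrow> j \<in> J \<Longrightarrow> integrable N (f i j)"
  shows "(\<integral>x. (\<Sum>i\<in>I. \<Sum>j\<in>J. f i j x) \<partial>N) = (\<Sum>i\<in>I. \<Sum>j\<in>J. \<integral>x. f i j x \<partial>N)"
proof -
  have "(\<integral>x. (\<Sum>i\<in>I. \<Sum>j\<in>J. f i j x) \<partial>N) = (\<Sum>i\<in>I. \<integral>x. (\<Sum>j\<in>J. f i j x) \<partial>N)"
    using assms by (intro Bochner_Integration.integral_sum Bochner_Integration.integrable_sum)
  also have "\<dots> = (\<Sum>i\<in>I. \<Sum>j\<in>J. \<integral>x. f i j x \<partial>N)"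
    using assms by (intro sum.cong Bochner_Integration.integral_sum refl)
  finally show ?thesis .
qed

lemma ip_sum_sum:
  assumes "\<And>i. i \<in> I \<Longrightarrow> sq_int N (f i)" "\<And>j. j \<in> J \<Longrightarrow> sq_int N (g j)"
  shows "ip N (\<lambda>x. \<Sum>i\<in>I. f i x) (\<lambda>x. \<Sum>j\<in>J. g j x) = (\<Sum>i\<in>I. \<Sum>j\<in>J. ip N (f i) (g j))"
  unfolding ip_def inner_sum_left unfolding inner_sum_right
  using assms by (intro integral_sum_sum sq_int_integrable_inner)

lemma increment_min_clamp:
  fixes X :: "real \<Rightarrow> 'b::ab_group_add"
  assumes "s \<le> t"
  shows "X (min t q) - X (min s q) = X (max s (min t q)) - X s"
  using assms by (cases "q \<le> s") (auto simp: min_def max_def)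

text \<open>
  An increment over \<open>(s, t]\<close> of an elementary integral is the sum over the same partition with its
  points clamped to \<open>[s, t]\<close>: the path at a clamped point and the truncated increment differ by the
  path value at \<open>s\<close>, which cancels between the two ends of a partition interval.
\<close>
lemma step_integral_diff:
  assumes "s \<le> t"
  shows "step_integral X n \<tau> \<xi> t \<omega> - step_integral X n \<tau> \<xi> s \<omega>
    = (\<Sum>i<n. (X (max s (min t (\<tau> (Suc i)))) \<omega> - X (max s (min t (\<tau> i))) \<omega>) *\<^sub>R \<xi> i \<omega>)"
proof -
  have "(X (min t p) \<omega> - X (min t q) \<omega>) - (X (min s p) \<omega> - X (min s q) \<omega>)
      = X (max s (min t p)) \<omega> - X (max s (min t q)) \<omega>" for p q
    using increment_min_clamp[OF assms, of "\<lambda>r. X r \<omega>" p] increment_min_clamp[OF assms, of "\<lambda>r. X r \<omega>" q]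
    by (simp add: algebra_simps)
  then show ?thesis
    unfolding step_integral_def by (simp add: sum_subtractf[symmetric] scaleR_diff_left[symmetric])
qed

context orthogonal_noise
begin

definition noise_step_data :: "nat \<Rightarrow> (nat \<Rightarrow> real) \<Rightarrow> (nat \<Rightarrow> 'a \<Rightarrow> 'b::euclidean_space) \<Rightarrow> bool" where
  "noise_step_data n \<tau> \<xi> \<longleftrightarrow> step_data T n \<tau> \<xi> \<and> (\<forall>i<n. \<xi> i \<in> borel_measurable (K (\<tau> i) (\<tau> (Suc i))))"

lemma noise_step_dataD:
  assumes "noise_step_data n \<tau> \<xi>" "i < n"
  shows "0 \<le> \<tau> i" "\<tau> i \<le> \<tau> (Suc i)" "\<tau> (Suc i) \<le> T" "\<xi> i \<in> borel_measurable (K (\<tau> i) (\<tau> (Suc i)))"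
    "\<xi> i \<in> borel_measurable M" "\<exists>c. \<forall>\<omega>. norm (\<xi> i \<omega>) \<le> c"
proof -
  have *: "mono_on {..n} \<tau>" "\<tau> ` {..n} \<subseteq> {0..T}" "\<exists>c. \<forall>i<n. \<forall>\<omega>. norm (\<xi> i \<omega>) \<le> c"
    "\<xi> i \<in> borel_measurable (K (\<tau> i) (\<tau> (Suc i)))"
    using assms by (auto simp: noise_step_data_def step_data_def)
  have "\<tau> i \<in> \<tau> ` {..n}" "\<tau> (Suc i) \<in> \<tau> ` {..n}" using assms(2) by auto
  then have "\<tau> i \<in> {0..T}" "\<tau> (Suc i) \<in> {0..T}" using *(2) by blast+
  then show b: "0 \<le> \<tau> i" "\<tau> (Suc i) \<le> T" by auto
  show le: "\<tau> i \<le> \<tau> (Suc i)" by (rule mono_onD[OF *(1)]) (use assms in auto)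
  show "\<xi> i \<in> borel_measurable (K (\<tau> i) (\<tau> (Suc i)))" by (rule *(4))
  then show "\<xi> i \<in> borel_measurable M"
    by (rule measurable_from_subalg[OF K_subalg[OF b(1) le b(2)]])
  show "\<exists>c. \<forall>\<omega>. norm (\<xi> i \<omega>) \<le> c" using *(3) assms(2) by blast
qed

lemma K_meas_mono:
  assumes "f \<in> borel_measurable (K a b)" "0 \<le> a" "a \<le> a'" "a' \<le> b'" "b' \<le> b" "b \<le> T"
  shows "f \<in> borel_measurable (K a' b')"
proof (rule measurable_mono_sets[OF assms(1)])
  have "subalgebra M (K a b)" "subalgebra M (K a' b')" using assms by (auto intro!: K_subalg)
  then show "space (K a b) = space (K a' b')" by (simp add: subalgebra_def)
  show "sets (K a b) \<subseteq> sets (K a' b')" by (rule K_mono) (use assms in auto)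
qed

text \<open>
  Truncating an interval shrinks it and therefore enlarges the information. An empty truncation may
  lie outside \<open>[p, q]\<close> and has to be excluded; the increment over it is zero.
\<close>
lemma truncated_measurable:
  assumes st: "0 \<le> s" "s \<le> t" "t \<le> T" and pq: "0 \<le> p" "p \<le> q" "q \<le> T"
    and ne: "max s (min t p) < max s (min t q)" and f: "f \<in> borel_measurable (K p q)"
  shows "f \<in> borel_measurable (K (max s (min t p)) (max s (min t q)))"
  by (rule K_meas_mono[OF f]) (use st pq ne in \<open>auto simp: max_def min_def split: if_splits\<close>)

lemma step_process_sq_int:
  assumes "noise_step_data n \<tau> \<xi>"
  shows "sq_int (state_time M T) (joint (step_process n \<tau> \<xi>))"
  unfolding step_process_def joint_def
proof (rule sq_int_sum)
  fix i assume i: "i \<in> {..<n}"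
  interpret ST: finite_measure "state_time M T"
    by (rule finite_measure_state_time) (rule prob_space_axioms)
  note d = noise_step_dataD[OF assms, of i]
  obtain c where c: "\<And>\<omega>. norm (\<xi> i \<omega>) \<le> c" using d(6) i by auto
  have m: "(\<lambda>p. indicator {\<tau> i<..\<tau> (Suc i)} (snd p) *\<^sub>R \<xi> i (fst p)) \<in> borel_measurable (state_time M T)"
    using d(5) i by (intro borel_measurable_scaleR state_component_measurable time_component_measurable) auto
  have c0: "0 \<le> c" using c[of undefined] norm_ge_zero order_trans by blast
  show "sq_int (state_time M T) (\<lambda>p. indicator {\<tau> i<..\<tau> (Suc i)} (snd p) *\<^sub>R \<xi> i (fst p))"
    unfolding sq_int_def
  proof
    have "(norm (indicator {\<tau> i<..\<tau> (Suc i)} (snd p) *\<^sub>R \<xi> i (fst p)))\<^sup>2 \<le> c\<^sup>2" for p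
      using c[of "fst p"] c0 by (intro power_mono) (auto simp: indicator_def)
    then have "AE p in state_time M T. norm ((norm (indicator {\<tau> i<..\<tau> (Suc i)} (snd p) *\<^sub>R \<xi> i (fst p)))\<^sup>2) \<le> c\<^sup>2"
      by simp
    moreover have "(\<lambda>p. (norm (indicator {\<tau> i<..\<tau> (Suc i)} (snd p) *\<^sub>R \<xi> i (fst p)))\<^sup>2) \<in> borel_measurable (state_time M T)"
      using m by measurable
    ultimately show "integrable (state_time M T) (\<lambda>p. (norm (indicator {\<tau> i<..\<tau> (Suc i)} (snd p) *\<^sub>R \<xi> i (fst p)))\<^sup>2)"
      by (rule ST.integrable_const_bound)
  qed (rule m)
qed

lemma increment_scaleR_sq_int:
  assumes "0 \<le> a" "a \<le> b" "b \<le> T" "\<xi> \<in> borel_measurable M" "\<exists>c. \<forall>\<omega>. norm (\<xi> \<omega>) \<le> c"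
  shows "sq_int M (\<lambda>\<omega>. (X b \<omega> - X a \<omega>) *\<^sub>R \<xi> \<omega>)"
proof -
  obtain c where c: "\<And>\<omega>. norm (\<xi> \<omega>) \<le> c" using assms by auto
  note s = increment_sq_int[OF assms(1-3)]
  show ?thesis
  proof (rule sq_int_bound[OF s, where c=c])
    show "(\<lambda>\<omega>. (X b \<omega> - X a \<omega>) *\<^sub>R \<xi> \<omega>) \<in> borel_measurable M"
      using sq_int_measurable[OF s] assms(4) by (rule borel_measurable_scaleR)
    show "AE \<omega> in M. norm ((X b \<omega> - X a \<omega>) *\<^sub>R \<xi> \<omega>) \<le> c * norm (X b \<omega> - X a \<omega>)"
      using c by (auto simp: mult.commute[of c] intro!: mult_left_mono)
  qed
qed

lemma clamp_bounds:
  assumes st: "0 \<le> s" "s \<le> t" "t \<le> T" and "p \<le> q"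
  shows "0 \<le> max s (min t p)" "max s (min t p) \<le> max s (min t q)" "max s (min t q) \<le> T"
  using assms by (auto simp: max_def min_def)

lemma step_integral_diff_sq_int:
  assumes "noise_step_data n \<tau> \<xi>" "0 \<le> s" "s \<le> t" "t \<le> T"
  shows "sq_int M (\<lambda>\<omega>. step_integral X n \<tau> \<xi> t \<omega> - step_integral X n \<tau> \<xi> s \<omega>)"
  unfolding step_integral_diff[OF assms(3)]
proof (rule sq_int_sum)
  fix i assume "i \<in> {..<n}"
  then have i: "i < n" by simp
  note d = noise_step_dataD[OF assms(1) i]
  show "sq_int M (\<lambda>\<omega>. (X (max s (min t (\<tau> (Suc i)))) \<omega> - X (max s (min t (\<tau> i))) \<omega>) *\<^sub>R \<xi> i \<omega>)"
    by (rule increment_scaleR_sq_int[OF clamp_bounds[OF assms(2-4) d(2)] d(5,6)])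
qed

lemma step_integral_sq_int:
  assumes d: "noise_step_data n \<tau> \<xi>" and t: "0 \<le> t" "t \<le> T"
  shows "sq_int M (step_integral X n \<tau> \<xi> t)"
proof -
  have "step_integral X n \<tau> \<xi> 0 \<omega> = 0" for \<omega>
    unfolding step_integral_def
  proof (rule sum.neutral, safe)
    fix i assume "i < n"
    note b = noise_step_dataD[OF d this]
    have "min 0 (\<tau> i) = 0" "min 0 (\<tau> (Suc i)) = 0" using b(1,2) by auto
    then show "(X (min 0 (\<tau> (Suc i))) \<omega> - X (min 0 (\<tau> i)) \<omega>) *\<^sub>R \<xi> i \<omega> = 0" by simp
  qed
  then show ?thesis using step_integral_diff_sq_int[OF d order_refl t] by simp
qed

text \<open>
  The scalar relation is summed over the coordinates. Measurability with respect to \<open>K\<close> is asked only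
  for nonempty intervals, as provided by \<open>truncated_measurable\<close>.
\<close>
lemma increment_pair_inner:
  fixes \<xi> \<eta> :: "'a \<Rightarrow> 'b::euclidean_space"
  assumes ab: "0 \<le> a" "a \<le> b" "b \<le> T" and cd: "0 \<le> c" "c \<le> d" "d \<le> T"
    and \<xi>: "a < b \<Longrightarrow> \<xi> \<in> borel_measurable (K a b)" "\<xi> \<in> borel_measurable M" "\<exists>k. \<forall>\<omega>. norm (\<xi> \<omega>) \<le> k"
    and \<eta>: "c < d \<Longrightarrow> \<eta> \<in> borel_measurable (K c d)" "\<eta> \<in> borel_measurable M" "\<exists>k. \<forall>\<omega>. norm (\<eta> \<omega>) \<le> k"
  shows "ip M (\<lambda>\<omega>. (X b \<omega> - X a \<omega>) *\<^sub>R \<xi> \<omega>) (\<lambda>\<omega>. (X d \<omega> - X c \<omega>) *\<^sub>R \<eta> \<omega>)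
    = max 0 (min b d - max a c) * (\<integral>\<omega>. \<xi> \<omega> \<bullet> \<eta> \<omega> \<partial>M)"
proof (cases "a = b \<or> c = d")
  case True
  then show ?thesis using ab cd by (auto simp: ip_def max_def min_def)
next
  case False
  obtain k k' where k: "\<And>\<omega>. norm (\<xi> \<omega>) \<le> k" "\<And>\<omega>. norm (\<eta> \<omega>) \<le> k'" using \<xi>(3) \<eta>(3) by auto
  have \<xi>K: "\<xi> \<in> borel_measurable (K a b)" and \<eta>K: "\<eta> \<in> borel_measurable (K c d)"
    using False ab cd \<xi>(1) \<eta>(1) by auto
  have comp: "(\<lambda>\<omega>. f \<omega> \<bullet> e) \<in> borel_measurable N" if "f \<in> borel_measurable N"
    for f :: "'c \<Rightarrow> 'b" and e and N :: "'c measure"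
    using that by (intro borel_measurable_inner) auto
  have bd: "\<bar>\<xi> \<omega> \<bullet> e\<bar> \<le> k" "\<bar>\<eta> \<omega> \<bullet> e\<bar> \<le> k'" if "e \<in> Basis" for \<omega> e
    using Basis_le_norm[OF that, of "\<xi> \<omega>"] Basis_le_norm[OF that, of "\<eta> \<omega>"] k[of \<omega>] by linarith+
  have pr: "(\<integral>\<omega>. ((\<xi> \<omega> \<bullet> e) * (\<eta> \<omega> \<bullet> e)) * ((X b \<omega> - X a \<omega>) * (X d \<omega> - X c \<omega>)) \<partial>M)
      = max 0 (min b d - max a c) * (\<integral>\<omega>. (\<xi> \<omega> \<bullet> e) * (\<eta> \<omega> \<bullet> e) \<partial>M)" if "e \<in> Basis" for e
    by (rule increment_pair[OF ab cd comp[OF \<xi>K] bd(1)[OF that] comp[OF \<eta>K] bd(2)[OF that]])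
  have i1: "integrable M (\<lambda>\<omega>. ((\<xi> \<omega> \<bullet> e) * (\<eta> \<omega> \<bullet> e)) * ((X b \<omega> - X a \<omega>) * (X d \<omega> - X c \<omega>)))"
    if "e \<in> Basis" for e
  proof -
    have "sq_int M (\<lambda>\<omega>. (X b \<omega> - X a \<omega>) *\<^sub>R (\<xi> \<omega> \<bullet> e))"
      by (rule increment_scaleR_sq_int[OF ab comp[OF \<xi>(2)]]) (use bd(1)[OF that] in auto)
    moreover have "sq_int M (\<lambda>\<omega>. (X d \<omega> - X c \<omega>) *\<^sub>R (\<eta> \<omega> \<bullet> e))"
      by (rule increment_scaleR_sq_int[OF cd comp[OF \<eta>(2)]]) (use bd(2)[OF that] in auto)
    ultimately have "integrable M (\<lambda>\<omega>. ((X b \<omega> - X a \<omega>) *\<^sub>R (\<xi> \<omega> \<bullet> e)) \<bullet> ((X d \<omega> - X c \<omega>) *\<^sub>R (\<eta> \<omega> \<bullet> e)))"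
      by (rule sq_int_integrable_inner)
    then show ?thesis by (simp add: mult_ac)
  qed
  have i2: "integrable M (\<lambda>\<omega>. (\<xi> \<omega> \<bullet> e) * (\<eta> \<omega> \<bullet> e))" if "e \<in> Basis" for e
  proof (rule integrable_const_bound[of _ "k * k'"])
    show "AE \<omega> in M. norm ((\<xi> \<omega> \<bullet> e) * (\<eta> \<omega> \<bullet> e)) \<le> k * k'"
      using bd[OF that] by (auto simp: abs_mult intro!: mult_mono order_trans[OF abs_ge_zero])
    show "(\<lambda>\<omega>. (\<xi> \<omega> \<bullet> e) * (\<eta> \<omega> \<bullet> e)) \<in> borel_measurable M"
      by (intro borel_measurable_times comp \<xi> \<eta>)
  qed
  have "ip M (\<lambda>\<omega>. (X b \<omega> - X a \<omega>) *\<^sub>R \<xi> \<omega>) (\<lambda>\<omega>. (X d \<omega> - X c \<omega>) *\<^sub>R \<eta> \<omega>)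
      = (\<integral>\<omega>. (\<Sum>e\<in>Basis. ((\<xi> \<omega> \<bullet> e) * (\<eta> \<omega> \<bullet> e)) * ((X b \<omega> - X a \<omega>) * (X d \<omega> - X c \<omega>))) \<partial>M)"
    unfolding ip_def
  proof (rule Bochner_Integration.integral_cong[OF refl])
    fix \<omega>
    have "((X b \<omega> - X a \<omega>) *\<^sub>R \<xi> \<omega>) \<bullet> ((X d \<omega> - X c \<omega>) *\<^sub>R \<eta> \<omega>)
       = (\<xi> \<omega> \<bullet> \<eta> \<omega>) * ((X b \<omega> - X a \<omega>) * (X d \<omega> - X c \<omega>))" by simp
    also have "\<dots> = (\<Sum>e\<in>Basis. ((\<xi> \<omega> \<bullet> e) * (\<eta> \<omega> \<bullet> e)) * ((X b \<omega> - X a \<omega>) * (X d \<omega> - X c \<omega>)))"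
      by (subst euclidean_inner) (rule sum_distrib_right)
    finally show "((X b \<omega> - X a \<omega>) *\<^sub>R \<xi> \<omega>) \<bullet> ((X d \<omega> - X c \<omega>) *\<^sub>R \<eta> \<omega>)
      = (\<Sum>e\<in>Basis. ((\<xi> \<omega> \<bullet> e) * (\<eta> \<omega> \<bullet> e)) * ((X b \<omega> - X a \<omega>) * (X d \<omega> - X c \<omega>)))" .
  qed
  also have "\<dots> = (\<Sum>e\<in>Basis. max 0 (min b d - max a c) * (\<integral>\<omega>. (\<xi> \<omega> \<bullet> e) * (\<eta> \<omega> \<bullet> e) \<partial>M))"
    by (subst Bochner_Integration.integral_sum[OF i1]) (auto intro!: sum.cong pr)
  also have "\<dots> = max 0 (min b d - max a c) * (\<integral>\<omega>. (\<Sum>e\<in>Basis. (\<xi> \<omega> \<bullet> e) * (\<eta> \<omega> \<bullet> e)) \<partial>M)"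
    by (subst Bochner_Integration.integral_sum[OF i2]) (auto simp: sum_distrib_left)
  also have "\<dots> = max 0 (min b d - max a c) * (\<integral>\<omega>. \<xi> \<omega> \<bullet> \<eta> \<omega> \<partial>M)"
    by (simp add: euclidean_inner[symmetric])
  finally show ?thesis .
qed

lemma indicator_clamp:
  fixes s t p q r :: real
  assumes "s \<le> t" "p \<le> q"
  shows "indicator {s<..t} r * indicator {p<..q} r = (indicator {max s (min t p)<..max s (min t q)} r :: real)"
  using assms by (auto simp: indicator_def max_def min_def)

text \<open>
  Both sides expand into a double sum over pairs of partition intervals, in which each pair
  contributes the length of its overlap inside \<open>(s, t]\<close> times the expectation of
  \<open>\<langle>\<xi>\<^sub>i, \<eta>\<^sub>j\<rangle>\<close>. The two partitions can therefore be unrelated.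
\<close>
lemma step_isometry:
  fixes \<xi> \<eta> :: "nat \<Rightarrow> 'a \<Rightarrow> 'b::euclidean_space"
  assumes d: "noise_step_data n \<tau> \<xi>" and d': "noise_step_data n' \<tau>' \<eta>" and st: "0 \<le> s" "s \<le> t" "t \<le> T"
  shows "ip M (\<lambda>\<omega>. step_integral X n \<tau> \<xi> t \<omega> - step_integral X n \<tau> \<xi> s \<omega>)
      (\<lambda>\<omega>. step_integral X n' \<tau>' \<eta> t \<omega> - step_integral X n' \<tau>' \<eta> s \<omega>)
    = ip (state_time M T) (\<lambda>p. indicator (strip s t) p *\<^sub>R joint (step_process n \<tau> \<xi>) p)
        (\<lambda>p. indicator (strip s t) p *\<^sub>R joint (step_process n' \<tau>' \<eta>) p)"
proof -
  define c where "c r = max s (min t r)" for r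
  note D = noise_step_dataD[OF d] and D' = noise_step_dataD[OF d']
  have cb: "0 \<le> c p" "c p \<le> c q" "c q \<le> T" if "p \<le> q" for p q
    using clamp_bounds[OF st that] by (auto simp: c_def)
  have s1: "sq_int M (\<lambda>\<omega>. (X (c (\<tau> (Suc i))) \<omega> - X (c (\<tau> i)) \<omega>) *\<^sub>R \<xi> i \<omega>)" if "i \<in> {..<n}" for i
    using that by (intro increment_scaleR_sq_int cb(1)[OF D(2)] cb(2)[OF D(2)] cb(3)[OF D(2)] D(5,6)) auto
  have s2: "sq_int M (\<lambda>\<omega>. (X (c (\<tau>' (Suc i))) \<omega> - X (c (\<tau>' i)) \<omega>) *\<^sub>R \<eta> i \<omega>)" if "i \<in> {..<n'}" for i
    using that by (intro increment_scaleR_sq_int cb(1)[OF D'(2)] cb(2)[OF D'(2)] cb(3)[OF D'(2)] D'(5,6)) auto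
  have pr: "ip M (\<lambda>\<omega>. (X (c (\<tau> (Suc i))) \<omega> - X (c (\<tau> i)) \<omega>) *\<^sub>R \<xi> i \<omega>)
        (\<lambda>\<omega>. (X (c (\<tau>' (Suc j))) \<omega> - X (c (\<tau>' j)) \<omega>) *\<^sub>R \<eta> j \<omega>)
      = max 0 (min (c (\<tau> (Suc i))) (c (\<tau>' (Suc j))) - max (c (\<tau> i)) (c (\<tau>' j)))
        * (\<integral>\<omega>. \<xi> i \<omega> \<bullet> \<eta> j \<omega> \<partial>M)" if i: "i < n" and j: "j < n'" for i j
  proof (rule increment_pair_inner)
    show "\<xi> i \<in> borel_measurable (K (c (\<tau> i)) (c (\<tau> (Suc i))))" if "c (\<tau> i) < c (\<tau> (Suc i))"
      unfolding c_def by (rule truncated_measurable[OF st D(1)[OF i] D(2)[OF i] D(3)[OF i] _ D(4)[OF i]])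
        (use that in \<open>simp add: c_def\<close>)
    show "\<eta> j \<in> borel_measurable (K (c (\<tau>' j)) (c (\<tau>' (Suc j))))" if "c (\<tau>' j) < c (\<tau>' (Suc j))"
      unfolding c_def by (rule truncated_measurable[OF st D'(1)[OF j] D'(2)[OF j] D'(3)[OF j] _ D'(4)[OF j]])
        (use that in \<open>simp add: c_def\<close>)
  qed (fact D(5)[OF i] D(6)[OF i] D'(5)[OF j] D'(6)[OF j] cb[OF D(2)[OF i]] cb[OF D'(2)[OF j]])+
  have lhs: "ip M (\<lambda>\<omega>. step_integral X n \<tau> \<xi> t \<omega> - step_integral X n \<tau> \<xi> s \<omega>)
      (\<lambda>\<omega>. step_integral X n' \<tau>' \<eta> t \<omega> - step_integral X n' \<tau>' \<eta> s \<omega>)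
     = (\<Sum>i<n. \<Sum>j<n'. max 0 (min (c (\<tau> (Suc i))) (c (\<tau>' (Suc j))) - max (c (\<tau> i)) (c (\<tau>' j)))
         * (\<integral>\<omega>. \<xi> i \<omega> \<bullet> \<eta> j \<omega> \<partial>M))"
    unfolding step_integral_diff[OF st(2)] c_def[symmetric]
    by (subst ip_sum_sum, erule s1, erule s2, intro sum.cong refl pr) auto
  let ?I = "\<lambda>i. {c (\<tau> i)<..c (\<tau> (Suc i))}" and ?J = "\<lambda>j. {c (\<tau>' j)<..c (\<tau>' (Suc j))}"
  have expand: "(indicator (strip s t) p *\<^sub>R joint (step_process n \<tau> \<xi>) p)
        \<bullet> (indicator (strip s t) p *\<^sub>R joint (step_process n' \<tau>' \<eta>) p)
      = (\<Sum>i<n. \<Sum>j<n'. (\<xi> i (fst p) \<bullet> \<eta> j (fst p)) * indicator (?I i \<inter> ?J j) (snd p))" for p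
  proof -
    have 1: "indicator (strip s t) p *\<^sub>R joint (step_process n \<tau> \<xi>) p = (\<Sum>i<n. indicator (?I i) (snd p) *\<^sub>R \<xi> i (fst p))"
      unfolding joint_def step_process_def scaleR_sum_right scaleR_scaleR indicator_strip
      using indicator_clamp[OF st(2) D(2)] by (intro sum.cong) (auto simp: c_def)
    have 2: "indicator (strip s t) p *\<^sub>R joint (step_process n' \<tau>' \<eta>) p = (\<Sum>i<n'. indicator (?J i) (snd p) *\<^sub>R \<eta> i (fst p))"
      unfolding joint_def step_process_def scaleR_sum_right scaleR_scaleR indicator_strip
      using indicator_clamp[OF st(2) D'(2)] by (intro sum.cong) (auto simp: c_def)
    show ?thesis
      unfolding 1 2 inner_sum_left unfolding inner_sum_right indicator_inter_arith inner_scaleR_left inner_scaleR_right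
      by (intro sum.cong refl) (simp only: mult_ac)
  qed
  have one: "integrable (state_time M T) (\<lambda>p. (\<xi> i (fst p) \<bullet> \<eta> j (fst p)) * indicator (?I i \<inter> ?J j) (snd p)) \<and>
      (\<integral>p. (\<xi> i (fst p) \<bullet> \<eta> j (fst p)) * indicator (?I i \<inter> ?J j) (snd p) \<partial>state_time M T)
      = max 0 (min (c (\<tau> (Suc i))) (c (\<tau>' (Suc j))) - max (c (\<tau> i)) (c (\<tau>' j))) * (\<integral>\<omega>. \<xi> i \<omega> \<bullet> \<eta> j \<omega> \<partial>M)"
    if i: "i < n" and j: "j < n'" for i j
  proof -
    obtain k k' where k: "\<And>\<omega>. norm (\<xi> i \<omega>) \<le> k" "\<And>\<omega>. norm (\<eta> j \<omega>) \<le> k'"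
      using D(6)[OF i] D'(6)[OF j] by auto
    have b: "\<bar>\<xi> i \<omega> \<bullet> \<eta> j \<omega>\<bar> \<le> k * k'" for \<omega>
      by (rule order_trans[OF Cauchy_Schwarz_ineq2 mult_mono[OF k]])
         (rule order_trans[OF norm_ge_zero k(1)], rule norm_ge_zero)
    have m: "(\<lambda>\<omega>. \<xi> i \<omega> \<bullet> \<eta> j \<omega>) \<in> borel_measurable M"
      by (intro borel_measurable_inner D(5)[OF i] D'(5)[OF j])
    have A: "?I i \<inter> ?J j \<in> sets borel" "?I i \<inter> ?J j \<subseteq> {0..T}"
      using cb[OF D(2)[OF i]] by auto
    show ?thesis
      using integral_product_indicator[OF prob_space_axioms m b A]
        measure_strip_overlap[OF cb(1)[OF D(2)[OF i]] cb(3)[OF D(2)[OF i]] cb(1)[OF D'(2)[OF j]] cb(3)[OF D'(2)[OF j]]]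
      by simp
  qed
  have "ip (state_time M T) (\<lambda>p. indicator (strip s t) p *\<^sub>R joint (step_process n \<tau> \<xi>) p)
        (\<lambda>p. indicator (strip s t) p *\<^sub>R joint (step_process n' \<tau>' \<eta>) p)
     = (\<Sum>i<n. \<Sum>j<n'. max 0 (min (c (\<tau> (Suc i))) (c (\<tau>' (Suc j))) - max (c (\<tau> i)) (c (\<tau>' j)))
         * (\<integral>\<omega>. \<xi> i \<omega> \<bullet> \<eta> j \<omega> \<partial>M))"
    unfolding ip_def expand
    by (subst integral_sum_sum; (intro sum.cong refl)?) (use one in \<open>auto simp only: lessThan_iff\<close>)
  then show ?thesis using lhs by simp
qed

lemma step_mean:
  fixes \<xi> :: "nat \<Rightarrow> 'a \<Rightarrow> 'b::euclidean_space"
  assumes d: "noise_step_data n \<tau> \<xi>" and st: "0 \<le> s" "s \<le> t" "t \<le> T"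
    and \<zeta>: "\<zeta> \<in> borel_measurable (K s t)" "sq_int M \<zeta>"
  shows "ip M \<zeta> (\<lambda>\<omega>. step_integral X n \<tau> \<xi> t \<omega> - step_integral X n \<tau> \<xi> s \<omega>) = 0"
proof -
  define c where "c r = max s (min t r)" for r
  note D = noise_step_dataD[OF d]
  have cb: "0 \<le> c p" "c p \<le> c q" "c q \<le> T" "s \<le> c p" "c q \<le> t" if "p \<le> q" for p q
    using clamp_bounds[OF st that] st by (auto simp: c_def)
  have "\<zeta> \<omega> \<bullet> (step_integral X n \<tau> \<xi> t \<omega> - step_integral X n \<tau> \<xi> s \<omega>)
      = (\<Sum>i<n. (\<zeta> \<omega> \<bullet> \<xi> i \<omega>) * (X (c (\<tau> (Suc i))) \<omega> - X (c (\<tau> i)) \<omega>))" for \<omega>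
    unfolding step_integral_diff[OF st(2)] c_def
    by (simp add: inner_sum_right mult.commute)
  moreover have "integrable M (\<lambda>\<omega>. (\<zeta> \<omega> \<bullet> \<xi> i \<omega>) * (X (c (\<tau> (Suc i))) \<omega> - X (c (\<tau> i)) \<omega>)) \<and>
      (\<integral>\<omega>. (\<zeta> \<omega> \<bullet> \<xi> i \<omega>) * (X (c (\<tau> (Suc i))) \<omega> - X (c (\<tau> i)) \<omega>) \<partial>M) = 0" if i: "i < n" for i
  proof (cases "c (\<tau> i) = c (\<tau> (Suc i))")
    case False
    then have lt: "c (\<tau> i) < c (\<tau> (Suc i))" using cb[OF D(2)[OF i]] by simp
    obtain k where k: "\<And>\<omega>. norm (\<xi> i \<omega>) \<le> k" using D(6)[OF i] by auto
    have \<xi>K: "\<xi> i \<in> borel_measurable (K (c (\<tau> i)) (c (\<tau> (Suc i))))"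
      unfolding c_def by (rule truncated_measurable[OF st D(1)[OF i] D(2)[OF i] D(3)[OF i] _ D(4)[OF i]])
        (use lt in \<open>simp add: c_def\<close>)
    have \<zeta>K: "\<zeta> \<in> borel_measurable (K (c (\<tau> i)) (c (\<tau> (Suc i))))"
      by (rule K_meas_mono[OF \<zeta>(1)]) (use st cb[OF D(2)[OF i]] in auto)
    have "sq_int M (\<xi> i)"
      unfolding sq_int_def
    proof
      have "(norm (\<xi> i \<omega>))\<^sup>2 \<le> k\<^sup>2" for \<omega> using k by (intro power_mono) auto
      then show "integrable M (\<lambda>\<omega>. (norm (\<xi> i \<omega>))\<^sup>2)"
        using D(5)[OF i] by (intro integrable_const_bound[of _ "k\<^sup>2"]) auto
    qed (rule D(5)[OF i])
    then have "integrable M (\<lambda>\<omega>. \<zeta> \<omega> \<bullet> \<xi> i \<omega>)" by (rule sq_int_integrable_inner[OF \<zeta>(2)])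
    moreover have "(\<lambda>\<omega>. \<zeta> \<omega> \<bullet> \<xi> i \<omega>) \<in> borel_measurable (K (c (\<tau> i)) (c (\<tau> (Suc i))))"
      by (intro borel_measurable_inner \<zeta>K \<xi>K)
    ultimately show ?thesis using increment_mean[OF cb(1-3)[OF D(2)[OF i]]] by blast
  qed simp
  ultimately show ?thesis
    unfolding ip_def by (simp add: Bochner_Integration.integral_sum)
qed

text \<open>The \<open>L\<^sup>2\<close>-closure of the elementary integrals, expressed on the product space.\<close>
definition ito_integral :: "(real \<Rightarrow> 'a \<Rightarrow> 'b::euclidean_space) \<Rightarrow> (real \<Rightarrow> 'a \<Rightarrow> 'b) \<Rightarrow> bool" where
  "ito_integral \<phi> J \<longleftrightarrow> (\<exists>n \<tau> \<xi>. (\<forall>m. noise_step_data (n m) (\<tau> m) (\<xi> m)) \<and>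
     sq_conv (state_time M T) (\<lambda>m. joint (step_process (n m) (\<tau> m) (\<xi> m))) (joint \<phi>) \<and>
     (\<forall>t\<in>{0..T}. sq_conv M (\<lambda>m. step_integral X (n m) (\<tau> m) (\<xi> m) t) (J t)))"

lemma ito_integral_sq_int:
  assumes "ito_integral \<phi> J"
  shows "sq_int (state_time M T) (joint \<phi>)" "0 \<le> t \<Longrightarrow> t \<le> T \<Longrightarrow> sq_int M (J t)"
  using assms unfolding ito_integral_def sq_conv_def by auto

lemma ito_isometry:
  assumes J: "ito_integral \<phi> J" and L: "ito_integral \<psi> L" and st: "0 \<le> s" "s \<le> t" "t \<le> T"
  shows "ip M (\<lambda>\<omega>. J t \<omega> - J s \<omega>) (\<lambda>\<omega>. L t \<omega> - L s \<omega>)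
    = ip (state_time M T) (\<lambda>p. indicator (strip s t) p *\<^sub>R joint \<phi> p) (\<lambda>p. indicator (strip s t) p *\<^sub>R joint \<psi> p)"
proof -
  obtain n \<tau> \<xi> where 1: "\<And>m. noise_step_data (n m) (\<tau> m) (\<xi> m)"
    "sq_conv (state_time M T) (\<lambda>m. joint (step_process (n m) (\<tau> m) (\<xi> m))) (joint \<phi>)"
    "\<And>t. t \<in> {0..T} \<Longrightarrow> sq_conv M (\<lambda>m. step_integral X (n m) (\<tau> m) (\<xi> m) t) (J t)"
    using J unfolding ito_integral_def by blast
  obtain n' \<tau>' \<eta> where 2: "\<And>m. noise_step_data (n' m) (\<tau>' m) (\<eta> m)"
    "sq_conv (state_time M T) (\<lambda>m. joint (step_process (n' m) (\<tau>' m) (\<eta> m))) (joint \<psi>)"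
    "\<And>t. t \<in> {0..T} \<Longrightarrow> sq_conv M (\<lambda>m. step_integral X (n' m) (\<tau>' m) (\<eta> m) t) (L t)"
    using L unfolding ito_integral_def by blast
  have stT: "s \<in> {0..T}" "t \<in> {0..T}" using st by auto
  have "(\<lambda>m. ip M (\<lambda>\<omega>. step_integral X (n m) (\<tau> m) (\<xi> m) t \<omega> - step_integral X (n m) (\<tau> m) (\<xi> m) s \<omega>)
      (\<lambda>\<omega>. step_integral X (n' m) (\<tau>' m) (\<eta> m) t \<omega> - step_integral X (n' m) (\<tau>' m) (\<eta> m) s \<omega>))
      \<longlonglongrightarrow> ip M (\<lambda>\<omega>. J t \<omega> - J s \<omega>) (\<lambda>\<omega>. L t \<omega> - L s \<omega>)"
    by (intro ip_tendsto sq_conv_diff 1 2 stT)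
  moreover have "(\<lambda>m. ip (state_time M T)
        (\<lambda>p. indicator (strip s t) p *\<^sub>R joint (step_process (n m) (\<tau> m) (\<xi> m)) p)
        (\<lambda>p. indicator (strip s t) p *\<^sub>R joint (step_process (n' m) (\<tau>' m) (\<eta> m)) p))
      \<longlonglongrightarrow> ip (state_time M T) (\<lambda>p. indicator (strip s t) p *\<^sub>R joint \<phi> p) (\<lambda>p. indicator (strip s t) p *\<^sub>R joint \<psi> p)"
    by (intro ip_tendsto sq_conv_indicator 1(2) 2(2) strip_measurable)
  ultimately show ?thesis
    unfolding step_isometry[OF 1(1) 2(1) st] by (rule LIMSEQ_unique)
qed

lemma ito_mean:
  assumes J: "ito_integral \<phi> J" and st: "0 \<le> s" "s \<le> t" "t \<le> T"
    and \<zeta>: "\<zeta> \<in> borel_measurable (K s t)" "sq_int M \<zeta>"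
  shows "ip M \<zeta> (\<lambda>\<omega>. J t \<omega> - J s \<omega>) = 0"
proof -
  obtain n \<tau> \<xi> where 1: "\<And>m. noise_step_data (n m) (\<tau> m) (\<xi> m)"
    "\<And>t. t \<in> {0..T} \<Longrightarrow> sq_conv M (\<lambda>m. step_integral X (n m) (\<tau> m) (\<xi> m) t) (J t)"
    using J unfolding ito_integral_def by blast
  have stT: "s \<in> {0..T}" "t \<in> {0..T}" using st by auto
  have "(\<lambda>m. ip M \<zeta> (\<lambda>\<omega>. step_integral X (n m) (\<tau> m) (\<xi> m) t \<omega> - step_integral X (n m) (\<tau> m) (\<xi> m) s \<omega>))
      \<longlonglongrightarrow> ip M \<zeta> (\<lambda>\<omega>. J t \<omega> - J s \<omega>)"
    by (intro ip_tendsto[OF sq_conv_const[OF \<zeta>(2)]] sq_conv_diff 1 stT)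
  then show ?thesis
    unfolding step_mean[OF 1(1) st \<zeta>] by (simp add: LIMSEQ_const_iff)
qed

lemma nn_integral_state_time:
  fixes f :: "'a \<times> real \<Rightarrow> ennreal"
  assumes "f \<in> borel_measurable (state_time M T)"
  shows "(\<integral>\<^sup>+p. f p \<partial>state_time M T) = (\<integral>\<^sup>+\<omega>. (\<integral>\<^sup>+s\<in>{0..T}. f (\<omega>, s) \<partial>lborel) \<partial>M)"
proof -
  interpret L: finite_measure "restrict_space lborel {0..T}" by (rule finite_measure_time)
  have "(\<integral>\<^sup>+p. f p \<partial>state_time M T) = (\<integral>\<^sup>+\<omega>. (\<integral>\<^sup>+s. f (\<omega>, s) \<partial>restrict_space lborel {0..T}) \<partial>M)"
    unfolding state_time_def
    by (rule L.nn_integral_fst[symmetric]) (use assms in \<open>simp add: state_time_def\<close>)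
  also have "\<dots> = (\<integral>\<^sup>+\<omega>. (\<integral>\<^sup>+s\<in>{0..T}. f (\<omega>, s) \<partial>lborel) \<partial>M)"
    by (subst nn_integral_restrict_space) auto
  finally show ?thesis .
qed

lemma L2_integral_limit_ito_integral:
  fixes \<phi> J :: "real \<Rightarrow> 'a \<Rightarrow> 'b::euclidean_space"
  assumes lim: "L2_integral_limit M T S X \<phi> J"
    and S: "\<And>n \<tau> \<xi>. S n \<tau> \<xi> \<Longrightarrow> noise_step_data n \<tau> \<xi>"
    and \<phi>: "joint \<phi> \<in> borel_measurable (state_time M T)"
  shows "ito_integral \<phi> J"
proof -
  obtain n \<tau> \<xi> where *: "\<And>m. S (n m) (\<tau> m) (\<xi> m)"
    "(\<lambda>m. \<integral>\<^sup>+\<omega>. (\<integral>\<^sup>+s\<in>{0..T}.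
            ennreal ((norm (step_process (n m) (\<tau> m) (\<xi> m) s \<omega> - \<phi> s \<omega>))\<^sup>2) \<partial>lborel) \<partial>M) \<longlonglongrightarrow> 0"
    "\<And>t. t\<in>{0..T} \<Longrightarrow> (\<lambda>m. \<integral>\<^sup>+\<omega>. ennreal ((norm (step_integral X (n m) (\<tau> m) (\<xi> m) t \<omega> - J t \<omega>))\<^sup>2) \<partial>M) \<longlonglongrightarrow> 0"
    and Jm: "\<And>t. t\<in>{0..T} \<Longrightarrow> J t \<in> borel_measurable M"
    using lim unfolding L2_integral_limit_def by blast
  have D: "noise_step_data (n m) (\<tau> m) (\<xi> m)" for m by (rule S[OF *(1)])
  have "sq_conv (state_time M T) (\<lambda>m. joint (step_process (n m) (\<tau> m) (\<xi> m))) (joint \<phi>)"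
  proof (rule sq_convI_nn[OF step_process_sq_int[OF D] \<phi>])
    note [measurable] = sq_int_measurable[OF step_process_sq_int[OF D]] \<phi>
    show "(\<lambda>m. \<integral>\<^sup>+p. ennreal ((norm (joint (step_process (n m) (\<tau> m) (\<xi> m)) p - joint \<phi> p))\<^sup>2) \<partial>state_time M T) \<longlonglongrightarrow> 0"
      using *(2) by (subst nn_integral_state_time, measurable) (simp add: joint_def)
  qed
  moreover have "sq_conv M (\<lambda>m. step_integral X (n m) (\<tau> m) (\<xi> m) t) (J t)" if "t \<in> {0..T}" for t
    by (rule sq_convI_nn[OF step_integral_sq_int[OF D] Jm *(3)]) (use that in auto)
  ultimately show ?thesis using D unfolding ito_integral_def by blast
qed

end

section \<open>Drift integrals on the product of state space and time\<close>

abbreviation time :: "real \<Rightarrow> real measure" where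
  "time T \<equiv> restrict_space lborel {0..T}"

text \<open>The restriction to times in \<open>(s, t]\<close>; half-open strips make inner products additive in the interval.\<close>
definition on_strip :: "real \<Rightarrow> real \<Rightarrow> ('a \<times> real \<Rightarrow> 'b::real_vector) \<Rightarrow> 'a \<times> real \<Rightarrow> 'b" where
  "on_strip s t \<phi> p = indicator (strip s t) p *\<^sub>R \<phi> p"

lemma sq_int_on_strip: "sq_int (state_time M T) \<phi> \<Longrightarrow> sq_int (state_time M T) (on_strip s t \<phi>)"
  unfolding on_strip_def using sq_int_indicator[OF _ strip_measurable] .

lemma on_strip_diff: "on_strip s t (\<lambda>p. \<phi> p - \<psi> p) = (\<lambda>p. on_strip s t \<phi> p - on_strip s t \<psi> p)"
  by (simp add: on_strip_def scaleR_diff_right fun_eq_iff)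

lemma on_strip_inner: "on_strip s t \<phi> p \<bullet> on_strip s t \<psi> p = indicator (strip s t) p * (\<phi> p \<bullet> \<psi> p)"
  by (simp add: on_strip_def indicator_def)

lemma ip_on_strip_split:
  assumes "s \<le> t" "t \<le> u" "sq_int (state_time M T) \<phi>" "sq_int (state_time M T) \<psi>"
  shows "ip (state_time M T) (on_strip s u \<phi>) (on_strip s u \<psi>)
    = ip (state_time M T) (on_strip s t \<phi>) (on_strip s t \<psi>) + ip (state_time M T) (on_strip t u \<phi>) (on_strip t u \<psi>)"
proof -
  have "on_strip s u \<phi> p \<bullet> on_strip s u \<psi> p = on_strip s t \<phi> p \<bullet> on_strip s t \<psi> p + on_strip t u \<phi> p \<bullet> on_strip t u \<psi> p" for p
    using assms(1,2) by (cases p) (auto simp: on_strip_inner strip_def indicator_def)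
  then show ?thesis
    unfolding ip_def by (simp add: sq_int_integrable_inner sq_int_on_strip assms)
qed

lemma ip_on_strip_empty: "ip N (on_strip s s \<phi>) (on_strip s s \<psi>) = 0"
  by (simp add: ip_def on_strip_inner strip_def)

text \<open>The strip \<open>(0, T]\<close> omits only the null set of time \<open>0\<close>.\<close>
lemma ip_on_strip_whole:
  "ip (state_time M T) (on_strip 0 T \<phi>) (on_strip 0 T \<psi>) = ip (state_time M T) \<phi> \<psi>" if "0 < T"
    and "sq_int (state_time M T) \<phi>" "sq_int (state_time M T) \<psi>" "prob_space M"
proof -
  interpret prob_space M by fact
  interpret L: finite_measure "time T" by (rule finite_measure_time)
  have [measurable]: "\<phi> \<in> borel_measurable (state_time M T)" "\<psi> \<in> borel_measurable (state_time M T)"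
    using that by (auto intro: sq_int_measurable)
  have "AE p in state_time M T. p \<in> strip 0 T"
  proof (rule AE_I)
    show "{p \<in> space (state_time M T). p \<notin> strip 0 T} \<subseteq> space M \<times> {0}"
      by (auto simp: space_state_time strip_def)
    have "{0} \<in> sets (time T)" using that by (subst sets_restrict_space_iff) auto
    moreover have "emeasure (time T) {0} = 0"
      using that by (subst emeasure_restrict_space) auto
    ultimately show "emeasure (state_time M T) (space M \<times> {0}) = 0" "space M \<times> {0} \<in> sets (state_time M T)"
      unfolding state_time_def by (auto simp: L.emeasure_pair_measure_Times)
  qed
  then have eq: "AE p in state_time M T. on_strip 0 T \<phi> p \<bullet> on_strip 0 T \<psi> p = \<phi> p \<bullet> \<psi> p"
    by eventually_elim (simp add: on_strip_inner)
  have "integrable (state_time M T) (\<lambda>p. on_strip 0 T \<phi> p \<bullet> on_strip 0 T \<psi> p)"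
    using that by (intro sq_int_integrable_inner sq_int_on_strip)
  then show ?thesis
    unfolding ip_def using eq by (intro integral_cong_AE) auto
qed

lemma pair_sigma_finite_time: "prob_space M \<Longrightarrow> pair_sigma_finite M (time T)"
proof -
  assume "prob_space M"
  then interpret prob_space M .
  interpret L: finite_measure "time T" by (rule finite_measure_time)
  show ?thesis ..
qed

lemma sq_int_const_in_time:
  assumes "prob_space M" and \<zeta>: "sq_int M \<zeta>"
  shows "sq_int (state_time M T) (\<lambda>p. \<zeta> (fst p))"
proof -
  interpret L: finite_measure "time T" by (rule finite_measure_time)
  have m: "(\<lambda>p. \<zeta> (fst p)) \<in> borel_measurable (state_time M T)"
    by (rule state_component_measurable[OF sq_int_measurable[OF \<zeta>]])
  have [measurable]: "\<zeta> \<in> borel_measurable M" by (rule sq_int_measurable[OF \<zeta>])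
  have "(\<integral>\<^sup>+p. ennreal ((norm (\<zeta> (fst p)))\<^sup>2) \<partial>state_time M T)
      = (\<integral>\<^sup>+\<omega>. (\<integral>\<^sup>+r. ennreal ((norm (\<zeta> \<omega>))\<^sup>2) \<partial>time T) \<partial>M)"
    unfolding state_time_def
    by (subst L.nn_integral_fst[symmetric]) (use m in \<open>auto simp: state_time_def\<close>)
  also have "\<dots> = (\<integral>\<^sup>+\<omega>. ennreal ((norm (\<zeta> \<omega>))\<^sup>2) \<partial>M) * emeasure (time T) (space (time T))"
    by (simp add: nn_integral_multc)
  also have "\<dots> < \<infinity>"
    using \<zeta> L.emeasure_finite[of "{0..T}"] unfolding sq_int_iff_nn[OF sq_int_measurable[OF \<zeta>]]
    by (simp add: ennreal_mult_eq_top_iff space_restrict_space less_top[symmetric])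
  finally show ?thesis by (simp add: sq_int_iff_nn[OF m])
qed

lemma joint_section_measurable:
  assumes "joint f \<in> borel_measurable (state_time M T)" "\<omega> \<in> space M"
  shows "(\<lambda>r. f r \<omega>) \<in> borel_measurable (time T)"
  using measurable_Pair2[OF assms(1)[unfolded state_time_def] assms(2)] by (simp add: joint_def)

lemma sq_int_sections:
  assumes "prob_space M" and f: "sq_int (state_time M T) (joint f)"
  shows "AE \<omega> in M. sq_int (time T) (\<lambda>r. f r \<omega>)"
proof -
  interpret P: pair_sigma_finite M "time T" by (rule pair_sigma_finite_time) fact
  have "AE \<omega> in M. integrable (time T) (\<lambda>r. (norm (joint f (\<omega>, r)))\<^sup>2)"
    by (rule P.AE_integrable_fst') (use sq_int_norm[OF f] in \<open>simp add: state_time_def\<close>)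
  then show ?thesis
    using AE_space
    by eventually_elim (use joint_section_measurable[OF sq_int_measurable[OF f]] in \<open>simp add: sq_int_def joint_def\<close>)
qed

lemma sq_int_integrable:
  assumes "finite_measure N" and f: "sq_int N f"
  shows "integrable N f"
proof (rule Bochner_Integration.integrable_bound)
  interpret finite_measure N by fact
  show "integrable N (\<lambda>x. 1 + (norm (f x))\<^sup>2)" using sq_int_norm[OF f] by simp
  show "f \<in> borel_measurable N" by (rule sq_int_measurable[OF f])
  have "norm (f x) \<le> 1 + (norm (f x))\<^sup>2" for x
  proof -
    have "2 * norm (f x) \<le> 1 + (norm (f x))\<^sup>2" using sum_squares_bound[of 1 "norm (f x)"] by simp
    then show ?thesis using norm_ge_zero[of "f x"] by linarith
  qed
  then show "AE x in N. norm (f x) \<le> norm (1 + (norm (f x))\<^sup>2)"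
    by (intro AE_I2) (simp add: abs_of_nonneg)
qed

text \<open>The increment over \<open>(s, t]\<close> of the Lebesgue part, written on the second factor of \<open>state_time\<close>.\<close>
definition drift :: "real \<Rightarrow> (real \<Rightarrow> 'a \<Rightarrow> 'b::euclidean_space) \<Rightarrow> real \<Rightarrow> real \<Rightarrow> 'a \<Rightarrow> 'b" where
  "drift T f s t \<omega> = (\<integral>r. indicator {s<..t} r *\<^sub>R f r \<omega> \<partial>time T)"

lemma indicator_time_sets: "A \<in> sets borel \<Longrightarrow> A \<inter> space (time T) \<in> sets (time T)"
  by (subst sets_restrict_space_iff) (auto simp: space_restrict_space)

lemma drift_eq_LINT_diff:
  fixes f :: "real \<Rightarrow> 'a \<Rightarrow> 'b::euclidean_space"
  assumes f: "sq_int (time T) (\<lambda>r. f r \<omega>)" and st: "0 \<le> s" "s \<le> t" "t \<le> T"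
  shows "(LINT r:{0..t}|lborel. f r \<omega>) - (LINT r:{0..s}|lborel. f r \<omega>) = drift T f s t \<omega>"
proof -
  have eq: "(LINT r:{0..u}|lborel. f r \<omega>) = (\<integral>r. indicator {0..u} r *\<^sub>R f r \<omega> \<partial>time T)" if "u \<le> T" for u
  proof -
    have "(\<integral>r. indicator {0..u} r *\<^sub>R f r \<omega> \<partial>time T)
        = (\<integral>r. indicator {0..T} r *\<^sub>R (indicator {0..u} r *\<^sub>R f r \<omega>) \<partial>lborel)"
      by (rule integral_restrict_space) simp
    also have "\<dots> = (LINT r:{0..u}|lborel. f r \<omega>)"
      unfolding set_lebesgue_integral_def using that
      by (intro Bochner_Integration.integral_cong) (auto simp: indicator_def)
    finally show ?thesis ..
  qed
  have i: "integrable (time T) (\<lambda>r. indicator A r *\<^sub>R f r \<omega>)" if "A \<in> sets borel" for A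
    by (rule sq_int_integrable[OF finite_measure_time sq_int_indicator[OF f indicator_time_sets[OF that]]])
  have "(LINT r:{0..t}|lborel. f r \<omega>) - (LINT r:{0..s}|lborel. f r \<omega>)
     = (\<integral>r. indicator {0..t} r *\<^sub>R f r \<omega> - indicator {0..s} r *\<^sub>R f r \<omega> \<partial>time T)"
    using st by (simp add: eq i)
  also have "\<dots> = drift T f s t \<omega>"
    unfolding drift_def using st
    by (intro Bochner_Integration.integral_cong) (auto simp: indicator_def space_restrict_space)
  finally show ?thesis .
qed

lemma drift_measurable:
  assumes f: "joint f \<in> borel_measurable (state_time M T)"
  shows "drift T f s t \<in> borel_measurable M"
proof -
  interpret L: finite_measure "time T" by (rule finite_measure_time)
  have "(\<lambda>p. indicator {s<..t} (snd p) *\<^sub>R joint f p) \<in> borel_measurable (state_time M T)"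
    by (intro borel_measurable_scaleR time_component_measurable f) auto
  then have "(\<lambda>\<omega>. \<integral>r. indicator {s<..t} r *\<^sub>R f r \<omega> \<partial>time T) \<in> borel_measurable M"
    unfolding state_time_def
    by (intro L.borel_measurable_lebesgue_integral) (simp add: joint_def split_beta')
  then show ?thesis by (simp add: drift_def[abs_def])
qed

text \<open>The Cauchy-Schwarz inequality against the constant \<open>1\<close> gains the factor \<open>t - s\<close>.\<close>
lemma drift_section_bound:
  fixes f :: "real \<Rightarrow> 'a \<Rightarrow> 'b::euclidean_space"
  assumes f: "sq_int (time T) (\<lambda>r. f r \<omega>)" and st: "0 \<le> s" "s \<le> t" "t \<le> T"
  shows "(norm (drift T f s t \<omega>))\<^sup>2 \<le> (t - s) * (\<integral>r. indicator {s<..t} r * (norm (f r \<omega>))\<^sup>2 \<partial>time T)"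
proof -
  interpret L: finite_measure "time T" by (rule finite_measure_time)
  let ?u = "\<lambda>r. indicator {s<..t} r *\<^sub>R (1::real)" and ?v = "\<lambda>r. indicator {s<..t} r *\<^sub>R norm (f r \<omega>)"
  have A: "{s<..t} \<inter> space (time T) \<in> sets (time T)" by (rule indicator_time_sets) simp
  have "sq_int (time T) (\<lambda>r. 1::real)" by (simp add: sq_int_def)
  then have u: "sq_int (time T) ?u" by (rule sq_int_indicator[OF _ A])
  have "sq_int (time T) (\<lambda>r. norm (f r \<omega>))"
  proof -
    note [measurable] = sq_int_measurable[OF f]
    have "(\<lambda>r. norm (f r \<omega>)) \<in> borel_measurable (time T)" by measurable
    then show ?thesis using f by (simp add: sq_int_def)
  qed
  then have v: "sq_int (time T) ?v" by (rule sq_int_indicator[OF _ A])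
  have "norm (drift T f s t \<omega>) \<le> (\<integral>r. norm (indicator {s<..t} r *\<^sub>R f r \<omega>) \<partial>time T)"
    unfolding drift_def by (rule integral_norm_bound)
  also have "\<dots> = ip (time T) ?u ?v"
    unfolding ip_def by (intro Bochner_Integration.integral_cong) (auto simp: indicator_def)
  also have "\<dots> \<le> sqrt (ip (time T) ?u ?u) * sqrt (ip (time T) ?v ?v)"
    using ip_Cauchy_Schwarz[OF u v] by simp
  finally have "(norm (drift T f s t \<omega>))\<^sup>2 \<le> (sqrt (ip (time T) ?u ?u) * sqrt (ip (time T) ?v ?v))\<^sup>2"
    by (rule power_mono) simp
  also have "\<dots> = ip (time T) ?u ?u * ip (time T) ?v ?v"
    by (simp add: power_mult_distrib ip_nonneg)
  also have "ip (time T) ?u ?u = t - s"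
  proof -
    have "ip (time T) ?u ?u = (\<integral>r. indicator {s<..t} r \<partial>time T)"
      unfolding ip_def by (intro Bochner_Integration.integral_cong) (auto simp: indicator_def)
    also have "\<dots> = measure (time T) ({s<..t} \<inter> {s<..t})"
      using st by (simp add: space_restrict_space) (rule arg_cong[where f="measure (time T)"], auto)
    also have "\<dots> = t - s" using st by (subst measure_strip_overlap) auto
    finally show ?thesis .
  qed
  also have "ip (time T) ?v ?v = (\<integral>r. indicator {s<..t} r * (norm (f r \<omega>))\<^sup>2 \<partial>time T)"
    unfolding ip_def by (intro Bochner_Integration.integral_cong) (auto simp: indicator_def power2_eq_square)
  finally show ?thesis .
qed

lemma
  fixes f :: "real \<Rightarrow> 'a \<Rightarrow> 'b::euclidean_space"
  assumes "prob_space M" and f: "sq_int (state_time M T) (joint f)" and st: "0 \<le> s" "s \<le> t" "t \<le> T"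
  shows drift_sq_int: "sq_int M (drift T f s t)"
    and drift_energy: "ip M (drift T f s t) (drift T f s t)
      \<le> (t - s) * ip (state_time M T) (on_strip s t (joint f)) (on_strip s t (joint f))"
proof -
  interpret prob_space M by fact
  interpret P: pair_sigma_finite M "time T" by (rule pair_sigma_finite_time) fact
  let ?e = "\<lambda>p. indicator {s<..t} (snd p) * (norm (joint f p))\<^sup>2"
  have eq: "?e p = on_strip s t (joint f) p \<bullet> on_strip s t (joint f) p" for p
    by (simp add: on_strip_inner indicator_strip power2_norm_eq_inner)
  have i: "integrable (M \<Otimes>\<^sub>M time T) ?e"
    unfolding eq state_time_def[symmetric] by (intro sq_int_integrable_inner sq_int_on_strip f)
  have i2: "integrable M (\<lambda>\<omega>. (t - s) * (\<integral>r. ?e (\<omega>, r) \<partial>time T))"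
    by (intro integrable_mult_right P.integrable_fst' i)
  have bound: "AE \<omega> in M. (norm (drift T f s t \<omega>))\<^sup>2 \<le> (t - s) * (\<integral>r. ?e (\<omega>, r) \<partial>time T)"
    using sq_int_sections[OF prob_space_axioms f]
    by eventually_elim (use drift_section_bound[where f=f, OF _ st] in \<open>simp add: joint_def\<close>)
  have m: "drift T f s t \<in> borel_measurable M" by (rule drift_measurable[OF sq_int_measurable[OF f]])
  have i3: "integrable M (\<lambda>\<omega>. (norm (drift T f s t \<omega>))\<^sup>2)"
  proof (rule Bochner_Integration.integrable_bound[OF i2])
    show "(\<lambda>\<omega>. (norm (drift T f s t \<omega>))\<^sup>2) \<in> borel_measurable M" using m by measurable
    show "AE \<omega> in M. norm ((norm (drift T f s t \<omega>))\<^sup>2) \<le> norm ((t - s) * (\<integral>r. ?e (\<omega>, r) \<partial>time T))"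
      using bound
    proof eventually_elim
      case (elim \<omega>)
      then show ?case
        using abs_ge_self[of "(t - s) * (\<integral>r. ?e (\<omega>, r) \<partial>time T)"]
        unfolding real_norm_def abs_power2 by (rule order_trans)
    qed
  qed
  then show "sq_int M (drift T f s t)" using m by (simp add: sq_int_def)
  have "ip M (drift T f s t) (drift T f s t) \<le> (\<integral>\<omega>. (t - s) * (\<integral>r. ?e (\<omega>, r) \<partial>time T) \<partial>M)"
    unfolding ip_self by (rule integral_mono_AE[OF i3 i2 bound])
  also have "\<dots> = (t - s) * (\<integral>p. ?e p \<partial>state_time M T)"
    using P.integral_fst'[OF i] by (simp add: state_time_def)
  also have "(\<integral>p. ?e p \<partial>state_time M T) = ip (state_time M T) (on_strip s t (joint f)) (on_strip s t (joint f))"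
    unfolding ip_def eq ..
  finally show "ip M (drift T f s t) (drift T f s t)
      \<le> (t - s) * ip (state_time M T) (on_strip s t (joint f)) (on_strip s t (joint f))" .
qed

text \<open>By Fubini, pairing a drift increment with \<open>\<zeta>\<close> is pairing its density with the process that is constantly \<open>\<zeta>\<close>.\<close>
lemma ip_drift:
  fixes f :: "real \<Rightarrow> 'a \<Rightarrow> 'b::euclidean_space"
  assumes "prob_space M" and f: "sq_int (state_time M T) (joint f)"
    and \<zeta>: "sq_int M \<zeta>"
  shows "ip M \<zeta> (drift T f s t)
    = ip (state_time M T) (on_strip s t (\<lambda>p. \<zeta> (fst p))) (on_strip s t (joint f))"
proof -
  interpret prob_space M by fact
  interpret P: pair_sigma_finite M "time T" by (rule pair_sigma_finite_time) fact
  note \<zeta>' = sq_int_const_in_time[OF prob_space_axioms \<zeta>, of T]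
  let ?e = "\<lambda>p. on_strip s t (\<lambda>p. \<zeta> (fst p)) p \<bullet> on_strip s t (joint f) p"
  have i: "integrable (M \<Otimes>\<^sub>M time T) ?e"
    unfolding state_time_def[symmetric] by (intro sq_int_integrable_inner sq_int_on_strip f \<zeta>')
  have "ip (state_time M T) (on_strip s t (\<lambda>p. \<zeta> (fst p))) (on_strip s t (joint f)) = (\<integral>\<omega>. (\<integral>r. ?e (\<omega>, r) \<partial>time T) \<partial>M)"
    unfolding ip_def using P.integral_fst'[OF i] by (simp add: state_time_def)
  also have "\<dots> = ip M \<zeta> (drift T f s t)"
    unfolding ip_def
  proof (rule integral_cong_AE)
    show "(\<lambda>\<omega>. \<integral>r. ?e (\<omega>, r) \<partial>time T) \<in> borel_measurable M"
      using P.integrable_fst'[OF i] by simp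
    show "(\<lambda>\<omega>. \<zeta> \<omega> \<bullet> drift T f s t \<omega>) \<in> borel_measurable M"
      using sq_int_measurable[OF \<zeta>] drift_measurable[OF sq_int_measurable[OF f]]
      by (rule borel_measurable_inner)
    show "AE \<omega> in M. (\<integral>r. ?e (\<omega>, r) \<partial>time T) = \<zeta> \<omega> \<bullet> drift T f s t \<omega>"
      using sq_int_sections[OF prob_space_axioms f]
    proof eventually_elim
      case (elim \<omega>)
      have "{s<..t} \<inter> space (time T) \<in> sets (time T)" by (rule indicator_time_sets) simp
      then have "integrable (time T) (\<lambda>r. indicator {s<..t} r *\<^sub>R f r \<omega>)"
        by (rule sq_int_integrable[OF finite_measure_time sq_int_indicator[OF elim]])
      then have "\<zeta> \<omega> \<bullet> drift T f s t \<omega> = (\<integral>r. \<zeta> \<omega> \<bullet> (indicator {s<..t} r *\<^sub>R f r \<omega>) \<partial>time T)"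
        unfolding drift_def by (subst integral_inner_right) auto
      also have "\<dots> = (\<integral>r. ?e (\<omega>, r) \<partial>time T)"
        by (simp add: on_strip_inner indicator_strip joint_def)
      finally show ?case ..
    qed
  qed
  finally show ?thesis ..
qed

section \<open>Processes with a doubly stochastic differential\<close>

lemma AE_witness:
  assumes "AE x in N. P x" "emeasure N (space N) \<noteq> 0"
  obtains x where "x \<in> space N" "P x"
proof -
  have "\<exists>x\<in>space N. P x"
  proof (rule ccontr)
    assume "\<not> (\<exists>x\<in>space N. P x)"
    moreover have "AE x in N. x \<in> space N \<and> P x" using AE_space assms(1) by (rule AE_conjI)
    ultimately have "AE x in N. False" by (auto elim: eventually_mono)
    then show False using assms(2) by (simp add: eventually_False ae_filter_eq_bot_iff)
  qed
  then show ?thesis using that by blast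
qed

locale ds_basis =
  fixes M :: "'a measure" and T :: real and W B :: "real \<Rightarrow> 'a \<Rightarrow> real"
  assumes basis: "doubly_stochastic_basis M T W B"

sublocale ds_basis \<subseteq> WN: orthogonal_noise M T W "\<lambda>a b. info M W B T a 0"
  by (rule orthogonal_noise_W[OF basis])

sublocale ds_basis \<subseteq> BN: orthogonal_noise M T B "\<lambda>a b. info M W B T T b"
  by (rule orthogonal_noise_B[OF basis])

context ds_basis
begin

abbreviation "ST \<equiv> state_time M T"

abbreviation energy :: "real \<Rightarrow> real \<Rightarrow> (real \<Rightarrow> 'a \<Rightarrow> 'b::euclidean_space) \<Rightarrow> real" where
  "energy s t f \<equiv> ip ST (on_strip s t (joint f)) (on_strip s t (joint f))"

definition ds_process ::
  "(real \<Rightarrow> 'a \<Rightarrow> 'b::euclidean_space) \<Rightarrow> (real \<Rightarrow> 'a \<Rightarrow> 'b) \<Rightarrow> (real \<Rightarrow> 'a \<Rightarrow> 'b) \<Rightarrow> (real \<Rightarrow> 'a \<Rightarrow> 'b) \<Rightarrow> bool" where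
  "ds_process Z f g h \<longleftrightarrow> (\<forall>t\<in>{0..T}. Z t \<in> borel_measurable (info M W B T t t)) \<and>
     sq_int ST (joint Z) \<and> sq_int ST (joint f) \<and> sq_int ST (joint g) \<and> sq_int ST (joint h) \<and>
     has_ds_differential M T W B Z f g h"

lemma T_pos: "0 < T"
  using basis by (simp add: doubly_stochastic_basis_def)

lemma info_measurable:
  assumes "0 \<le> t" "t \<le> T" "f \<in> borel_measurable (info M W B T t t)"
  shows "f \<in> borel_measurable (info M W B T t 0)" "f \<in> borel_measurable (info M W B T T t)"
    "f \<in> borel_measurable M"
proof -
  show 1: "f \<in> borel_measurable (info M W B T t 0)"
    by (rule measurable_mono_sets[OF assms(3) _ sets_info_mono]) (use assms in auto)
  show "f \<in> borel_measurable (info M W B T T t)"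
    by (rule measurable_mono_sets[OF assms(3) _ sets_info_mono]) (use assms in auto)
  show "f \<in> borel_measurable M"
    by (rule measurable_from_subalg[OF WN.K_subalg 1]) (use assms in auto)
qed

text \<open>
  Splits an increment into its Lebesgue, forward and backward parts. Square integrability is assumed
  only on the product space; the proof transfers it to every single time.
\<close>
lemma ds_process_increments:
  fixes Z :: "real \<Rightarrow> 'a \<Rightarrow> 'b::euclidean_space"
  assumes Z: "ds_process Z f g h"
  obtains G H where "WN.ito_integral g G" "BN.ito_integral h H"
    "\<And>t. 0 \<le> t \<Longrightarrow> t \<le> T \<Longrightarrow> sq_int M (Z t)"
    "\<And>s t. 0 \<le> s \<Longrightarrow> s \<le> t \<Longrightarrow> t \<le> T \<Longrightarrow>
      AE \<omega> in M. Z t \<omega> = Z s \<omega> + drift T f s t \<omega> + (G t \<omega> - G s \<omega>) + (H t \<omega> - H s \<omega>)"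
proof -
  have sq: "sq_int ST (joint Z)" "sq_int ST (joint f)" "sq_int ST (joint g)" "sq_int ST (joint h)"
    and Zm: "\<And>t. 0 \<le> t \<Longrightarrow> t \<le> T \<Longrightarrow> Z t \<in> borel_measurable (info M W B T t t)"
    and dZ: "has_ds_differential M T W B Z f g h"
    using Z by (auto simp: ds_process_def)
  obtain G H where GH: "has_forward_integral M T W B g G" "has_backward_integral M T W B h H"
    and eq: "\<And>t. t \<in> {0..T} \<Longrightarrow> AE \<omega> in M. Z t \<omega> = Z 0 \<omega> + (LINT s:{0..t}|lborel. f s \<omega>) + G t \<omega> + H t \<omega>"
    using dZ unfolding has_ds_differential_def by blast
  have G: "WN.ito_integral g G"
    by (rule WN.L2_integral_limit_ito_integral[OF GH(1)[unfolded has_forward_integral_def] _ sq_int_measurable[OF sq(3)]])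
       (simp add: forward_step_data_def WN.noise_step_data_def)
  have H: "BN.ito_integral h H"
    by (rule BN.L2_integral_limit_ito_integral[OF GH(2)[unfolded has_backward_integral_def] _ sq_int_measurable[OF sq(4)]])
       (simp add: backward_step_data_def BN.noise_step_data_def)
  have inc: "AE \<omega> in M. Z t \<omega> = Z s \<omega> + drift T f s t \<omega> + (G t \<omega> - G s \<omega>) + (H t \<omega> - H s \<omega>)"
    if st: "0 \<le> s" "s \<le> t" "t \<le> T" for s t
  proof -
    have stT: "s \<in> {0..T}" "t \<in> {0..T}" using st by auto
    show ?thesis
      using eq[OF stT(1)] eq[OF stT(2)] sq_int_sections[OF WN.prob_space_axioms sq(2)]
    proof eventually_elim
      case (elim \<omega>)
      show ?case
        using drift_eq_LINT_diff[where f=f, OF elim(3) st, symmetric] elim(1,2) by simp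
    qed
  qed
  have Zm': "Z t \<in> borel_measurable M" if "0 \<le> t" "t \<le> T" for t
    by (rule info_measurable(3)[OF that Zm[OF that]])
  \<comment> \<open>Almost every value is square integrable, hence one is, and the increments transport this to all.\<close>
  have "\<exists>u\<in>{0..T}. sq_int M (Z u)"
  proof -
    interpret P: pair_sigma_finite M "time T"
      by (rule pair_sigma_finite_time) (rule WN.prob_space_axioms)
    have "AE r in time T. integrable M (\<lambda>\<omega>. (norm (Z r \<omega>))\<^sup>2)"
      by (rule P.AE_integrable_snd) (use sq_int_norm[OF sq(1)] in \<open>simp add: state_time_def joint_def split_beta'\<close>)
    moreover have "emeasure (time T) (space (time T)) \<noteq> 0"
      using T_pos by (simp add: space_restrict_space emeasure_restrict_space)
    ultimately obtain u where "u \<in> space (time T)" "integrable M (\<lambda>\<omega>. (norm (Z u \<omega>))\<^sup>2)"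
      by (rule AE_witness)
    then show ?thesis using Zm' by (intro bexI[of _ u]) (auto simp: sq_int_def space_restrict_space)
  qed
  then obtain u where u: "0 \<le> u" "u \<le> T" "sq_int M (Z u)" by auto
  have sqD: "sq_int M (\<lambda>\<omega>. drift T f s t \<omega> + (G t \<omega> - G s \<omega>) + (H t \<omega> - H s \<omega>))"
    if st: "0 \<le> s" "s \<le> t" "t \<le> T" for s t
    using st by (intro sq_int_add sq_int_diff drift_sq_int[OF WN.prob_space_axioms sq(2)]
        WN.ito_integral_sq_int(2)[OF G] BN.ito_integral_sq_int(2)[OF H]) auto
  have cong: "sq_int M X'" if "sq_int M X" "X' \<in> borel_measurable M" "AE \<omega> in M. X' \<omega> = X \<omega>" for X X' :: "'a \<Rightarrow> 'b"
    by (rule sq_int_bound[OF that(1,2), where c=1]) (use that(3) in auto)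
  have "sq_int M (Z t)" if t: "0 \<le> t" "t \<le> T" for t
  proof (cases "u \<le> t")
    case True
    show ?thesis
      by (rule cong[OF sq_int_add[OF u(3) sqD[OF u(1) True t(2)]] Zm'[OF t]])
         (use inc[OF u(1) True t(2)] in \<open>simp add: add.assoc\<close>)
  next
    case False
    then have "t \<le> u" by simp
    show ?thesis
      by (rule cong[OF sq_int_diff[OF u(3) sqD[OF t(1) \<open>t \<le> u\<close> u(2)]] Zm'[OF t]])
         (use inc[OF t(1) \<open>t \<le> u\<close> u(2)] in \<open>auto simp: algebra_simps\<close>)
  qed
  then show ?thesis by (rule that[OF G H _ inc]) auto
qed

end

section \<open>The product formula in expectation\<close>

text \<open>
  Cut \<open>[0, t]\<close> into \<open>n\<close> equal pieces: the bounds add up to \<open>C sqrt (t/n) (\<mu> t - \<mu> 0)\<close>, which tends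
  to \<open>0\<close>.
\<close>
lemma eq_if_sqrt_additive_bound:
  fixes \<Phi> \<mu> :: "real \<Rightarrow> real"
  assumes bound: "\<And>s t. 0 \<le> s \<Longrightarrow> s \<le> t \<Longrightarrow> t \<le> T \<Longrightarrow> \<bar>\<Phi> t - \<Phi> s\<bar> \<le> C * sqrt (t - s) * (\<mu> t - \<mu> s)"
    and t: "0 \<le> t" "t \<le> T"
  shows "\<Phi> t = \<Phi> 0"
proof -
  have *: "\<bar>\<Phi> t - \<Phi> 0\<bar> \<le> C * sqrt (t / real (Suc n)) * (\<mu> t - \<mu> 0)" for n
  proof -
    define N where "N = real (Suc n)"
    have N: "0 < N" by (simp add: N_def)
    define g where "g i = t * real i / N" for i
    have g: "0 \<le> g i" "g i \<le> g (Suc i)" "g (Suc i) - g i = t / N" for i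
      using t N by (auto simp: g_def field_simps)
    have gT: "g (Suc i) \<le> T" if "i < Suc n" for i
    proof -
      have "real (Suc i) \<le> N" using that by (simp add: N_def)
      then have "t * real (Suc i) \<le> t * N" using t by (intro mult_left_mono) auto
      then have "g (Suc i) \<le> t" using N by (simp add: g_def field_simps)
      then show ?thesis using t by simp
    qed
    have "\<Phi> t - \<Phi> 0 = (\<Sum>i<Suc n. \<Phi> (g (Suc i)) - \<Phi> (g i))"
      using N by (subst sum_lessThan_telescope) (simp add: g_def N_def)
    also have "\<bar>\<dots>\<bar> \<le> (\<Sum>i<Suc n. \<bar>\<Phi> (g (Suc i)) - \<Phi> (g i)\<bar>)" by (rule sum_abs)
    also have "\<dots> \<le> (\<Sum>i<Suc n. C * sqrt (t / N) * (\<mu> (g (Suc i)) - \<mu> (g i)))"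
      using bound[OF g(1,2) gT] by (intro sum_mono) (simp add: g(3))
    also have "\<dots> = C * sqrt (t / N) * (\<Sum>i<Suc n. \<mu> (g (Suc i)) - \<mu> (g i))"
      by (rule sum_distrib_left[symmetric])
    also have "(\<Sum>i<Suc n. \<mu> (g (Suc i)) - \<mu> (g i)) = \<mu> t - \<mu> 0"
      using N by (subst sum_lessThan_telescope) (simp add: g_def N_def)
    finally show ?thesis by (simp add: N_def)
  qed
  have "(\<lambda>n. t * inverse (real (Suc n))) \<longlonglongrightarrow> t * 0"
    by (intro tendsto_mult tendsto_const LIMSEQ_inverse_real_of_nat)
  then have "(\<lambda>n. C * sqrt (t / real (Suc n)) * (\<mu> t - \<mu> 0)) \<longlonglongrightarrow> C * sqrt 0 * (\<mu> t - \<mu> 0)"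
    by (intro tendsto_mult tendsto_const tendsto_real_sqrt) (simp add: divide_inverse)
  then have "\<bar>\<Phi> t - \<Phi> 0\<bar> \<le> 0"
    using * by (intro LIMSEQ_le_const) auto
  then show ?thesis by simp
qed

text \<open>
  Of the sixteen terms of the full expansion the hypotheses on \<open>G\<close> and \<open>G'\<close> remove two, and those on
  \<open>H\<close> and \<open>H'\<close> remove two groups of four. The term with \<open>H\<close> and \<open>H'\<close> belongs to both groups, hence
  its minus sign.
\<close>
lemma ip_expand_increments:
  fixes a F G H :: "'a \<Rightarrow> 'b::euclidean_space"
  assumes s: "sq_int M a" "sq_int M F" "sq_int M G" "sq_int M H"
    and s': "sq_int M b" "sq_int M F'" "sq_int M G'" "sq_int M H'"
    and G: "ip M a G' = 0" "ip M G b = 0"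
    and H: "ip M (\<lambda>\<omega>. a \<omega> + F \<omega> + G \<omega> + H \<omega>) H' = 0" "ip M H (\<lambda>\<omega>. b \<omega> + F' \<omega> + G' \<omega> + H' \<omega>) = 0"
  shows "ip M (\<lambda>\<omega>. a \<omega> + F \<omega> + G \<omega> + H \<omega>) (\<lambda>\<omega>. b \<omega> + F' \<omega> + G' \<omega> + H' \<omega>) - ip M a b
    = ip M a F' + ip M F b + ip M F F' + ip M F G' + ip M G F' + ip M G G' - ip M H H'"
  using G H by (simp add: ip_add_left ip_add_right sq_int_add s s')

lemma abs_ip_le:
  assumes "sq_int N a" "sq_int N b" "ip N a a \<le> p" "ip N b b \<le> q"
  shows "\<bar>ip N a b\<bar> \<le> sqrt p * sqrt q"
  by (rule order_trans[OF ip_Cauchy_Schwarz[OF assms(1,2)]])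
     (intro mult_mono real_sqrt_le_mono assms real_sqrt_ge_zero ip_nonneg order_trans[OF ip_nonneg assms(3)])

context ds_basis
begin

lemma energy_mono:
  assumes "sq_int ST (joint f)" "s \<le> t" "t \<le> u"
  shows "energy s t f \<le> energy s u f"
  using ip_on_strip_split[OF assms(2,3) assms(1) assms(1)] ip_nonneg[of ST "on_strip t u (joint f)"] by simp

lemma increment_energy:
  fixes Z :: "real \<Rightarrow> 'a \<Rightarrow> 'b::euclidean_space"
  assumes Z: "ds_process Z f g h" and st: "0 \<le> s" "s \<le> t" "t \<le> T"
  shows "ip M (\<lambda>\<omega>. Z t \<omega> - Z s \<omega>) (\<lambda>\<omega>. Z t \<omega> - Z s \<omega>) \<le> 4 * (T + 1) * (energy s t f + energy s t g + energy s t h)"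
proof -
  obtain G H where G: "WN.ito_integral g G" and H: "BN.ito_integral h H"
    and Zs: "\<And>t. 0 \<le> t \<Longrightarrow> t \<le> T \<Longrightarrow> sq_int M (Z t)"
    and inc: "\<And>s t. 0 \<le> s \<Longrightarrow> s \<le> t \<Longrightarrow> t \<le> T \<Longrightarrow>
      AE \<omega> in M. Z t \<omega> = Z s \<omega> + drift T f s t \<omega> + (G t \<omega> - G s \<omega>) + (H t \<omega> - H s \<omega>)"
    by (rule ds_process_increments[OF Z]) blast
  have fs: "sq_int ST (joint f)" using Z by (simp add: ds_process_def)
  define dF where "dF = drift T f s t"
  define dG where "dG = (\<lambda>\<omega>. G t \<omega> - G s \<omega>)"
  define dH where "dH = (\<lambda>\<omega>. H t \<omega> - H s \<omega>)"
  have dF: "sq_int M dF" unfolding dF_def by (rule drift_sq_int[OF WN.prob_space_axioms fs st])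
  have dG: "sq_int M dG" unfolding dG_def
    by (intro sq_int_diff WN.ito_integral_sq_int(2)[OF G]) (use st in auto)
  have dH: "sq_int M dH" unfolding dH_def
    by (intro sq_int_diff BN.ito_integral_sq_int(2)[OF H]) (use st in auto)
  have Zd: "sq_int M (\<lambda>\<omega>. Z t \<omega> - Z s \<omega>)" using st by (intro sq_int_diff Zs) auto
  have sum: "sq_int M (\<lambda>\<omega>. dF \<omega> + (dG \<omega> + dH \<omega>))" by (intro sq_int_add dF dG dH)
  have "AE \<omega> in M. Z t \<omega> - Z s \<omega> = dF \<omega> + (dG \<omega> + dH \<omega>)"
    using inc[OF st] by eventually_elim (simp add: dF_def dG_def dH_def)
  then have "ip M (\<lambda>\<omega>. Z t \<omega> - Z s \<omega>) (\<lambda>\<omega>. Z t \<omega> - Z s \<omega>)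
      = ip M (\<lambda>\<omega>. dF \<omega> + (dG \<omega> + dH \<omega>)) (\<lambda>\<omega>. dF \<omega> + (dG \<omega> + dH \<omega>))"
    by (intro ip_cong_AE sq_int_measurable Zd sum)
  also have "\<dots> \<le> 2 * ip M dF dF + 2 * ip M (\<lambda>\<omega>. dG \<omega> + dH \<omega>) (\<lambda>\<omega>. dG \<omega> + dH \<omega>)"
    by (intro ip_add_self_le sq_int_add dF dG dH)
  also have "ip M (\<lambda>\<omega>. dG \<omega> + dH \<omega>) (\<lambda>\<omega>. dG \<omega> + dH \<omega>) \<le> 2 * ip M dG dG + 2 * ip M dH dH"
    by (intro ip_add_self_le dG dH)
  also have "ip M dG dG = energy s t g"
    unfolding dG_def WN.ito_isometry[OF G G st] on_strip_def ..
  also have "ip M dH dH = energy s t h"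
    unfolding dH_def BN.ito_isometry[OF H H st] on_strip_def ..
  also have "ip M dF dF \<le> T * energy s t f"
  proof -
    have "ip M dF dF \<le> (t - s) * energy s t f"
      unfolding dF_def by (rule drift_energy[OF WN.prob_space_axioms fs st])
    also have "\<dots> \<le> T * energy s t f"
      using st by (intro mult_right_mono ip_nonneg) auto
    finally show ?thesis .
  qed
  finally have "ip M (\<lambda>\<omega>. Z t \<omega> - Z s \<omega>) (\<lambda>\<omega>. Z t \<omega> - Z s \<omega>)
      \<le> 2 * (T * energy s t f) + 2 * (2 * energy s t g + 2 * energy s t h)" by simp
  also have "\<dots> \<le> 4 * (T + 1) * (energy s t f + energy s t g + energy s t h)"
  proof -
    have "0 \<le> T * energy s t f" "0 \<le> T * energy s t g" "0 \<le> T * energy s t h"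
      using T_pos by (auto intro!: mult_nonneg_nonneg ip_nonneg)
    then show ?thesis using ip_nonneg[of ST "on_strip s t (joint f)"] by (simp add: algebra_simps)
  qed
  finally show ?thesis .
qed

text \<open>
  Freezing \<open>Z\<close> at the left endpoint costs at each time of \<open>(s, t]\<close> at most a constant times the
  energy of the whole interval, and integrating this over the interval gives another factor \<open>t - s\<close>.
\<close>
lemma frozen_energy:
  fixes Z :: "real \<Rightarrow> 'a \<Rightarrow> 'b::euclidean_space"
  assumes Z: "ds_process Z f g h" and st: "0 \<le> s" "s \<le> t" "t \<le> T"
  defines "D \<equiv> on_strip s t (\<lambda>p. joint Z p - Z s (fst p))"
  shows "sq_int ST D" "ip ST D D \<le> (t - s) * (4 * (T + 1) * (energy s t f + energy s t g + energy s t h))"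
proof -
  interpret P: pair_sigma_finite M "time T"
    by (rule pair_sigma_finite_time) (rule WN.prob_space_axioms)
  interpret L: finite_measure "time T" by (rule finite_measure_time)
  have sq: "sq_int ST (joint Z)" "sq_int ST (joint f)" "sq_int ST (joint g)" "sq_int ST (joint h)"
    using Z by (auto simp: ds_process_def)
  obtain Zs: "\<And>t. 0 \<le> t \<Longrightarrow> t \<le> T \<Longrightarrow> sq_int M (Z t)"
    by (rule ds_process_increments[OF Z]) blast
  have "sq_int M (Z s)" using Zs st by simp
  then show Ds: "sq_int ST D"
    unfolding D_def
    by (intro sq_int_on_strip sq_int_diff sq(1) sq_int_const_in_time[OF WN.prob_space_axioms])
  define c where "c = 4 * (T + 1) * (energy s t f + energy s t g + energy s t h)"
  have i: "integrable (M \<Otimes>\<^sub>M time T) (\<lambda>(\<omega>, r). (norm (D (\<omega>, r)))\<^sup>2)"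
    using sq_int_norm[OF Ds] by (simp add: state_time_def split_beta')
  have "ip ST D D = (\<integral>r. (\<integral>\<omega>. (norm (D (\<omega>, r)))\<^sup>2 \<partial>M) \<partial>time T)"
    unfolding ip_self using P.integral_snd[OF i] by (simp add: state_time_def split_beta')
  also have "\<dots> \<le> (\<integral>r. indicator ({s<..t} \<inter> {s<..t}) r * c \<partial>time T)"
  proof (rule integral_mono)
    show "integrable (time T) (\<lambda>r. \<integral>\<omega>. (norm (D (\<omega>, r)))\<^sup>2 \<partial>M)" by (rule P.integrable_snd[OF i])
    have A: "{s<..t} \<inter> {s<..t} \<in> sets (time T)"
      using st by (subst sets_restrict_space_iff) auto
    show "integrable (time T) (\<lambda>r. indicator ({s<..t} \<inter> {s<..t}) r * c)"
      by (intro integrable_mult_left integrable_real_indicator A) (simp add: less_top[symmetric])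
    fix r assume r: "r \<in> space (time T)"
    show "(\<integral>\<omega>. (norm (D (\<omega>, r)))\<^sup>2 \<partial>M) \<le> indicator ({s<..t} \<inter> {s<..t}) r * c"
    proof (cases "r \<in> {s<..t}")
      case True
      then have D: "D (\<omega>, r) = Z r \<omega> - Z s \<omega>" for \<omega>
        by (simp add: D_def on_strip_def indicator_strip joint_def)
      have "(\<integral>\<omega>. (norm (D (\<omega>, r)))\<^sup>2 \<partial>M) \<le> 4 * (T + 1) * (energy s r f + energy s r g + energy s r h)"
        unfolding D ip_self[symmetric] using True st by (intro increment_energy[OF Z]) auto
      also have "\<dots> \<le> c"
        unfolding c_def using True T_pos
        by (intro mult_left_mono add_mono energy_mono sq) auto
      finally show ?thesis using True by simp
    next
      case False
      then have "D (\<omega>, r) = 0" for \<omega> by (simp add: D_def on_strip_def indicator_strip)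
      then show ?thesis using False by simp
    qed
  qed
  also have "\<dots> = measure (time T) ({s<..t} \<inter> {s<..t}) * c"
  proof -
    have "({s<..t} \<inter> {s<..t}) \<inter> space (time T) = {s<..t} \<inter> {s<..t}"
      using st by (auto simp: space_restrict_space)
    then show ?thesis by simp
  qed
  also have "\<dots> = (t - s) * c" using st by (subst measure_strip_overlap) auto
  finally show "ip ST D D \<le> (t - s) * (4 * (T + 1) * (energy s t f + energy s t g + energy s t h))"
    by (simp add: c_def)
qed

text \<open>The contribution of \<open>(s, t]\<close> to the right-hand side of the product formula.\<close>
definition bracket where
  "bracket s t Z f g h Y f' g' h' = ip ST (on_strip s t (joint Z)) (on_strip s t (joint f'))
     + ip ST (on_strip s t (joint f)) (on_strip s t (joint Y))
     + ip ST (on_strip s t (joint g)) (on_strip s t (joint g')) - ip ST (on_strip s t (joint h)) (on_strip s t (joint h'))"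

text \<open>
  The expansion of the increment is exact. Its terms that pair two forward or two backward increments
  equal those of the bracket by the isometry. The drift terms pair a frozen value instead of the
  running one, and the mixed terms contain at least one Lebesgue increment; both are of order
  \<open>sqrt (t - s)\<close> by \<open>frozen_energy\<close> and \<open>drift_energy\<close>.
\<close>
lemma product_local_estimate:
  fixes Z Y :: "real \<Rightarrow> 'a \<Rightarrow> 'b::euclidean_space"
  assumes Z: "ds_process Z f g h" and Y: "ds_process Y f' g' h'" and st: "0 \<le> s" "s \<le> t" "t \<le> T"
  defines "m \<equiv> energy s t f + energy s t g + energy s t h + energy s t f' + energy s t g' + energy s t h'"
  shows "\<bar>ip M (Z t) (Y t) - ip M (Z s) (Y s) - bracket s t Z f g h Y f' g' h'\<bar>
    \<le> (4 * sqrt (T + 1) + sqrt T + 2) * sqrt (t - s) * m"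
proof -
  obtain G H where G: "WN.ito_integral g G" and H: "BN.ito_integral h H"
    and Zs: "\<And>t. 0 \<le> t \<Longrightarrow> t \<le> T \<Longrightarrow> sq_int M (Z t)"
    and incZ: "\<And>s t. 0 \<le> s \<Longrightarrow> s \<le> t \<Longrightarrow> t \<le> T \<Longrightarrow>
      AE \<omega> in M. Z t \<omega> = Z s \<omega> + drift T f s t \<omega> + (G t \<omega> - G s \<omega>) + (H t \<omega> - H s \<omega>)"
    by (rule ds_process_increments[OF Z]) blast
  obtain G' H' where G': "WN.ito_integral g' G'" and H': "BN.ito_integral h' H'"
    and Ys: "\<And>t. 0 \<le> t \<Longrightarrow> t \<le> T \<Longrightarrow> sq_int M (Y t)"
    and incY: "\<And>s t. 0 \<le> s \<Longrightarrow> s \<le> t \<Longrightarrow> t \<le> T \<Longrightarrow>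
      AE \<omega> in M. Y t \<omega> = Y s \<omega> + drift T f' s t \<omega> + (G' t \<omega> - G' s \<omega>) + (H' t \<omega> - H' s \<omega>)"
    by (rule ds_process_increments[OF Y]) blast
  have sq: "sq_int ST (joint Z)" "sq_int ST (joint f)" "sq_int ST (joint g)" "sq_int ST (joint h)"
    and Zm: "\<And>t. 0 \<le> t \<Longrightarrow> t \<le> T \<Longrightarrow> Z t \<in> borel_measurable (info M W B T t t)"
    using Z by (auto simp: ds_process_def)
  have sq': "sq_int ST (joint Y)" "sq_int ST (joint f')" "sq_int ST (joint g')" "sq_int ST (joint h')"
    and Ym: "\<And>t. 0 \<le> t \<Longrightarrow> t \<le> T \<Longrightarrow> Y t \<in> borel_measurable (info M W B T t t)"
    using Y by (auto simp: ds_process_def)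
  note pr = WN.prob_space_axioms
  have s': "0 \<le> s" "s \<le> T" and t': "0 \<le> t" "t \<le> T" using st by auto
  define F where "F = drift T f s t"
  define F' where "F' = drift T f' s t"
  define dG where "dG = (\<lambda>\<omega>. G t \<omega> - G s \<omega>)"
  define dG' where "dG' = (\<lambda>\<omega>. G' t \<omega> - G' s \<omega>)"
  define dH where "dH = (\<lambda>\<omega>. H t \<omega> - H s \<omega>)"
  define dH' where "dH' = (\<lambda>\<omega>. H' t \<omega> - H' s \<omega>)"
  note a = Zs[OF s'] and b = Ys[OF s']
  have F: "sq_int M F" unfolding F_def by (rule drift_sq_int[OF pr sq(2) st])
  have F': "sq_int M F'" unfolding F'_def by (rule drift_sq_int[OF pr sq'(2) st])
  have dG: "sq_int M dG" unfolding dG_def by (intro sq_int_diff WN.ito_integral_sq_int(2)[OF G] s' t')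
  have dG': "sq_int M dG'" unfolding dG'_def by (intro sq_int_diff WN.ito_integral_sq_int(2)[OF G'] s' t')
  have dH: "sq_int M dH" unfolding dH_def by (intro sq_int_diff BN.ito_integral_sq_int(2)[OF H] s' t')
  have dH': "sq_int M dH'" unfolding dH'_def by (intro sq_int_diff BN.ito_integral_sq_int(2)[OF H'] s' t')
  have Zt: "AE \<omega> in M. Z t \<omega> = Z s \<omega> + F \<omega> + dG \<omega> + dH \<omega>"
    using incZ[OF st] by (simp add: F_def dG_def dH_def)
  have Yt: "AE \<omega> in M. Y t \<omega> = Y s \<omega> + F' \<omega> + dG' \<omega> + dH' \<omega>"
    using incY[OF st] by (simp add: F'_def dG'_def dH'_def)
  have Zsum: "sq_int M (\<lambda>\<omega>. Z s \<omega> + F \<omega> + dG \<omega> + dH \<omega>)" by (intro sq_int_add a F dG dH)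
  have Ysum: "sq_int M (\<lambda>\<omega>. Y s \<omega> + F' \<omega> + dG' \<omega> + dH' \<omega>)" by (intro sq_int_add b F' dG' dH')
  \<comment> \<open>Forward increments are orthogonal to the past value, backward ones to the future value.\<close>
  have "ip M (Z s) dG' = 0"
    unfolding dG'_def by (rule WN.ito_mean[OF G' st info_measurable(1)[OF s' Zm[OF s']] a])
  moreover have "ip M dG (Y s) = 0"
    unfolding dG_def ip_commute[of M _ "Y s"]
    by (rule WN.ito_mean[OF G st info_measurable(1)[OF s' Ym[OF s']] b])
  moreover have "ip M (\<lambda>\<omega>. Z s \<omega> + F \<omega> + dG \<omega> + dH \<omega>) dH' = 0"
  proof -
    have "ip M (\<lambda>\<omega>. Z s \<omega> + F \<omega> + dG \<omega> + dH \<omega>) dH' = ip M (Z t) dH'"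
      using Zt by (intro ip_cong_AE sq_int_measurable Zsum dH' Zs t') auto
    also have "\<dots> = 0"
      unfolding dH'_def by (rule BN.ito_mean[OF H' st info_measurable(2)[OF t' Zm[OF t']] Zs[OF t']])
    finally show ?thesis .
  qed
  moreover have "ip M dH (\<lambda>\<omega>. Y s \<omega> + F' \<omega> + dG' \<omega> + dH' \<omega>) = 0"
  proof -
    have "ip M dH (\<lambda>\<omega>. Y s \<omega> + F' \<omega> + dG' \<omega> + dH' \<omega>) = ip M (Y t) dH"
      unfolding ip_commute[of M dH] using Yt by (intro ip_cong_AE sq_int_measurable Ysum dH Ys t') auto
    also have "\<dots> = 0"
      unfolding dH_def by (rule BN.ito_mean[OF H st info_measurable(2)[OF t' Ym[OF t']] Ys[OF t']])
    finally show ?thesis .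
  qed
  ultimately have "ip M (\<lambda>\<omega>. Z s \<omega> + F \<omega> + dG \<omega> + dH \<omega>) (\<lambda>\<omega>. Y s \<omega> + F' \<omega> + dG' \<omega> + dH' \<omega>) - ip M (Z s) (Y s)
    = ip M (Z s) F' + ip M F (Y s) + ip M F F' + ip M F dG' + ip M dG F' + ip M dG dG' - ip M dH dH'"
    by (rule ip_expand_increments[OF a F dG dH b F' dG' dH'])
  also have "ip M (\<lambda>\<omega>. Z s \<omega> + F \<omega> + dG \<omega> + dH \<omega>) (\<lambda>\<omega>. Y s \<omega> + F' \<omega> + dG' \<omega> + dH' \<omega>) = ip M (Z t) (Y t)"
    using Zt Yt by (intro ip_cong_AE sq_int_measurable Zsum Ysum Zs Ys t') auto
  finally have main: "ip M (Z t) (Y t) - ip M (Z s) (Y s)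
    = ip M (Z s) F' + ip M F (Y s) + ip M F F' + ip M F dG' + ip M dG F' + ip M dG dG' - ip M dH dH'" .
  have iso: "ip M dG dG' = ip ST (on_strip s t (joint g)) (on_strip s t (joint g'))"
    "ip M dH dH' = ip ST (on_strip s t (joint h)) (on_strip s t (joint h'))"
    "ip M dG dG = energy s t g" "ip M dG' dG' = energy s t g'"
    unfolding dG_def dG'_def dH_def dH'_def WN.ito_isometry[OF G G' st] BN.ito_isometry[OF H H' st]
      WN.ito_isometry[OF G G st] WN.ito_isometry[OF G' G' st] on_strip_def by (rule refl)+
  define DZ where "DZ = on_strip s t (\<lambda>p. joint Z p - Z s (fst p))"
  define DY where "DY = on_strip s t (\<lambda>p. joint Y p - Y s (fst p))"
  have dr: "ip M (Z s) F' = ip ST (on_strip s t (joint Z)) (on_strip s t (joint f')) - ip ST DZ (on_strip s t (joint f'))"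
    "ip M F (Y s) = ip ST (on_strip s t (joint f)) (on_strip s t (joint Y)) - ip ST DY (on_strip s t (joint f))"
    unfolding F'_def F_def ip_commute[of M "drift T f s t"] ip_commute[of ST "on_strip s t (joint f)" "on_strip s t (joint Y)"]
      ip_drift[OF pr sq'(2) a] ip_drift[OF pr sq(2) b] DZ_def DY_def on_strip_diff
    by (simp_all add: ip_diff_left sq_int_on_strip sq sq' sq_int_const_in_time[OF pr a] sq_int_const_in_time[OF pr b])
  have m0: "0 \<le> energy s t f" "0 \<le> energy s t g" "0 \<le> energy s t h"
    "0 \<le> energy s t f'" "0 \<le> energy s t g'" "0 \<le> energy s t h'" by (rule ip_nonneg)+
  have m: "0 \<le> m" "energy s t f \<le> m" "energy s t g \<le> m" "energy s t f' \<le> m" "energy s t g' \<le> m"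
    "energy s t f + energy s t g + energy s t h \<le> m" "energy s t f' + energy s t g' + energy s t h' \<le> m"
    using m0 unfolding m_def by linarith+
  define d where "d = t - s"
  have d: "0 \<le> d" "d \<le> T" using st by (auto simp: d_def)
  have Fb: "ip M F F \<le> d * m" "ip M F' F' \<le> d * m"
    unfolding F_def F'_def d_def
    using order_trans[OF drift_energy[OF pr sq(2) st] mult_left_mono[OF m(2)]]
      order_trans[OF drift_energy[OF pr sq'(2) st] mult_left_mono[OF m(4)]] st by auto
  have Db: "ip ST DZ DZ \<le> d * (4 * (T + 1) * m)" "ip ST DY DY \<le> d * (4 * (T + 1) * m)"
    unfolding DZ_def DY_def d_def
    using order_trans[OF frozen_energy(2)[OF Z st] mult_left_mono[OF mult_left_mono[OF m(6)]]]
      order_trans[OF frozen_energy(2)[OF Y st] mult_left_mono[OF mult_left_mono[OF m(7)]]] st T_pos by auto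
  have "\<bar>ip M F F'\<bar> \<le> sqrt (d * m) * sqrt (d * m)" by (rule abs_ip_le[OF F F' Fb])
  also have "\<dots> = d * m" using d m(1) by simp
  also have "\<dots> \<le> sqrt T * sqrt d * m"
  proof -
    have "d = sqrt d * sqrt d" using d by simp
    also have "\<dots> \<le> sqrt T * sqrt d" using d by (intro mult_right_mono) auto
    finally show ?thesis using m(1) by (rule mult_right_mono)
  qed
  finally have e1: "\<bar>ip M F F'\<bar> \<le> sqrt T * sqrt d * m" .
  have half: "sqrt (d * m) * sqrt m = sqrt d * m"
    using m(1) by (simp add: real_sqrt_mult)
  have e2: "\<bar>ip M F dG'\<bar> \<le> sqrt d * m"
    using abs_ip_le[OF F dG' Fb(1), of m] m(5) unfolding iso half by simp
  have e3: "\<bar>ip M dG F'\<bar> \<le> sqrt d * m"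
    using abs_ip_le[OF F' dG Fb(2), of m] m(3) unfolding iso half ip_commute[of M dG F'] by simp
  have quarter: "sqrt (d * (4 * (T + 1) * m)) * sqrt m = 2 * sqrt (T + 1) * sqrt d * m"
  proof -
    have "sqrt (d * (4 * (T + 1) * m)) * sqrt m = 2 * sqrt (T + 1) * sqrt d * (sqrt m * sqrt m)"
      unfolding real_sqrt_mult real_sqrt_four by (simp only: mult_ac)
    then show ?thesis using m(1) by simp
  qed
  have e4: "\<bar>ip ST DZ (on_strip s t (joint f'))\<bar> \<le> 2 * sqrt (T + 1) * sqrt d * m"
    unfolding quarter[symmetric]
    by (rule abs_ip_le[OF _ _ Db(1) m(4)]) (use frozen_energy(1)[OF Z st] in \<open>auto simp: DZ_def sq_int_on_strip sq'\<close>)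
  have e5: "\<bar>ip ST DY (on_strip s t (joint f))\<bar> \<le> 2 * sqrt (T + 1) * sqrt d * m"
    unfolding quarter[symmetric]
    by (rule abs_ip_le[OF _ _ Db(2) m(2)]) (use frozen_energy(1)[OF Y st] in \<open>auto simp: DY_def sq_int_on_strip sq\<close>)
  have "ip M (Z t) (Y t) - ip M (Z s) (Y s) - bracket s t Z f g h Y f' g' h'
      = ip M F F' + ip M F dG' + ip M dG F' - ip ST DZ (on_strip s t (joint f')) - ip ST DY (on_strip s t (joint f))"
    unfolding main iso(1,2) dr bracket_def by simp
  also have "\<bar>\<dots>\<bar> \<le> sqrt T * sqrt d * m + sqrt d * m + sqrt d * m
      + 2 * sqrt (T + 1) * sqrt d * m + 2 * sqrt (T + 1) * sqrt d * m"
    using e1 e2 e3 e4 e5 by linarith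
  also have "\<dots> = (4 * sqrt (T + 1) + sqrt T + 2) * sqrt (t - s) * m"
    by (simp add: d_def algebra_simps)
  finally show ?thesis .
qed

theorem product_formula:
  fixes Z Y :: "real \<Rightarrow> 'a \<Rightarrow> 'b::euclidean_space"
  assumes Z: "ds_process Z f g h" and Y: "ds_process Y f' g' h'" and t: "0 \<le> t" "t \<le> T"
  shows "ip M (Z t) (Y t) - ip M (Z 0) (Y 0) = bracket 0 t Z f g h Y f' g' h'"
proof -
  have sq: "sq_int ST (joint Z)" "sq_int ST (joint f)" "sq_int ST (joint g)" "sq_int ST (joint h)"
    using Z by (auto simp: ds_process_def)
  have sq': "sq_int ST (joint Y)" "sq_int ST (joint f')" "sq_int ST (joint g')" "sq_int ST (joint h')"
    using Y by (auto simp: ds_process_def)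
  let ?\<Phi> = "\<lambda>t. ip M (Z t) (Y t) - bracket 0 t Z f g h Y f' g' h'"
  let ?\<mu> = "\<lambda>t. energy 0 t f + energy 0 t g + energy 0 t h + energy 0 t f' + energy 0 t g' + energy 0 t h'"
  have "?\<Phi> t = ?\<Phi> 0"
  proof (rule eq_if_sqrt_additive_bound[OF _ t])
    fix s t assume st: "0 \<le> s" "s \<le> t" "t \<le> T"
    have "bracket 0 t Z f g h Y f' g' h' = bracket 0 s Z f g h Y f' g' h' + bracket s t Z f g h Y f' g' h'"
      unfolding bracket_def ip_on_strip_split[OF st(1,2) sq(1) sq'(2)] ip_on_strip_split[OF st(1,2) sq(2) sq'(1)]
        ip_on_strip_split[OF st(1,2) sq(3) sq'(3)] ip_on_strip_split[OF st(1,2) sq(4) sq'(4)] by simp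
    moreover have "?\<mu> t - ?\<mu> s = energy s t f + energy s t g + energy s t h + energy s t f' + energy s t g' + energy s t h'"
      unfolding ip_on_strip_split[OF st(1,2) sq(2) sq(2)] ip_on_strip_split[OF st(1,2) sq(3) sq(3)]
        ip_on_strip_split[OF st(1,2) sq(4) sq(4)] ip_on_strip_split[OF st(1,2) sq'(2) sq'(2)]
        ip_on_strip_split[OF st(1,2) sq'(3) sq'(3)] ip_on_strip_split[OF st(1,2) sq'(4) sq'(4)] by simp
    ultimately show "\<bar>?\<Phi> t - ?\<Phi> s\<bar> \<le> (4 * sqrt (T + 1) + sqrt T + 2) * sqrt (t - s) * (?\<mu> t - ?\<mu> s)"
      using product_local_estimate[OF Z Y st] by (simp add: algebra_simps)
  qed
  moreover have "bracket 0 0 Z f g h Y f' g' h' = 0"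
    by (simp add: bracket_def ip_on_strip_empty)
  ultimately show ?thesis by simp
qed

abbreviation process_diff :: "(real \<Rightarrow> 'a \<Rightarrow> 'b::euclidean_space) \<Rightarrow> (real \<Rightarrow> 'a \<Rightarrow> 'b) \<Rightarrow> real \<Rightarrow> 'a \<Rightarrow> 'b" where
  "process_diff Z Y \<equiv> \<lambda>t \<omega>. Z t \<omega> - Y t \<omega>"

lemma joint_diff: "joint (process_diff Z Y) = (\<lambda>p. joint Z p - joint Y p)"
  by (simp add: joint_def fun_eq_iff)

lemma ds_process_sq_int:
  fixes Z :: "real \<Rightarrow> 'a \<Rightarrow> 'b::euclidean_space"
  assumes "ds_process Z f g h" "0 \<le> t" "t \<le> T" shows "sq_int M (Z t)"
  by (rule ds_process_increments[OF assms(1)]) (use assms in blast)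

text \<open>Subtracts two instances of the product formula, whose two sides are bilinear.\<close>
lemma product_formula_diff:
  fixes Z1 Z2 Y :: "real \<Rightarrow> 'a \<Rightarrow> 'b::euclidean_space"
  assumes Z1: "ds_process Z1 f1 g1 h1" and Z2: "ds_process Z2 f2 g2 h2" and Y: "ds_process Y f' g' h'"
    and t: "0 \<le> t" "t \<le> T"
  shows "ip M (process_diff Z1 Z2 t) (Y t) - ip M (process_diff Z1 Z2 0) (Y 0)
    = bracket 0 t (process_diff Z1 Z2) (process_diff f1 f2) (process_diff g1 g2) (process_diff h1 h2) Y f' g' h'"
proof -
  have t0: "0 \<le> (0::real)" "0 \<le> T" using T_pos by auto
  have sq: "sq_int ST (joint Z1)" "sq_int ST (joint f1)" "sq_int ST (joint g1)" "sq_int ST (joint h1)"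
    "sq_int ST (joint Z2)" "sq_int ST (joint f2)" "sq_int ST (joint g2)" "sq_int ST (joint h2)"
    "sq_int ST (joint Y)" "sq_int ST (joint f')" "sq_int ST (joint g')" "sq_int ST (joint h')"
    using Z1 Z2 Y by (auto simp: ds_process_def)
  show ?thesis
    using product_formula[OF Z1 Y t] product_formula[OF Z2 Y t]
    by (simp add: bracket_def joint_diff on_strip_diff ip_diff_left sq_int_on_strip sq
        ds_process_sq_int[OF Z1 t] ds_process_sq_int[OF Z2 t] ds_process_sq_int[OF Y t]
        ds_process_sq_int[OF Z1 t0] ds_process_sq_int[OF Z2 t0] ds_process_sq_int[OF Y t0])
qed

lemma energy_formula_diff:
  fixes Z1 Z2 :: "real \<Rightarrow> 'a \<Rightarrow> 'b::euclidean_space"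
  assumes Z1: "ds_process Z1 f1 g1 h1" and Z2: "ds_process Z2 f2 g2 h2" and t: "0 \<le> t" "t \<le> T"
  defines "Z \<equiv> process_diff Z1 Z2" and "f \<equiv> process_diff f1 f2" and "g \<equiv> process_diff g1 g2" and "h \<equiv> process_diff h1 h2"
  shows "ip M (Z t) (Z t) - ip M (Z 0) (Z 0) = 2 * ip ST (on_strip 0 t (joint Z)) (on_strip 0 t (joint f)) + energy 0 t g - energy 0 t h"
proof -
  have t0: "0 \<le> (0::real)" "0 \<le> T" using T_pos by auto
  have sq: "sq_int ST (joint Z1)" "sq_int ST (joint f1)" "sq_int ST (joint g1)" "sq_int ST (joint h1)"
    "sq_int ST (joint Z2)" "sq_int ST (joint f2)" "sq_int ST (joint g2)" "sq_int ST (joint h2)"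
    using Z1 Z2 by (auto simp: ds_process_def)
  have sqd: "sq_int ST (joint Z)" "sq_int ST (joint f)" "sq_int ST (joint g)" "sq_int ST (joint h)"
    unfolding Z_def f_def g_def h_def joint_diff by (intro sq_int_diff sq)+
  have sqM: "sq_int M (Z1 t)" "sq_int M (Z2 t)" "sq_int M (Z1 0)" "sq_int M (Z2 0)"
    by (fact ds_process_sq_int[OF Z1 t] ds_process_sq_int[OF Z2 t] ds_process_sq_int[OF Z1 t0] ds_process_sq_int[OF Z2 t0])+
  have sqMd: "sq_int M (Z t)" "sq_int M (Z 0)"
    unfolding Z_def by (intro sq_int_diff sqM)+
  have expand: "ip M (Z t) (Z t) - ip M (Z 0) (Z 0)
      = (ip M (Z t) (Z1 t) - ip M (Z 0) (Z1 0)) - (ip M (Z t) (Z2 t) - ip M (Z 0) (Z2 0))"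
    using ip_diff_right[OF sqM(1,2) sqMd(1)] ip_diff_right[OF sqM(3,4) sqMd(2)] by (simp add: Z_def)
  have "ip M (Z t) (Z t) - ip M (Z 0) (Z 0) = bracket 0 t Z f g h Z1 f1 g1 h1 - bracket 0 t Z f g h Z2 f2 g2 h2"
    unfolding expand unfolding Z_def f_def g_def h_def
      product_formula_diff[OF Z1 Z2 Z1 t] product_formula_diff[OF Z1 Z2 Z2 t] ..
  also have "\<dots> = bracket 0 t Z f g h Z f g h"
  proof -
    have d: "on_strip 0 t (joint Z) = (\<lambda>p. on_strip 0 t (joint Z1) p - on_strip 0 t (joint Z2) p)"
      "on_strip 0 t (joint f) = (\<lambda>p. on_strip 0 t (joint f1) p - on_strip 0 t (joint f2) p)"
      "on_strip 0 t (joint g) = (\<lambda>p. on_strip 0 t (joint g1) p - on_strip 0 t (joint g2) p)"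
      "on_strip 0 t (joint h) = (\<lambda>p. on_strip 0 t (joint h1) p - on_strip 0 t (joint h2) p)"
      unfolding Z_def f_def g_def h_def joint_diff on_strip_diff by (rule refl)+
    have r: "ip ST q (on_strip 0 t (joint Z)) = ip ST q (on_strip 0 t (joint Z1)) - ip ST q (on_strip 0 t (joint Z2))"
      "ip ST q (on_strip 0 t (joint f)) = ip ST q (on_strip 0 t (joint f1)) - ip ST q (on_strip 0 t (joint f2))"
      "ip ST q (on_strip 0 t (joint g)) = ip ST q (on_strip 0 t (joint g1)) - ip ST q (on_strip 0 t (joint g2))"
      "ip ST q (on_strip 0 t (joint h)) = ip ST q (on_strip 0 t (joint h1)) - ip ST q (on_strip 0 t (joint h2))"
      if "sq_int ST q" for q
      unfolding d using that by (intro ip_diff_right sq_int_on_strip sq; assumption)+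
    show ?thesis
      unfolding bracket_def
      using r(2)[OF sq_int_on_strip[OF sqd(1), of 0 t]] r(1)[OF sq_int_on_strip[OF sqd(2), of 0 t]]
        r(3)[OF sq_int_on_strip[OF sqd(3), of 0 t]] r(4)[OF sq_int_on_strip[OF sqd(4), of 0 t]] by simp
  qed
  also have "\<dots> = 2 * ip ST (on_strip 0 t (joint Z)) (on_strip 0 t (joint f)) + energy 0 t g - energy 0 t h"
    unfolding bracket_def ip_commute[of ST "on_strip 0 t (joint f)"] by simp
  finally show ?thesis .
qed

end

section \<open>Uniqueness of the state\<close>

lemma norm_matrix_vector_le: "norm ((A :: real^'n^'m) *v x) \<le> onorm ((*v) A) * norm x"
  by (rule onorm[OF matrix_vector_mul_bounded_linear])

text \<open>
  With \<open>\<bar>E\<bar>\<close> the operator norm and \<open>\<delta> = (1 - \<bar>E\<bar>\<^sup>2) / 2\<close>, half of the negative term \<open>(\<bar>E\<bar>\<^sup>2 - 1) \<bar>K\<bar>\<^sup>2\<close> absorbs the cross terms in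
  \<open>\<bar>X\<bar> \<bar>K\<bar>\<close> by Young's inequality, and the other half remains.
\<close>
lemma linear_state_coercive:
  fixes A C D E :: "real^'n^'n"
  assumes E: "onorm ((*v) E) < 1"
  obtains c \<delta> where "0 \<le> c" "0 < \<delta>"
    "\<And>X K. 2 * (X \<bullet> (A *v X + C *v K)) + (norm (D *v X + E *v K))\<^sup>2 - (norm K)\<^sup>2
      \<le> c * (norm X)\<^sup>2 - \<delta> * (norm K)\<^sup>2"
proof -
  define a where "a = onorm ((*v) A)"
  define g where "g = onorm ((*v) C)"
  define d where "d = onorm ((*v) D)"
  define e where "e = onorm ((*v) E)"
  have nn: "0 \<le> a" "0 \<le> g" "0 \<le> d" "0 \<le> e"
    unfolding a_def g_def d_def e_def by (intro onorm_pos_le matrix_vector_mul_bounded_linear)+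
  define b where "b = g + d * e"
  define \<delta> where "\<delta> = (1 - e\<^sup>2) / 2"
  have "e\<^sup>2 < 1" using E nn(4) by (simp add: e_def power_less_one_iff abs_square_less_1)
  then have \<delta>: "0 < \<delta>" by (simp add: \<delta>_def)
  define c where "c = 2 * a + d\<^sup>2 + b\<^sup>2 / \<delta>"
  have "0 \<le> c" using nn \<delta> by (simp add: c_def)
  moreover have "2 * (X \<bullet> (A *v X + C *v K)) + (norm (D *v X + E *v K))\<^sup>2 - (norm K)\<^sup>2
      \<le> c * (norm X)\<^sup>2 - \<delta> * (norm K)\<^sup>2" for X K
  proof -
    define x where "x = norm X"
    define k where "k = norm K"
    have x: "0 \<le> x" and k: "0 \<le> k" by (auto simp: x_def k_def)
    have 1: "X \<bullet> (A *v X) \<le> x * (a * x)"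
      unfolding x_def a_def
      by (rule order_trans[OF norm_cauchy_schwarz mult_left_mono[OF norm_matrix_vector_le]]) simp
    have 2: "X \<bullet> (C *v K) \<le> x * (g * k)"
      unfolding x_def g_def k_def
      by (rule order_trans[OF norm_cauchy_schwarz mult_left_mono[OF norm_matrix_vector_le]]) simp
    have 3: "(norm (D *v X + E *v K))\<^sup>2 \<le> (d * x + e * k)\<^sup>2"
      unfolding x_def d_def e_def k_def
      by (rule power_mono[OF order_trans[OF norm_triangle_ineq add_mono[OF norm_matrix_vector_le norm_matrix_vector_le]]]) simp
    have 4: "2 * b * x * k \<le> b\<^sup>2 / \<delta> * x\<^sup>2 + \<delta> * k\<^sup>2"
    proof -
      have "2 * (b * x) * (\<delta> * k) \<le> (b * x)\<^sup>2 + (\<delta> * k)\<^sup>2" by (rule sum_squares_bound)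
      moreover have "(b\<^sup>2 / \<delta> * x\<^sup>2 + \<delta> * k\<^sup>2) * \<delta> = (b * x)\<^sup>2 + (\<delta> * k)\<^sup>2"
        using \<delta> by (simp add: field_simps power2_eq_square)
      ultimately have "(2 * b * x * k) * \<delta> \<le> (b\<^sup>2 / \<delta> * x\<^sup>2 + \<delta> * k\<^sup>2) * \<delta>"
        by (simp add: mult_ac)
      then show ?thesis using \<delta> by simp
    qed
    have "2 * (X \<bullet> (A *v X + C *v K)) + (norm (D *v X + E *v K))\<^sup>2 - (norm K)\<^sup>2
        \<le> 2 * (x * (a * x)) + 2 * (x * (g * k)) + (d * x + e * k)\<^sup>2 - k\<^sup>2"
      using 1 2 3 by (simp add: inner_add_right k_def)
    also have "\<dots> = 2 * (x * (a * x)) + d\<^sup>2 * x\<^sup>2 + 2 * b * x * k + e\<^sup>2 * k\<^sup>2 - k\<^sup>2"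
      by (simp add: b_def power2_eq_square algebra_simps)
    also have "\<dots> \<le> 2 * (x * (a * x)) + d\<^sup>2 * x\<^sup>2 + (b\<^sup>2 / \<delta> * x\<^sup>2 + \<delta> * k\<^sup>2) + e\<^sup>2 * k\<^sup>2 - k\<^sup>2"
      using 4 by simp
    also have "\<dots> = c * x\<^sup>2 - \<delta> * k\<^sup>2"
      by (simp add: c_def \<delta>_def power2_eq_square algebra_simps)
    finally show ?thesis by (simp only: x_def k_def)
  qed
  ultimately show ?thesis using \<delta> that by blast
qed

lemma integral_time_power:
  assumes "0 \<le> t" "t \<le> T"
  shows "integrable (time T) (\<lambda>r. indicator {0..t} r * r ^ n)"
    "(\<integral>r. indicator {0..t} r * r ^ n \<partial>time T) = t ^ Suc n / Suc n"
proof -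
  have "(\<lambda>r::real. indicator {0..T} r *\<^sub>R (indicator {0..t} r * r ^ n)) = (\<lambda>r. r ^ n * indicator {0..t} r)"
    using assms by (auto simp: indicator_def fun_eq_iff)
  moreover have "integrable lborel (\<lambda>r. r ^ n * indicator {0..t} r)"
  proof -
    have "continuous_on {0..t} (\<lambda>r::real. r ^ n)" by (intro continuous_intros)
    from borel_integrable_atLeastAtMost'[OF this] show ?thesis
      by (simp add: set_integrable_def mult.commute)
  qed
  ultimately show "integrable (time T) (\<lambda>r. indicator {0..t} r * r ^ n)"
    "(\<integral>r. indicator {0..t} r * r ^ n \<partial>time T) = t ^ Suc n / Suc n"
    using assms by (simp_all add: integrable_restrict_space integral_restrict_space integral_power)
qed

text \<open>
  Iterating the bound shows that the integral up to \<open>t\<close> is at most \<open>(c t)\<^sup>n / n!\<close> times the one up to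
  \<open>T\<close>, for every \<open>n\<close>.
\<close>
lemma Gronwall_zero:
  fixes \<phi> :: "real \<Rightarrow> real"
  assumes int: "integrable (time T) \<phi>" and c: "0 \<le> c"
    and nonneg: "\<And>r. 0 \<le> r \<Longrightarrow> r \<le> T \<Longrightarrow> 0 \<le> \<phi> r"
    and bound: "\<And>r. 0 \<le> r \<Longrightarrow> r \<le> T \<Longrightarrow> \<phi> r \<le> c * (\<integral>q. indicator {0<..r} q * \<phi> q \<partial>time T)"
    and t: "0 \<le> t" "t \<le> T"
  shows "(\<integral>q. indicator {0<..t} q * \<phi> q \<partial>time T) = 0"
proof -
  define \<psi> where "\<psi> r = (\<integral>q. indicator {0<..r} q * \<phi> q \<partial>time T)" for r
  have i: "integrable (time T) (\<lambda>q. indicator {0<..r} q * \<phi> q)" for r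
  proof (rule Bochner_Integration.integrable_bound[OF int])
    show "(\<lambda>q. indicator {0<..r} q * \<phi> q) \<in> borel_measurable (time T)"
      by (rule borel_measurable_times[OF measurable_restrict_space1 borel_measurable_integrable[OF int]]) simp
  qed (auto simp: indicator_def)
  have nn: "0 \<le> \<phi> q" if "q \<in> space (time T)" for q
    using that nonneg by (auto simp: space_restrict_space)
  have "\<psi> r \<le> \<psi> T * (c * r) ^ n / fact n" if "0 \<le> r" "r \<le> T" for r n
    using that
  proof (induction n arbitrary: r)
    case 0
    have "\<psi> r \<le> \<psi> T"
      unfolding \<psi>_def using nn 0 by (intro integral_mono i) (auto simp: indicator_def)
    then show ?case by simp
  next
    case (Suc n)
    define k where "k = c * (\<psi> T * c ^ n / fact n)"
    have "\<psi> r \<le> (\<integral>q. k * (indicator {0..r} q * q ^ n) \<partial>time T)"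
      unfolding \<psi>_def
    proof (rule integral_mono[OF i])
      show "integrable (time T) (\<lambda>q. k * (indicator {0..r} q * q ^ n))"
        using integral_time_power(1)[OF Suc.prems] by simp
      fix q assume "q \<in> space (time T)"
      then have q: "0 \<le> q" "q \<le> T" by (auto simp: space_restrict_space)
      have "\<phi> q \<le> c * \<psi> q" using bound[OF q] by (simp add: \<psi>_def)
      also have "\<dots> \<le> c * (\<psi> T * (c * q) ^ n / fact n)"
        using Suc.IH[OF q] c by (rule mult_left_mono)
      also have "\<dots> = k * q ^ n" by (simp add: k_def power_mult_distrib)
      finally have le: "\<phi> q \<le> k * q ^ n" .
      have "0 \<le> k * q ^ n" using le nonneg[OF q] by linarith
      then show "indicator {0<..r} q * \<phi> q \<le> k * (indicator {0..r} q * q ^ n)"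
        using le by (auto simp: indicator_def)
    qed
    also have "\<dots> = k * (r ^ Suc n / Suc n)"
      using integral_time_power(2)[OF Suc.prems] by simp
    also have "\<dots> = \<psi> T * (c * r) ^ Suc n / fact (Suc n)"
      by (simp add: k_def power_mult_distrib field_simps)
    finally show ?case .
  qed
  from this[OF t] have "\<psi> t \<le> \<psi> T * (inverse (fact n) * (c * t) ^ n)" for n
    by (simp add: divide_inverse mult_ac)
  moreover have "(\<lambda>n. \<psi> T * (inverse (fact n) * (c * t) ^ n)) \<longlonglongrightarrow> \<psi> T * 0"
    by (intro tendsto_mult tendsto_const summable_LIMSEQ_zero[OF summable_exp])
  ultimately have "\<psi> t \<le> \<psi> T * 0" by (intro LIMSEQ_le_const) auto
  moreover have "0 \<le> \<psi> t"
    unfolding \<psi>_def using nn by (intro integral_nonneg_AE AE_I2) (auto simp: indicator_def)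
  ultimately show ?thesis by (simp add: \<psi>_def)
qed

lemma ip_self_zero:
  assumes "sq_int N f" "ip N f f = 0"
  shows "AE x in N. f x = 0"
proof -
  have "AE x in N. (norm (f x))\<^sup>2 = 0"
    using integral_nonneg_eq_0_iff_AE[OF sq_int_norm[OF assms(1)]] assms(2) by (simp add: ip_self)
  then show ?thesis by simp
qed

context ds_basis
begin

lemma energy_eq_time_integral:
  fixes Z :: "real \<Rightarrow> 'a \<Rightarrow> 'b::euclidean_space"
  assumes Z: "sq_int ST (joint Z)"
  shows "integrable (time T) (\<lambda>r. ip M (Z r) (Z r))"
    "energy 0 t Z = (\<integral>r. indicator {0<..t} r * ip M (Z r) (Z r) \<partial>time T)"
proof -
  interpret P: pair_sigma_finite M "time T"
    by (rule pair_sigma_finite_time) (rule WN.prob_space_axioms)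
  have i0: "integrable (M \<Otimes>\<^sub>M time T) (\<lambda>(\<omega>, r). (norm (Z r \<omega>))\<^sup>2)"
    using sq_int_norm[OF Z] by (simp add: state_time_def split_beta' joint_def)
  show "integrable (time T) (\<lambda>r. ip M (Z r) (Z r))"
    unfolding ip_self by (rule P.integrable_snd[OF i0])
  have i: "integrable (M \<Otimes>\<^sub>M time T) (\<lambda>(\<omega>, r). (norm (on_strip 0 t (joint Z) (\<omega>, r)))\<^sup>2)"
    using sq_int_norm[OF sq_int_on_strip[OF Z]] by (simp add: state_time_def split_beta')
  have "energy 0 t Z = (\<integral>r. (\<integral>\<omega>. (norm (on_strip 0 t (joint Z) (\<omega>, r)))\<^sup>2 \<partial>M) \<partial>time T)"
    unfolding ip_self using P.integral_snd[OF i] by (simp add: state_time_def split_beta')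
  also have "\<dots> = (\<integral>r. indicator {0<..t} r * ip M (Z r) (Z r) \<partial>time T)"
  proof (rule Bochner_Integration.integral_cong[OF refl])
    fix r
    have "on_strip 0 t (joint Z) (\<omega>, r) = indicator {0<..t} r *\<^sub>R Z r \<omega>" for \<omega>
      unfolding on_strip_def indicator_strip joint_def by simp
    then show "(\<integral>\<omega>. (norm (on_strip 0 t (joint Z) (\<omega>, r)))\<^sup>2 \<partial>M) = indicator {0<..t} r * ip M (Z r) (Z r)"
      by (cases "r \<in> {0<..t}") (simp_all add: ip_self)
  qed
  finally show "energy 0 t Z = (\<integral>r. indicator {0<..t} r * ip M (Z r) (Z r) \<partial>time T)" .
qed

text \<open>
  By \<open>linear_state_coercive\<close> the product formula for the square of the difference \<open>X\<close> bounds the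
  expectation of \<open>\<bar>X\<^sub>t\<bar>\<^sup>2\<close> plus \<open>\<delta>\<close> times the energy of \<open>K\<close> up to \<open>t\<close> by \<open>c\<close> times the energy of \<open>X\<close>
  up to \<open>t\<close>. Gronwall's argument makes the bound vanish, and then both nonnegative terms vanish at \<open>T\<close>.
\<close>
lemma linear_state_unique:
  fixes x1 x2 k1 k2 :: "real \<Rightarrow> 'a \<Rightarrow> real^'n" and A C D E :: "real^'n^'n"
  assumes E: "onorm ((*v) E) < 1"
    and x1: "ds_process x1 f1 g1 h1" and x2: "ds_process x2 f2 g2 h2"
    and k: "sq_int ST (joint k1)" "sq_int ST (joint k2)"
    and f: "\<And>t \<omega>. 0 \<le> t \<Longrightarrow> t \<le> T \<Longrightarrow> process_diff f1 f2 t \<omega> = A *v process_diff x1 x2 t \<omega> + C *v process_diff k1 k2 t \<omega>"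
    and g: "\<And>t \<omega>. 0 \<le> t \<Longrightarrow> t \<le> T \<Longrightarrow> process_diff g1 g2 t \<omega> = D *v process_diff x1 x2 t \<omega> + E *v process_diff k1 k2 t \<omega>"
    and h: "\<And>t \<omega>. 0 \<le> t \<Longrightarrow> t \<le> T \<Longrightarrow> process_diff h1 h2 t \<omega> = - process_diff k1 k2 t \<omega>"
    and init: "AE \<omega> in M. x1 0 \<omega> = x2 0 \<omega>"
  shows "AE p in ST. joint x1 p = joint x2 p" "AE p in ST. joint k1 p = joint k2 p"
    "AE \<omega> in M. x1 T \<omega> = x2 T \<omega>"
proof -
  obtain c \<delta> where c: "0 \<le> c" and \<delta>: "0 < \<delta>" and coercive:
    "\<And>X K. 2 * (X \<bullet> (A *v X + C *v K)) + (norm (D *v X + E *v K))\<^sup>2 - (norm K)\<^sup>2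
      \<le> c * (norm X)\<^sup>2 - \<delta> * (norm K)\<^sup>2"
    using linear_state_coercive[OF E] by blast
  define X where "X = process_diff x1 x2"
  define K where "K = process_diff k1 k2"
  define F where "F = process_diff f1 f2"
  define G where "G = process_diff g1 g2"
  define H where "H = process_diff h1 h2"
  have sq: "sq_int ST (joint x1)" "sq_int ST (joint f1)" "sq_int ST (joint g1)" "sq_int ST (joint h1)"
    "sq_int ST (joint x2)" "sq_int ST (joint f2)" "sq_int ST (joint g2)" "sq_int ST (joint h2)"
    using x1 x2 by (auto simp: ds_process_def)
  have sX: "sq_int ST (joint X)" and sK: "sq_int ST (joint K)" and sF: "sq_int ST (joint F)"
    and sG: "sq_int ST (joint G)" and sH: "sq_int ST (joint H)"
    unfolding X_def K_def F_def G_def H_def joint_diff by (intro sq_int_diff sq k)+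
  have T0: "0 \<le> T" "T \<le> T" "0 \<le> (0::real)" using T_pos by auto
  have sXt: "sq_int M (X t)" if "0 \<le> t" "t \<le> T" for t
    unfolding X_def by (intro sq_int_diff ds_process_sq_int[OF x1 that] ds_process_sq_int[OF x2 that])
  have X0: "ip M (X 0) (X 0) = 0"
  proof -
    have "ip M (X 0) (X 0) = ip M (\<lambda>_. 0) (\<lambda>_. 0 :: real^'n)"
      using init by (intro ip_cong_AE sq_int_measurable[OF sXt[OF T0(3,1)]]) (auto simp: X_def)
    then show ?thesis by (simp add: ip_def)
  qed
  have est: "ip M (X t) (X t) \<le> c * energy 0 t X - \<delta> * energy 0 t K" if t: "0 \<le> t" "t \<le> T" for t
  proof -
    have i: "integrable ST (\<lambda>p. on_strip 0 t (joint U) p \<bullet> on_strip 0 t (joint V) p)"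
      if "sq_int ST (joint U)" "sq_int ST (joint V)" for U V :: "real \<Rightarrow> 'a \<Rightarrow> real^'n"
      using that by (intro sq_int_integrable_inner sq_int_on_strip)
    have "ip M (X t) (X t) = 2 * ip ST (on_strip 0 t (joint X)) (on_strip 0 t (joint F)) + energy 0 t G - energy 0 t H"
      using energy_formula_diff[OF x1 x2 t] X0 by (simp add: X_def F_def G_def H_def)
    also have "\<dots> = (\<integral>p. 2 * (on_strip 0 t (joint X) p \<bullet> on_strip 0 t (joint F) p) + on_strip 0 t (joint G) p \<bullet> on_strip 0 t (joint G) p
        - on_strip 0 t (joint H) p \<bullet> on_strip 0 t (joint H) p \<partial>ST)"
      unfolding ip_def using i[OF sX sF] i[OF sG sG] i[OF sH sH] by simp
    also have "\<dots> \<le> (\<integral>p. c * (on_strip 0 t (joint X) p \<bullet> on_strip 0 t (joint X) p) - \<delta> * (on_strip 0 t (joint K) p \<bullet> on_strip 0 t (joint K) p) \<partial>ST)"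
    proof (rule integral_mono)
      show "integrable ST (\<lambda>p. 2 * (on_strip 0 t (joint X) p \<bullet> on_strip 0 t (joint F) p) + on_strip 0 t (joint G) p \<bullet> on_strip 0 t (joint G) p
        - on_strip 0 t (joint H) p \<bullet> on_strip 0 t (joint H) p)"
        using i[OF sX sF] i[OF sG sG] i[OF sH sH] by simp
      show "integrable ST (\<lambda>p. c * (on_strip 0 t (joint X) p \<bullet> on_strip 0 t (joint X) p) - \<delta> * (on_strip 0 t (joint K) p \<bullet> on_strip 0 t (joint K) p))"
        using i[OF sX sX] i[OF sK sK] by simp
      fix p assume "p \<in> space ST"
      then obtain \<omega> r where p: "p = (\<omega>, r)" "0 \<le> r" "r \<le> T" by (auto simp: space_state_time)
      have FGH: "joint F p = A *v joint X p + C *v joint K p" "joint G p = D *v joint X p + E *v joint K p"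
        "joint H p = - joint K p"
        using f[OF p(2,3)] g[OF p(2,3)] h[OF p(2,3)]
        by (simp_all only: joint_def F_def G_def H_def X_def K_def p fst_conv snd_conv)
      have "indicator (strip 0 t) p * (2 * (joint X p \<bullet> joint F p) + joint G p \<bullet> joint G p - joint H p \<bullet> joint H p)
          \<le> indicator (strip 0 t) p * (c * (joint X p \<bullet> joint X p) - \<delta> * (joint K p \<bullet> joint K p))"
        using coercive[of "joint X p" "joint K p"] unfolding FGH
        by (intro mult_left_mono) (simp_all add: power2_norm_eq_inner)
      then show "2 * (on_strip 0 t (joint X) p \<bullet> on_strip 0 t (joint F) p) + on_strip 0 t (joint G) p \<bullet> on_strip 0 t (joint G) p
        - on_strip 0 t (joint H) p \<bullet> on_strip 0 t (joint H) p
        \<le> c * (on_strip 0 t (joint X) p \<bullet> on_strip 0 t (joint X) p) - \<delta> * (on_strip 0 t (joint K) p \<bullet> on_strip 0 t (joint K) p)"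
        unfolding on_strip_inner by (simp add: algebra_simps)
    qed
    also have "\<dots> = c * energy 0 t X - \<delta> * energy 0 t K"
      unfolding ip_def using i[OF sX sX] i[OF sK sK] by simp
    finally show ?thesis .
  qed
  have est': "ip M (X t) (X t) \<le> c * energy 0 t X" if "0 \<le> t" "t \<le> T" for t
  proof -
    have "0 \<le> \<delta> * energy 0 t K" using \<delta> ip_nonneg by (intro mult_nonneg_nonneg) auto
    then show ?thesis using est[OF that] by linarith
  qed
  have EX: "energy 0 T X = 0"
    unfolding energy_eq_time_integral(2)[OF sX]
    by (rule Gronwall_zero[OF energy_eq_time_integral(1)[OF sX] c ip_nonneg _ T0(1,2)])
       (use est' in \<open>simp add: energy_eq_time_integral(2)[OF sX]\<close>)
  have "ip M (X T) (X T) + \<delta> * energy 0 T K \<le> 0"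
    using est[OF T0(1,2)] EX by simp
  moreover have "0 \<le> ip M (X T) (X T)" "0 \<le> \<delta> * energy 0 T K"
    using \<delta> ip_nonneg[of M "X T"] ip_nonneg[of ST "on_strip 0 T (joint K)"] by auto
  ultimately have XT: "ip M (X T) (X T) = 0" and "\<delta> * energy 0 T K = 0" by linarith+
  then have EK: "energy 0 T K = 0" using \<delta> by simp
  have whole: "ip ST (joint X) (joint X) = 0" "ip ST (joint K) (joint K) = 0"
    using EX EK ip_on_strip_whole[OF T_pos sX sX WN.prob_space_axioms] ip_on_strip_whole[OF T_pos sK sK WN.prob_space_axioms]
    by (simp_all only:)
  show "AE p in ST. joint x1 p = joint x2 p"
    using ip_self_zero[OF sX whole(1)] by (simp add: X_def joint_diff)
  show "AE p in ST. joint k1 p = joint k2 p"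
    using ip_self_zero[OF sK whole(2)] by (simp add: K_def joint_diff)
  show "AE \<omega> in M. x1 T \<omega> = x2 T \<omega>"
    using ip_self_zero[OF sXt[OF T0(1,2)] XT] by (simp add: X_def)
qed

end

section \<open>Measurability and cost on the product space\<close>

context ds_basis
begin

lemma joint_measurable:
  assumes "(\<lambda>(\<omega>, s). X s \<omega>) \<in> borel_measurable (M \<Otimes>\<^sub>M restrict_space borel {0..T})"
  shows "joint X \<in> borel_measurable ST"
proof -
  have "(\<lambda>(\<omega>, s). X s \<omega>) = joint X" by (simp add: joint_def fun_eq_iff)
  then show ?thesis
    using assms by (simp add: measurable_cong_sets[OF sets_state_time refl])
qed

lemma square_integrable_process_iff:
  assumes "joint X \<in> borel_measurable ST"
  shows "square_integrable_process M T X \<longleftrightarrow> sq_int ST (joint X)"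
proof -
  have "(\<lambda>p. ennreal ((norm (joint X p))\<^sup>2)) \<in> borel_measurable ST"
    using assms by measurable
  then show ?thesis
    unfolding square_integrable_process_def sq_int_iff_nn[OF assms]
    by (subst WN.nn_integral_state_time) (simp_all add: joint_def)
qed

text \<open>The condition at \<open>t = T\<close> already gives measurability on the whole product.\<close>
lemma progressive_joint_measurable:
  fixes X :: "real \<Rightarrow> 'a \<Rightarrow> 'b::euclidean_space"
  assumes "progressive_process M T W B X"
  shows "joint X \<in> borel_measurable ST"
proof (rule joint_measurable)
  have T: "0 \<le> T" "T \<le> T" using T_pos by auto
  have "(\<lambda>(\<omega>, s). X s \<omega>) \<in> borel_measurable (info M W B T T 0 \<Otimes>\<^sub>M restrict_space borel {0..T})"
    using assms T unfolding progressive_process_def by auto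
  moreover have "(\<lambda>p. p) \<in> measurable (M \<Otimes>\<^sub>M restrict_space borel {0..T}) (info M W B T T 0 \<Otimes>\<^sub>M restrict_space borel {0..T})"
  proof (rule measurable_pair)
    have "(\<lambda>\<omega>. \<omega>) \<in> measurable M (info M W B T T 0)"
    proof (rule measurableI)
      have "subalgebra M (info M W B T T 0)" by (rule WN.K_subalg[of T T]) (use T in auto)
      then show "(\<lambda>\<omega>. \<omega>) -` A \<inter> space M \<in> sets M" if "A \<in> sets (info M W B T T 0)" for A
        using that sets.sets_into_space[of A M] by (auto simp: subalgebra_def Int_absorb2)
    qed simp
    then show "fst \<circ> (\<lambda>p. p) \<in> measurable (M \<Otimes>\<^sub>M restrict_space borel {0..T}) (info M W B T T 0)"
      using measurable_compose[OF measurable_fst] by (simp add: comp_def)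
    show "snd \<circ> (\<lambda>p. p) \<in> measurable (M \<Otimes>\<^sub>M restrict_space borel {0..T}) (restrict_space borel {0..T})"
      by (simp add: comp_def)
  qed
  ultimately show "(\<lambda>(\<omega>, s). X s \<omega>) \<in> borel_measurable (M \<Otimes>\<^sub>M restrict_space borel {0..T})"
    by (rule measurable_compose[rotated])
qed

lemma M2_sq_int:
  assumes "X \<in> M2 M T W B"
  shows "sq_int ST (joint X)"
proof -
  have "progressive_process M T W B X" "square_integrable_process M T X"
    using assms by (simp_all add: M2_def)
  then show ?thesis by (simp add: square_integrable_process_iff[OF progressive_joint_measurable])
qed

lemma M2_adapted:
  assumes "X \<in> M2 M T W B" "0 \<le> t" "t \<le> T"
  shows "X t \<in> borel_measurable (info M W B T t t)"
  using assms by (auto simp: M2_def progressive_process_def)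

lemma source_sq_int:
  assumes "adapted_process M T W B \<alpha>" "square_integrable_process M T \<alpha>"
  shows "sq_int ST (joint \<alpha>)"
proof -
  have "joint \<alpha> \<in> borel_measurable ST"
    by (rule joint_measurable) (use assms(1) in \<open>simp add: adapted_process_def\<close>)
  then show ?thesis using assms(2) square_integrable_process_iff by blast
qed

lemma M2_linear:
  fixes y :: "real \<Rightarrow> 'a \<Rightarrow> 'b::euclidean_space" and u :: "real \<Rightarrow> 'a \<Rightarrow> 'c::euclidean_space"
  assumes y: "y \<in> M2 M T W B" and L: "bounded_linear L"
    and u: "\<And>t \<omega>. t \<in> {0..T} \<Longrightarrow> u t \<omega> = L (y t \<omega>)"
  shows "u \<in> M2 M T W B"
proof -
  have [measurable]: "L \<in> borel_measurable borel"
    using L by (simp add: borel_measurable_continuous_onI linear_continuous_on)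
  have prog: "progressive_process M T W B u"
    unfolding progressive_process_def
  proof (intro ballI conjI)
    fix t assume t: "t \<in> {0..T}"
    have P: "(\<lambda>(\<omega>, s). y s \<omega>) \<in> borel_measurable (info M W B T t 0 \<Otimes>\<^sub>M restrict_space borel {0..t})"
      "(\<lambda>(\<omega>, s). y s \<omega>) \<in> borel_measurable (info M W B T T t \<Otimes>\<^sub>M restrict_space borel {t..T})"
      "y t \<in> borel_measurable (info M W B T t t)"
      using y t by (auto simp: M2_def progressive_process_def)
    have "(\<lambda>p. L (case p of (\<omega>, s) \<Rightarrow> y s \<omega>)) \<in> borel_measurable (info M W B T t 0 \<Otimes>\<^sub>M restrict_space borel {0..t})"
      using P(1) by measurable
    then show "(\<lambda>(\<omega>, s). u s \<omega>) \<in> borel_measurable (info M W B T t 0 \<Otimes>\<^sub>M restrict_space borel {0..t})"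
      by (subst measurable_cong[where g="\<lambda>p. L (case p of (\<omega>, s) \<Rightarrow> y s \<omega>)"])
         (use t u in \<open>auto simp: space_pair_measure space_restrict_space\<close>)
    have "(\<lambda>p. L (case p of (\<omega>, s) \<Rightarrow> y s \<omega>)) \<in> borel_measurable (info M W B T T t \<Otimes>\<^sub>M restrict_space borel {t..T})"
      using P(2) by measurable
    then show "(\<lambda>(\<omega>, s). u s \<omega>) \<in> borel_measurable (info M W B T T t \<Otimes>\<^sub>M restrict_space borel {t..T})"
      by (subst measurable_cong[where g="\<lambda>p. L (case p of (\<omega>, s) \<Rightarrow> y s \<omega>)"])
         (use t u in \<open>auto simp: space_pair_measure space_restrict_space\<close>)
    have "u t = (\<lambda>\<omega>. L (y t \<omega>))" using u[OF t] by auto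
    then show "u t \<in> borel_measurable (info M W B T t t)"
      using P(3) by simp
  qed
  note m = progressive_joint_measurable[OF prog]
  obtain c where c: "\<And>x. norm (L x) \<le> norm x * c"
    using bounded_linear.bounded[OF L] by auto
  have "sq_int ST (joint u)"
  proof (rule sq_int_bound[OF M2_sq_int[OF y] m, where c=c], rule AE_I2)
    fix p assume "p \<in> space ST"
    then have "snd p \<in> {0..T}" by (auto simp: space_state_time)
    then show "norm (joint u p) \<le> c * norm (joint y p)"
      using c u by (simp add: joint_def mult.commute[of c])
  qed
  then show ?thesis
    using prog square_integrable_process_iff[OF m] by (simp add: M2_def)
qed

lemma has_ds_differential_cong:
  assumes "\<And>t \<omega>. t \<in> {0..T} \<Longrightarrow> f t \<omega> = f' t \<omega>"
    and "has_ds_differential M T W B Z f g h"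
  shows "has_ds_differential M T W B Z f' g h"
proof -
  have "(LINT s:{0..t}|lborel. f s \<omega>) = (LINT s:{0..t}|lborel. f' s \<omega>)" if "t \<in> {0..T}" for t \<omega>
    using assms(1) that by (intro set_lebesgue_integral_cong) auto
  then show ?thesis using assms(2) unfolding has_ds_differential_def by simp
qed

text \<open>Fubini's theorem, in a form in which the four terms of the cost can be compared separately.\<close>
lemma lq_cost_eq:
  fixes x k :: "real \<Rightarrow> 'a \<Rightarrow> real^'n" and w :: "real \<Rightarrow> 'a \<Rightarrow> real^'k"
  assumes x: "sq_int ST (joint x)" and k: "sq_int ST (joint k)" and w: "sq_int ST (joint w)" and xT: "sq_int M (x T)"
  shows "lq_cost M T R N P Q x k w = 1 / 2 *
    (ip ST (\<lambda>p. R *v joint x p) (joint x) + ip ST (\<lambda>p. N *v joint w p) (joint w)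
      + ip ST (\<lambda>p. P *v joint k p) (joint k) + ip M (\<lambda>\<omega>. Q *v x T \<omega>) (x T))"
proof -
  interpret P: pair_sigma_finite M "time T"
    by (rule pair_sigma_finite_time) (rule WN.prob_space_axioms)
  let ?q = "\<lambda>p. (R *v joint x p) \<bullet> joint x p + (N *v joint w p) \<bullet> joint w p + (P *v joint k p) \<bullet> joint k p"
  have i: "integrable ST (\<lambda>p. (R *v joint x p) \<bullet> joint x p)" "integrable ST (\<lambda>p. (N *v joint w p) \<bullet> joint w p)"
    "integrable ST (\<lambda>p. (P *v joint k p) \<bullet> joint k p)"
    by (intro sq_int_integrable_inner sq_int_mult_vec x k w)+
  have iQ: "integrable M (\<lambda>\<omega>. (Q *v x T \<omega>) \<bullet> x T \<omega>)"
    by (intro sq_int_integrable_inner sq_int_mult_vec xT)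
  have iq: "integrable (M \<Otimes>\<^sub>M time T) ?q" using i by (simp add: state_time_def)
  have lint: "(LINT t:{0..T}|lborel. (R *v x t \<omega>) \<bullet> x t \<omega> + (N *v w t \<omega>) \<bullet> w t \<omega> + (P *v k t \<omega>) \<bullet> k t \<omega>)
      = (\<integral>t. ?q (\<omega>, t) \<partial>time T)" for \<omega>
    unfolding set_lebesgue_integral_def by (subst integral_restrict_space) (simp_all add: joint_def)
  have "lq_cost M T R N P Q x k w
      = 1 / 2 * ((\<integral>\<omega>. (\<integral>t. ?q (\<omega>, t) \<partial>time T) \<partial>M) + ip M (\<lambda>\<omega>. Q *v x T \<omega>) (x T))"
    unfolding lq_cost_def lint ip_def using P.integrable_fst'[OF iq] iQ by simp
  also have "(\<integral>\<omega>. (\<integral>t. ?q (\<omega>, t) \<partial>time T) \<partial>M) = (\<integral>p. ?q p \<partial>ST)"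
    using P.integral_fst'[OF iq] by (simp add: state_time_def)
  also have "\<dots> = ip ST (\<lambda>p. R *v joint x p) (joint x) + ip ST (\<lambda>p. N *v joint w p) (joint w)
      + ip ST (\<lambda>p. P *v joint k p) (joint k)"
    unfolding ip_def using i by simp
  finally show ?thesis .
qed

end

section \<open>Duality and the equilibrium\<close>

lemma inner_transpose: "((S :: real^'n^'m) *v a) \<bullet> b = a \<bullet> (transpose S *v b)"
  using dot_lmul_matrix[of a "transpose S" b] by (simp add: vector_transpose_matrix)

text \<open>A convex quadratic form lies above its tangent at \<open>g\<close>; the gap is the form at \<open>f - g\<close>.\<close>
lemma quadratic_form_tangent:
  fixes S :: "real^'n^'n"
  assumes S: "transpose S = S" "\<And>z. 0 \<le> (S *v z) \<bullet> z"
    and f: "sq_int N f" and g: "sq_int N g"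
  shows "2 * ip N (\<lambda>p. S *v g p) (\<lambda>p. f p - g p) \<le> ip N (\<lambda>p. S *v f p) f - ip N (\<lambda>p. S *v g p) g"
proof -
  have "0 \<le> (\<integral>p. (S *v (f p - g p)) \<bullet> (f p - g p) \<partial>N)"
    by (intro integral_nonneg_AE AE_I2 S(2))
  also have "\<dots> = (\<integral>p. (S *v f p) \<bullet> f p - (S *v g p) \<bullet> g p - 2 * ((S *v g p) \<bullet> (f p - g p)) \<partial>N)"
  proof (rule Bochner_Integration.integral_cong[OF refl])
    fix p
    have "(S *v f p) \<bullet> g p = (S *v g p) \<bullet> f p"
      using inner_transpose[of S "f p" "g p"] S(1) by (simp add: inner_commute)
    then show "(S *v (f p - g p)) \<bullet> (f p - g p) = (S *v f p) \<bullet> f p - (S *v g p) \<bullet> g p - 2 * ((S *v g p) \<bullet> (f p - g p))"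
      by (simp add: matrix_vector_mult_diff_distrib inner_diff_left inner_diff_right)
  qed
  also have "\<dots> = ip N (\<lambda>p. S *v f p) f - ip N (\<lambda>p. S *v g p) g - 2 * ip N (\<lambda>p. S *v g p) (\<lambda>p. f p - g p)"
    unfolding ip_def
    using sq_int_integrable_inner[OF sq_int_mult_vec[OF f, of S] f]
      sq_int_integrable_inner[OF sq_int_mult_vec[OF g, of S] g]
      sq_int_integrable_inner[OF sq_int_mult_vec[OF g, of S] sq_int_diff[OF f g]]
    by simp
  finally show ?thesis by simp
qed

context ds_basis
begin

text \<open>
  In the bracket of \<open>X\<close> and \<open>y\<close> the matrices \<open>A\<close>, \<open>C\<close>, \<open>D\<close> and \<open>E\<close> meet their transposes and
  cancel. For \<open>C\<close> and \<open>E\<close> this uses that \<open>-K\<close>, the backward coefficient of \<open>X\<close>, enters the bracket with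
  a minus sign.
\<close>
lemma adjoint_duality:
  fixes x1 x2 k1 k2 y h r q b :: "real \<Rightarrow> 'a \<Rightarrow> real^'n" and A C D E :: "real^'n^'n"
  assumes x1: "ds_process x1 f1 g1 h1" and x2: "ds_process x2 f2 g2 h2"
    and y: "ds_process y (\<lambda>t \<omega>. - (transpose A *v y t \<omega> + transpose D *v h t \<omega> + r t \<omega>)) h
      (\<lambda>t \<omega>. - (transpose C *v y t \<omega> + transpose E *v h t \<omega> + q t \<omega>))"
    and init: "AE \<omega> in M. x1 0 \<omega> = x2 0 \<omega>"
    and f: "\<And>t \<omega>. process_diff f1 f2 t \<omega> = A *v process_diff x1 x2 t \<omega> + b t \<omega> + C *v process_diff k1 k2 t \<omega>"
    and g: "\<And>t \<omega>. process_diff g1 g2 t \<omega> = D *v process_diff x1 x2 t \<omega> + E *v process_diff k1 k2 t \<omega>"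
    and h: "\<And>t \<omega>. process_diff h1 h2 t \<omega> = - process_diff k1 k2 t \<omega>"
    and sq: "sq_int ST (joint b)" "sq_int ST (joint r)" "sq_int ST (joint q)"
      "sq_int ST (joint k1)" "sq_int ST (joint k2)"
  shows "ip M (process_diff x1 x2 T) (y T) = ip ST (joint b) (joint y)
    - ip ST (joint (process_diff x1 x2)) (joint r) - ip ST (joint (process_diff k1 k2)) (joint q)"
proof -
  define X where "X = process_diff x1 x2"
  define K where "K = process_diff k1 k2"
  define F where "F = process_diff f1 f2"
  define G where "G = process_diff g1 g2"
  define H where "H = process_diff h1 h2"
  define fy where "fy = (\<lambda>t \<omega>. - (transpose A *v y t \<omega> + transpose D *v h t \<omega> + r t \<omega>))"
  define hy where "hy = (\<lambda>t \<omega>. - (transpose C *v y t \<omega> + transpose E *v h t \<omega> + q t \<omega>))"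
  have y': "ds_process y fy h hy" using y by (simp add: fy_def hy_def)
  have sqs: "sq_int ST (joint x1)" "sq_int ST (joint f1)" "sq_int ST (joint g1)" "sq_int ST (joint h1)"
    "sq_int ST (joint x2)" "sq_int ST (joint f2)" "sq_int ST (joint g2)" "sq_int ST (joint h2)"
    "sq_int ST (joint y)" "sq_int ST (joint fy)" "sq_int ST (joint h)" "sq_int ST (joint hy)"
    using x1 x2 y' by (auto simp: ds_process_def)
  have sX: "sq_int ST (joint X)" and sK: "sq_int ST (joint K)" and sF: "sq_int ST (joint F)"
    and sG: "sq_int ST (joint G)" and sH: "sq_int ST (joint H)"
    unfolding X_def K_def F_def G_def H_def joint_diff by (intro sq_int_diff sqs sq)+
  have T0: "0 \<le> T" "T \<le> T" "0 \<le> (0::real)" using T_pos by auto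
  have "ip M (X 0) (y 0) = ip M (\<lambda>_. 0) (y 0)"
    using init unfolding X_def
    by (intro ip_cong_AE sq_int_measurable sq_int_diff ds_process_sq_int[OF x1 T0(3,1)]
        ds_process_sq_int[OF x2 T0(3,1)] ds_process_sq_int[OF y T0(3,1)]) (auto simp: sq_int_def)
  then have X0: "ip M (X 0) (y 0) = 0" by (simp add: ip_def)
  note whole = ip_on_strip_whole[OF T_pos _ _ WN.prob_space_axioms]
  have "ip M (X T) (y T) = bracket 0 T X F G H y fy h hy"
    using product_formula_diff[OF x1 x2 y' T0(1,2)] X0 by (simp add: X_def F_def G_def H_def)
  also have "\<dots> = ip ST (joint X) (joint fy) + ip ST (joint F) (joint y) + ip ST (joint G) (joint h)
      - ip ST (joint H) (joint hy)"
    unfolding bracket_def whole[OF sX sqs(10)] whole[OF sF sqs(9)] whole[OF sG sqs(11)] whole[OF sH sqs(12)] ..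
  also have "\<dots> = (\<integral>p. joint X p \<bullet> joint fy p + joint F p \<bullet> joint y p + joint G p \<bullet> joint h p
      - joint H p \<bullet> joint hy p \<partial>ST)"
    unfolding ip_def
    using sq_int_integrable_inner[OF sX sqs(10)] sq_int_integrable_inner[OF sF sqs(9)]
      sq_int_integrable_inner[OF sG sqs(11)] sq_int_integrable_inner[OF sH sqs(12)] by simp
  also have "\<dots> = (\<integral>p. joint b p \<bullet> joint y p - joint X p \<bullet> joint r p - joint K p \<bullet> joint q p \<partial>ST)"
  proof (rule Bochner_Integration.integral_cong[OF refl])
    fix p
    have FGH: "joint F p = A *v joint X p + joint b p + C *v joint K p"
      "joint G p = D *v joint X p + E *v joint K p" "joint H p = - joint K p"
      unfolding joint_def F_def G_def H_def X_def K_def by (rule f g h)+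
    have "joint fy p = - (transpose A *v joint y p + transpose D *v joint h p + joint r p)"
      "joint hy p = - (transpose C *v joint y p + transpose E *v joint h p + joint q p)"
      by (simp_all add: joint_def fy_def hy_def)
    then show "joint X p \<bullet> joint fy p + joint F p \<bullet> joint y p + joint G p \<bullet> joint h p - joint H p \<bullet> joint hy p
        = joint b p \<bullet> joint y p - joint X p \<bullet> joint r p - joint K p \<bullet> joint q p"
      unfolding FGH
      by (simp add: inner_add_left inner_add_right inner_diff_right inner_transpose[of A] inner_transpose[of C]
          inner_transpose[of D] inner_transpose[of E])
  qed
  also have "\<dots> = ip ST (joint b) (joint y) - ip ST (joint X) (joint r) - ip ST (joint K) (joint q)"
    unfolding ip_def
    using sq_int_integrable_inner[OF sq(1) sqs(9)] sq_int_integrable_inner[OF sX sq(2)]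
      sq_int_integrable_inner[OF sK sq(3)] by simp
  finally show ?thesis by (simp add: X_def K_def)
qed

text \<open>Brings states into the form on which the product formula operates.\<close>
lemma state_ds_process:
  fixes x k :: "real \<Rightarrow> 'a \<Rightarrow> real^'n" and Bc :: "player \<Rightarrow> real^'k^'n"
  assumes state: "is_state M T W B A Bc C D E \<alpha> \<beta> a v x k"
    and v: "\<And>i. v i \<in> M2 M T W B" and src: "sq_int ST (joint \<alpha>)" "sq_int ST (joint \<beta>)"
  shows "ds_process x
       (\<lambda>t \<omega>. A *v x t \<omega> + Bc Player1 *v v Player1 t \<omega> + Bc Player2 *v v Player2 t \<omega> + C *v k t \<omega> + \<alpha> t \<omega>)
       (\<lambda>t \<omega>. D *v x t \<omega> + E *v k t \<omega> + \<beta> t \<omega>)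
       (\<lambda>t \<omega>. - k t \<omega>)"
proof -
  have x: "x \<in> M2 M T W B" and k: "k \<in> M2 M T W B" using state by (auto simp: is_state_def)
  note s = M2_sq_int[OF x] M2_sq_int[OF k] M2_sq_int[OF v] src
  show ?thesis
    unfolding ds_process_def
  proof (intro conjI ballI)
    show "x t \<in> borel_measurable (info M W B T t t)" if "t \<in> {0..T}" for t
      using M2_adapted[OF x] that by simp
    show "sq_int ST (joint (\<lambda>t \<omega>. A *v x t \<omega> + Bc Player1 *v v Player1 t \<omega> + Bc Player2 *v v Player2 t \<omega> + C *v k t \<omega> + \<alpha> t \<omega>))"
      using s unfolding joint_def[abs_def] by (intro sq_int_add sq_int_mult_vec)
    show "sq_int ST (joint (\<lambda>t \<omega>. D *v x t \<omega> + E *v k t \<omega> + \<beta> t \<omega>))"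
      using s unfolding joint_def[abs_def] by (intro sq_int_add sq_int_mult_vec)
    show "sq_int ST (joint (\<lambda>t \<omega>. - k t \<omega>))"
      using s unfolding joint_def[abs_def] by (intro sq_int_minus)
  qed (use state M2_sq_int[OF x] in \<open>simp_all add: is_state_def\<close>)
qed

end

lemma matrix_vector_mult_minus: "(A :: real^'n^'m) *v (- z) = - (A *v z)"
  by (rule linear_neg[OF matrix_vector_mul_linear])

lemma matrix_inv_right: "invertible A \<Longrightarrow> A ** matrix_inv A = mat 1"
  unfolding invertible_def matrix_inv_def by (rule someI2_ex) auto

theorem theorem17:
  fixes M :: "'a measure" and T :: real and W B :: "real \<Rightarrow> 'a \<Rightarrow> real"
    and A C D E :: "real^'n^'n"
    and Bc :: "player \<Rightarrow> real^'k^'n"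
    and \<alpha> \<beta> :: "real \<Rightarrow> 'a \<Rightarrow> real^'n" and a :: "real^'n"
    and Q R P :: "player \<Rightarrow> real^'n^'n" and N :: "player \<Rightarrow> real^'k^'k"
    and x k :: "real \<Rightarrow> 'a \<Rightarrow> real^'n"
    and y h :: "player \<Rightarrow> real \<Rightarrow> 'a \<Rightarrow> real^'n"
    and u :: "player \<Rightarrow> real \<Rightarrow> 'a \<Rightarrow> real^'k"
  assumes basis: "doubly_stochastic_basis M T W B"
    and E_bounds: "0 < onorm ((*v) E)" "onorm ((*v) E) < 1"
    and sources: "adapted_process M T W B \<alpha>" "square_integrable_process M T \<alpha>"
      "adapted_process M T W B \<beta>" "square_integrable_process M T \<beta>"
    and weights: "\<And>i. nonneg_symmetric (Q i)" "\<And>i. nonneg_symmetric (R i)"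
      "\<And>i. nonneg_symmetric (P i)" "\<And>i. pos_symmetric (N i)" "\<And>i. invertible (N i)"
    and commutation: "\<And>i X. X \<in> {transpose A, transpose C, transpose D, transpose E,
        P Player1, P Player2} \<Longrightarrow> gain Bc N i ** X = X ** gain Bc N i"
    and spaces: "x \<in> M2 M T W B" "k \<in> M2 M T W B"
      "\<And>i. y i \<in> M2 M T W B" "\<And>i. h i \<in> M2 M T W B"
    and forward: "has_ds_differential M T W B x
      (\<lambda>t \<omega>. A *v x t \<omega> - gain Bc N Player1 *v y Player1 t \<omega>
              - gain Bc N Player2 *v y Player2 t \<omega> + C *v k t \<omega> + \<alpha> t \<omega>)
      (\<lambda>t \<omega>. D *v x t \<omega> + E *v k t \<omega> + \<beta> t \<omega>)
      (\<lambda>t \<omega>. - k t \<omega>)"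
    and backward: "\<And>i. has_ds_differential M T W B (y i)
      (\<lambda>t \<omega>. - (transpose A *v y i t \<omega> + transpose D *v h i t \<omega> + R i *v x t \<omega>))
      (\<lambda>t \<omega>. h i t \<omega>)
      (\<lambda>t \<omega>. - (transpose C *v y i t \<omega> + transpose E *v h i t \<omega> + P i *v k t \<omega>))"
    and initial: "AE \<omega> in M. x 0 \<omega> = a"
    and final: "\<And>i. AE \<omega> in M. y i T \<omega> = Q i *v x T \<omega>"
    and control: "\<And>i t \<omega>. t \<in> {0..T} \<Longrightarrow> u i t \<omega> = - ((matrix_inv (N i) ** transpose (Bc i)) *v y i t \<omega>)"
  shows "nash_equilibrium (\<lambda>w. w \<in> M2 M T W B)
    (game_cost M T W B A Bc C D E \<alpha> \<beta> a R N P Q) u"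
proof -
  interpret ds_basis M T W B by standard (rule basis)
  have T0: "0 \<le> T" "T \<le> T" using T_pos by auto
  have src: "sq_int ST (joint \<alpha>)" "sq_int ST (joint \<beta>)"
    using source_sq_int sources by blast+
  have u: "u i \<in> M2 M T W B" for i
    by (rule M2_linear[OF spaces(3)[of i], where L="\<lambda>z. - ((matrix_inv (N i) ** transpose (Bc i)) *v z)"])
       (auto intro: bounded_linear_minus matrix_vector_mul_bounded_linear control)
  have Bu: "Bc i *v u i t \<omega> = - (gain Bc N i *v y i t \<omega>)" if "t \<in> {0..T}" for i t \<omega>
    unfolding control[OF that] gain_def
    by (simp add: matrix_vector_mul_assoc[symmetric] matrix_vector_mult_minus)
  have Nu: "N i *v u i t \<omega> = - (transpose (Bc i) *v y i t \<omega>)" if "t \<in> {0..T}" for i t \<omega>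
  proof -
    have "N i *v (matrix_inv (N i) *v z) = z" for z
      by (simp add: matrix_vector_mul_assoc matrix_inv_right[OF weights(5)])
    then show ?thesis
      unfolding control[OF that]
      by (simp add: matrix_vector_mul_assoc[symmetric] matrix_vector_mult_minus)
  qed
  have state: "is_state M T W B A Bc C D E \<alpha> \<beta> a u x k"
    unfolding is_state_def
  proof (intro conjI spaces initial)
    show "has_ds_differential M T W B x
       (\<lambda>t \<omega>. A *v x t \<omega> + Bc Player1 *v u Player1 t \<omega> + Bc Player2 *v u Player2 t \<omega> + C *v k t \<omega> + \<alpha> t \<omega>)
       (\<lambda>t \<omega>. D *v x t \<omega> + E *v k t \<omega> + \<beta> t \<omega>) (\<lambda>t \<omega>. - k t \<omega>)"
      by (rule has_ds_differential_cong[OF _ forward]) (simp add: Bu)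
  qed
  note xs = M2_sq_int[OF spaces(1)] M2_sq_int[OF spaces(2)] and yhs = M2_sq_int[OF spaces(3)] M2_sq_int[OF spaces(4)]
  have ydp: "ds_process (y i)
      (\<lambda>t \<omega>. - (transpose A *v y i t \<omega> + transpose D *v h i t \<omega> + R i *v x t \<omega>)) (h i)
      (\<lambda>t \<omega>. - (transpose C *v y i t \<omega> + transpose E *v h i t \<omega> + P i *v k t \<omega>))" for i
    unfolding ds_process_def
  proof (intro conjI ballI)
    show "y i t \<in> borel_measurable (info M W B T t t)" if "t \<in> {0..T}" for t
      using M2_adapted[OF spaces(3)] that by simp
    show "sq_int ST (joint (\<lambda>t \<omega>. - (transpose A *v y i t \<omega> + transpose D *v h i t \<omega> + R i *v x t \<omega>)))"
      using xs yhs[of i] unfolding joint_def[abs_def] by (intro sq_int_minus sq_int_add sq_int_mult_vec)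
    show "sq_int ST (joint (\<lambda>t \<omega>. - (transpose C *v y i t \<omega> + transpose E *v h i t \<omega> + P i *v k t \<omega>)))"
      using xs yhs[of i] unfolding joint_def[abs_def] by (intro sq_int_minus sq_int_add sq_int_mult_vec)
    show "has_ds_differential M T W B (y i)
      (\<lambda>t \<omega>. - (transpose A *v y i t \<omega> + transpose D *v h i t \<omega> + R i *v x t \<omega>)) (h i)
      (\<lambda>t \<omega>. - (transpose C *v y i t \<omega> + transpose E *v h i t \<omega> + P i *v k t \<omega>))"
      using backward[of i] by simp
  qed (fact yhs)+
  have optimal: "c \<le> c'"
    if w: "w \<in> M2 M T W B" and c: "game_cost M T W B A Bc C D E \<alpha> \<beta> a R N P Q i u c"
      and c': "game_cost M T W B A Bc C D E \<alpha> \<beta> a R N P Q i (u(i := w)) c'" for i w c c'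
  proof -
    obtain x1 k1 where s1: "is_state M T W B A Bc C D E \<alpha> \<beta> a u x1 k1"
      and c_eq: "c = lq_cost M T (R i) (N i) (P i) (Q i) x1 k1 (u i)"
      using c unfolding game_cost_def by blast
    obtain x2 k2 where s2: "is_state M T W B A Bc C D E \<alpha> \<beta> a (u(i := w)) x2 k2"
      and c'_eq: "c' = lq_cost M T (R i) (N i) (P i) (Q i) x2 k2 w"
      using c' unfolding game_cost_def by auto
    have uw: "(u(i := w)) j \<in> M2 M T W B" for j using u w by simp
    note d0 = state_ds_process[OF state u src] and d1 = state_ds_process[OF s1 u src]
      and d2 = state_ds_process[OF s2 uw src]
    have M: "x1 \<in> M2 M T W B" "k1 \<in> M2 M T W B" "x2 \<in> M2 M T W B" "k2 \<in> M2 M T W B"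
      and init: "AE \<omega> in M. x1 0 \<omega> = a" "AE \<omega> in M. x2 0 \<omega> = a"
      using s1 s2 by (auto simp: is_state_def)
    note S = M2_sq_int[OF M(1)] M2_sq_int[OF M(2)] M2_sq_int[OF M(3)] M2_sq_int[OF M(4)]
      M2_sq_int[OF u[of i]] M2_sq_int[OF w]
    note x1T = ds_process_sq_int[OF d1 T0] and x2T = ds_process_sq_int[OF d2 T0]
      and xT = ds_process_sq_int[OF d0 T0] and yT = ds_process_sq_int[OF ydp[of i] T0]
    have init': "AE \<omega> in M. x 0 \<omega> = x1 0 \<omega>" "AE \<omega> in M. x2 0 \<omega> = x1 0 \<omega>"
      using initial init by (eventually_elim, simp)+
    \<comment> \<open>The adjoint processes are built from \<open>x\<close>, the cost at \<open>u\<close> from \<open>x1\<close>.\<close>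
    have eq: "AE p in ST. joint x p = joint x1 p" "AE p in ST. joint k p = joint k1 p"
      "AE \<omega> in M. x T \<omega> = x1 T \<omega>"
      by (rule linear_state_unique[OF E_bounds(2) d0 d1 xs(2) S(2), where A=A and C=C and D=D];
          simp add: matrix_vector_mult_diff_distrib init')+
    define X where "X = process_diff x2 x1"
    define K where "K = process_diff k2 k1"
    define V where "V = process_diff w (u i)"
    have joints: "joint X = (\<lambda>p. joint x2 p - joint x1 p)" "joint K = (\<lambda>p. joint k2 p - joint k1 p)"
      "joint V = (\<lambda>p. joint w p - joint (u i) p)"
      unfolding X_def K_def V_def joint_diff by (rule refl)+
    have sX: "sq_int ST (joint X)" "sq_int ST (joint K)" "sq_int ST (joint V)"
      unfolding joints by (intro sq_int_diff S)+
    have XT: "sq_int M (X T)" unfolding X_def by (intro sq_int_diff x1T x2T)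
    define b where "b = (\<lambda>t \<omega>. Bc i *v V t \<omega>)"
    have jb: "joint b = (\<lambda>p. Bc i *v joint V p)" by (simp add: b_def joint_def fun_eq_iff)
    have jR: "joint (\<lambda>t \<omega>. R i *v x t \<omega>) = (\<lambda>p. R i *v joint x p)"
      and jP: "joint (\<lambda>t \<omega>. P i *v k t \<omega>) = (\<lambda>p. P i *v joint k p)"
      by (simp_all add: joint_def fun_eq_iff)
    have dual: "ip M (X T) (y i T) = ip ST (joint b) (joint (y i))
        - ip ST (joint X) (\<lambda>p. R i *v joint x p) - ip ST (joint K) (\<lambda>p. P i *v joint k p)"
      unfolding X_def K_def jR[symmetric] jP[symmetric]
    proof (rule adjoint_duality[OF d2 d1 ydp init'(2), where b=b])
      fix t \<omega>
      show "process_diff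
          (\<lambda>t \<omega>. A *v x2 t \<omega> + Bc Player1 *v (u(i := w)) Player1 t \<omega> + Bc Player2 *v (u(i := w)) Player2 t \<omega> + C *v k2 t \<omega> + \<alpha> t \<omega>)
          (\<lambda>t \<omega>. A *v x1 t \<omega> + Bc Player1 *v u Player1 t \<omega> + Bc Player2 *v u Player2 t \<omega> + C *v k1 t \<omega> + \<alpha> t \<omega>) t \<omega>
        = A *v process_diff x2 x1 t \<omega> + b t \<omega> + C *v process_diff k2 k1 t \<omega>"
        by (cases i) (simp_all add: b_def V_def matrix_vector_mult_diff_distrib)
      show "process_diff (\<lambda>t \<omega>. D *v x2 t \<omega> + E *v k2 t \<omega> + \<beta> t \<omega>) (\<lambda>t \<omega>. D *v x1 t \<omega> + E *v k1 t \<omega> + \<beta> t \<omega>) t \<omega>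
        = D *v process_diff x2 x1 t \<omega> + E *v process_diff k2 k1 t \<omega>"
        by (simp add: matrix_vector_mult_diff_distrib)
    qed (use S sX(3) xs in \<open>auto simp: jb jR jP intro: sq_int_mult_vec\<close>)
    have ctl: "ip ST (joint b) (joint (y i)) = - ip ST (\<lambda>p. N i *v joint (u i) p) (joint V)"
    proof -
      have "ip ST (joint b) (joint (y i)) = (\<integral>p. - ((N i *v joint (u i) p) \<bullet> joint V p) \<partial>ST)"
        unfolding ip_def
      proof (rule Bochner_Integration.integral_cong[OF refl])
        fix p assume "p \<in> space ST"
        then have "snd p \<in> {0..T}" by (auto simp: space_state_time)
        then have Np: "N i *v joint (u i) p = - (transpose (Bc i) *v joint (y i) p)"
          unfolding joint_def by (rule Nu)
        have "joint b p \<bullet> joint (y i) p = joint V p \<bullet> (transpose (Bc i) *v joint (y i) p)"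
          unfolding jb by (rule inner_transpose)
        also have "\<dots> = - ((N i *v joint (u i) p) \<bullet> joint V p)"
          unfolding Np by (simp only: inner_minus_left inner_minus_right minus_minus inner_commute)
        finally show "joint b p \<bullet> joint (y i) p = - ((N i *v joint (u i) p) \<bullet> joint V p)" .
      qed
      then show ?thesis by (simp add: ip_def)
    qed
    have terminal: "ip M (\<lambda>\<omega>. Q i *v x1 T \<omega>) (X T) = ip M (X T) (y i T)"
      unfolding ip_commute[of M "X T"]
    proof (rule ip_cong_AE)
      show "AE \<omega> in M. Q i *v x1 T \<omega> = y i T \<omega>"
        using eq(3) final[of i] by eventually_elim simp
    qed (auto intro: sq_int_measurable XT yT sq_int_mult_vec x1T)
    have Rx: "ip ST (\<lambda>p. R i *v joint x1 p) (joint X) = ip ST (joint X) (\<lambda>p. R i *v joint x p)"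
      unfolding ip_commute[of ST "joint X"]
    proof (rule ip_cong_AE)
      show "AE p in ST. R i *v joint x1 p = R i *v joint x p"
        using eq(1) by eventually_elim simp
    qed (auto intro: sq_int_measurable sX xs S sq_int_mult_vec)
    have Pk: "ip ST (\<lambda>p. P i *v joint k1 p) (joint K) = ip ST (joint K) (\<lambda>p. P i *v joint k p)"
      unfolding ip_commute[of ST "joint K"]
    proof (rule ip_cong_AE)
      show "AE p in ST. P i *v joint k1 p = P i *v joint k p"
        using eq(2) by eventually_elim simp
    qed (auto intro: sq_int_measurable sX xs S sq_int_mult_vec)
    have nonneg: "transpose (R i) = R i" "\<And>z. 0 \<le> (R i *v z) \<bullet> z" "transpose (P i) = P i" "\<And>z. 0 \<le> (P i *v z) \<bullet> z"
      "transpose (Q i) = Q i" "\<And>z. 0 \<le> (Q i *v z) \<bullet> z" "transpose (N i) = N i"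
      using weights unfolding nonneg_symmetric_def pos_symmetric_def by auto
    have Nnn: "0 \<le> (N i *v z) \<bullet> z" for z
      using weights(4)[of i] unfolding pos_symmetric_def by (cases "z = 0") (auto simp: less_imp_le)
    have sum: "2 * (c' - c)
      = (ip ST (\<lambda>p. R i *v joint x2 p) (joint x2) - ip ST (\<lambda>p. R i *v joint x1 p) (joint x1))
      + (ip ST (\<lambda>p. N i *v joint w p) (joint w) - ip ST (\<lambda>p. N i *v joint (u i) p) (joint (u i)))
      + (ip ST (\<lambda>p. P i *v joint k2 p) (joint k2) - ip ST (\<lambda>p. P i *v joint k1 p) (joint k1))
      + (ip M (\<lambda>\<omega>. Q i *v x2 T \<omega>) (x2 T) - ip M (\<lambda>\<omega>. Q i *v x1 T \<omega>) (x1 T))"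
      unfolding c_eq c'_eq lq_cost_eq[OF S(1,2,5) x1T] lq_cost_eq[OF S(3,4,6) x2T] by (simp add: field_simps)
    have tR: "2 * ip ST (\<lambda>p. R i *v joint x1 p) (joint X)
        \<le> ip ST (\<lambda>p. R i *v joint x2 p) (joint x2) - ip ST (\<lambda>p. R i *v joint x1 p) (joint x1)"
      unfolding joints by (rule quadratic_form_tangent[OF nonneg(1,2) S(3,1)])
    have tN: "2 * ip ST (\<lambda>p. N i *v joint (u i) p) (joint V)
        \<le> ip ST (\<lambda>p. N i *v joint w p) (joint w) - ip ST (\<lambda>p. N i *v joint (u i) p) (joint (u i))"
      unfolding joints by (rule quadratic_form_tangent[OF nonneg(7) Nnn S(6,5)])
    have tP: "2 * ip ST (\<lambda>p. P i *v joint k1 p) (joint K)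
        \<le> ip ST (\<lambda>p. P i *v joint k2 p) (joint k2) - ip ST (\<lambda>p. P i *v joint k1 p) (joint k1)"
      unfolding joints by (rule quadratic_form_tangent[OF nonneg(3,4) S(4,2)])
    have tQ: "2 * ip M (\<lambda>\<omega>. Q i *v x1 T \<omega>) (X T)
        \<le> ip M (\<lambda>\<omega>. Q i *v x2 T \<omega>) (x2 T) - ip M (\<lambda>\<omega>. Q i *v x1 T \<omega>) (x1 T)"
      unfolding X_def by (rule quadratic_form_tangent[OF nonneg(5,6) x2T x1T])
    have zero: "ip ST (\<lambda>p. R i *v joint x1 p) (joint X) + ip ST (\<lambda>p. N i *v joint (u i) p) (joint V)
        + ip ST (\<lambda>p. P i *v joint k1 p) (joint K) + ip M (\<lambda>\<omega>. Q i *v x1 T \<omega>) (X T) = 0"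
      unfolding terminal dual ctl Rx Pk by simp
    have "0 \<le> 2 * (c' - c)"
      unfolding sum by (rule order_trans[OF _ add_mono[OF add_mono[OF add_mono[OF tR tN] tP] tQ]])
        (use zero in simp)
    then show "c \<le> c'" by simp
  qed
  show ?thesis
    unfolding nash_equilibrium_def
  proof (intro allI conjI impI)
    fix i
    show "u i \<in> M2 M T W B" by (rule u)
    show "\<exists>c. game_cost M T W B A Bc C D E \<alpha> \<beta> a R N P Q i u c"
      unfolding game_cost_def using state by blast
  next
    fix i w c c'
    assume "w \<in> M2 M T W B \<and> game_cost M T W B A Bc C D E \<alpha> \<beta> a R N P Q i u c
      \<and> game_cost M T W B A Bc C D E \<alpha> \<beta> a R N P Q i (u(i := w)) c'"
    then show "c \<le> c'" using optimal by blast
  qed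
qed

end
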